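(* Let $X$ be a first countable continuum, and for every $x\in X$ let $Y_x$ be a metrizable continuum. Then there exist a first countable continuum $Z$ and a map $\pi\colon Z\to X$ such that (a) for every $x\in X$, the pre-image $\pi^{-1}(x)$ is homeomorphic to $Y_x$; and (b) $\pi$ is ring-like and fully closed. Moreover, whenever a first countable continuum $Z$ and a map $\pi\colon Z\to X$ satisfy both (a) and (b), the following hold: (c) $\dim Z=\max\{\dim X,\dim\pi\}$; (d) if $X$ is perfectly normal, then $\operatorname{Ind}Z\leq\operatorname{Ind}X+\operatorname{Ind}\pi$; (e) if $X$ is separable, then so is $Z$; (f) if all $Y_x$ are non-degenerate continua and $P\subset Z$ is a metrizable continuum, then the image $\pi(P)$ is a single point; and (g) if $X$ and all $Y_x$ are hereditarily indecomposable, then so is $Z$; and if $X$ and all $Y_x$ are hereditarily decomposable, then so is $Z$.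
   Context: Conventions: a space is a regular $T_1$ topological space; compact spaces are Hausdorff; every map is continuous and closed. A continuum is a non-empty connected compact space; it is non-degenerate if it has more than one point. A continuum is decomposable if it is the union of two proper subcontinua; hereditarily decomposable if each of its non-degenerate subcontinua is decomposable; hereditarily indecomposable if none of its subcontinua is decomposable. A map $f\colon X\to Y$ is ring-like if for every $x\in X$ and every pair of open sets $U\ni x$ in $X$ and $V\ni f(x)$ in $Y$, there is an open set $V'\ni f(x)$ in $Y$ such that $V'\subset V$ and $f^{-1}(\operatorname{bd}V')\subset U$, where $\operatorname{bd}$ denotes the boundary. A map $f\colon X\to Y$ is fully closed if for every pair of disjoint closed sets $F,G\subset X$, the intersection $f(F)\cap f(G)$ is a discrete subspace of $Y$. $\dim$ is the covering dimension and $\operatorname{Ind}$ the large inductive dimension. For a map $f\colon X\to Y$, $\dim f=\sup\{\dim f^{-1}(y)\colon y\in Y\}$ and $\operatorname{Ind}f=\sup\{\operatorname{Ind}f^{-1}(y)\colon y\in Y\}$. *)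

theory Defs
  imports "HOL-Analysis.Analysis"
begin

section \<open>Continua\<close>

definition continuum :: "'a topology \<Rightarrow> bool" where
  "continuum X \<longleftrightarrow>
     topspace X \<noteq> {} \<and> connected_space X \<and> compact_space X \<and> Hausdorff_space X"

definition nondegenerate :: "'a topology \<Rightarrow> bool" where
  "nondegenerate X \<longleftrightarrow> (\<exists>x\<in>topspace X. \<exists>y\<in>topspace X. x \<noteq> y)"

definition subcontinuum_of :: "'a set \<Rightarrow> 'a topology \<Rightarrow> bool" where
  "subcontinuum_of K X \<longleftrightarrow> K \<subseteq> topspace X \<and> continuum (subtopology X K)"

definition decomposable :: "'a topology \<Rightarrow> bool" where
  "decomposable X \<longleftrightarrow>
     (\<exists>A B. subcontinuum_of A X \<and> A \<noteq> topspace X \<and>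
            subcontinuum_of B X \<and> B \<noteq> topspace X \<and> A \<union> B = topspace X)"

definition hereditarily_decomposable :: "'a topology \<Rightarrow> bool" where
  "hereditarily_decomposable X \<longleftrightarrow>
     (\<forall>K. subcontinuum_of K X \<and> nondegenerate (subtopology X K)
          \<longrightarrow> decomposable (subtopology X K))"

definition hereditarily_indecomposable :: "'a topology \<Rightarrow> bool" where
  "hereditarily_indecomposable X \<longleftrightarrow>
     (\<forall>K. subcontinuum_of K X \<longrightarrow> \<not> decomposable (subtopology X K))"

section \<open>Maps\<close>

text \<open>In this section continuity and closedness of \<open>f\<close> are not part of the definitions;
  they are to be assumed separately.\<close>

definition fibre :: "'a topology \<Rightarrow> ('a \<Rightarrow> 'b) \<Rightarrow> 'b \<Rightarrow> 'a topology" where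
  "fibre X f y = subtopology X {x \<in> topspace X. f x = y}"

definition ring_like :: "'a topology \<Rightarrow> 'b topology \<Rightarrow> ('a \<Rightarrow> 'b) \<Rightarrow> bool" where
  "ring_like X Y f \<longleftrightarrow>
     (\<forall>x\<in>topspace X. \<forall>U V. openin X U \<and> x \<in> U \<and> openin Y V \<and> f x \<in> V \<longrightarrow>
        (\<exists>V'. openin Y V' \<and> f x \<in> V' \<and> V' \<subseteq> V \<and>
              {z \<in> topspace X. f z \<in> Y frontier_of V'} \<subseteq> U))"

definition fully_closed :: "'a topology \<Rightarrow> 'b topology \<Rightarrow> ('a \<Rightarrow> 'b) \<Rightarrow> bool" where
  "fully_closed X Y f \<longleftrightarrow>
     (\<forall>F G. closedin X F \<and> closedin X G \<and> disjnt F G \<longrightarrow>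
        subtopology Y (f ` F \<inter> f ` G) = discrete_topology (f ` F \<inter> f ` G))"

section \<open>Perfect normality and dimension functions\<close>

definition perfectly_normal :: "'a topology \<Rightarrow> bool" where
  "perfectly_normal X \<longleftrightarrow>
     t1_space X \<and> normal_space X \<and> (\<forall>C. closedin X C \<longrightarrow> gdelta_in X C)"

text \<open>Dimensions take their values in \<open>{-1, 0, 1, \<dots>, \<infinity>}\<close>, embedded in \<^typ>\<open>ereal\<close>. The
  infimum of the admissible bounds is attained unless there are none, in which case it is
  \<open>\<infinity>\<close>. Both functions follow the usual definitions for normal spaces and give \<open>-1\<close> for
  the empty space.\<close>

text \<open>\<open>\<V>\<close> has order at most \<open>n\<close>: no point lies in more than \<open>n + 1\<close> of its members.\<close>

definition covering_dim_le :: "'a topology \<Rightarrow> int \<Rightarrow> bool" where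
  "covering_dim_le X n \<longleftrightarrow> -1 \<le> n \<and>
     (\<forall>\<U>. finite \<U> \<and> (\<forall>U\<in>\<U>. openin X U) \<and> \<Union>\<U> = topspace X \<longrightarrow>
        (\<exists>\<V>. finite \<V> \<and> (\<forall>V\<in>\<V>. openin X V) \<and> \<Union>\<V> = topspace X \<and>
             (\<forall>V\<in>\<V>. \<exists>U\<in>\<U>. V \<subseteq> U) \<and>
             (\<forall>x\<in>topspace X. int (card {V\<in>\<V>. x \<in> V}) \<le> n + 1)))"

definition covering_dim :: "'a topology \<Rightarrow> ereal" where
  "covering_dim X = Inf {ereal (real_of_int n) | n. covering_dim_le X n}"

inductive large_ind_le :: "'a topology \<Rightarrow> int \<Rightarrow> bool" where
  empty: "topspace X = {} \<Longrightarrow> large_ind_le X (-1)"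
| step: "\<lbrakk>0 \<le> n;
          \<forall>A V. closedin X A \<and> openin X V \<and> A \<subseteq> V \<longrightarrow>
            (\<exists>U. openin X U \<and> A \<subseteq> U \<and> U \<subseteq> V \<and>
                 large_ind_le (subtopology X (X frontier_of U)) (n - 1))\<rbrakk>
         \<Longrightarrow> large_ind_le X n"

definition large_ind :: "'a topology \<Rightarrow> ereal" where
  "large_ind X = Inf {ereal (real_of_int n) | n. large_ind_le X n}"

definition covering_dim_map :: "'a topology \<Rightarrow> 'b topology \<Rightarrow> ('a \<Rightarrow> 'b) \<Rightarrow> ereal" where
  "covering_dim_map X Y f = (SUP y\<in>topspace Y. covering_dim (fibre X f y))"

definition large_ind_map :: "'a topology \<Rightarrow> 'b topology \<Rightarrow> ('a \<Rightarrow> 'b) \<Rightarrow> ereal" where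
  "large_ind_map X Y f = (SUP y\<in>topspace Y. large_ind (fibre X f y))"

end

theory Submission
  imports Defs
begin

text \<open>For a fully closed map of compacta, finitely many fibres excepted, every fibre lies in a single
  member of a given finite open cover. Ring-like neighbourhoods of the finitely many exceptional
  points let one glue covers of the base to covers of the exceptional fibres, which gives (c). By
  the same neighbourhoods a subcontinuum with non-degenerate image is the full preimage of that
  image, which gives (f) and (g).

  For (d), two disjoint closed sets have images that meet in a finite set \<open>Q\<close>. Collapse all fibres
  over points outside \<open>Q\<close>: the fibres over \<open>Q\<close> are partitioned there, and the rest of the partition
  is pulled back from the base. The base needs the countable sum theorem for perfectly normal spaces.

  For the existence, each point \<open>x\<close> of \<open>X\<close> is replaced by \<open>Y x\<close> as in a resolution; as \<open>Y x\<close> need not be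
  arcwise connected, \<open>X - {x}\<close> is not mapped to \<open>Y x\<close> but to a ray in a function space whose limit
  set is \<open>Y x\<close>.\<close>

section \<open>Fully closed maps of compacta\<close>

text \<open>The frontier of a ring-like neighbourhood consists of points whose whole fibres lie in a
  prescribed open set. What is done on its two sides need not agree: at the frontier one open set,
  containing entire fibres, serves both.

  In (d) a partition over the base minus \<open>Q\<close> need not fit the one inside the fibres
  over \<open>Q\<close>, since points of these can be limits of fibres outside. So both closed sets
  are first enlarged by the two sides of the fibre partition \<open>P\<close> and separated in the
  collapsed space minus \<open>P\<close>. Its normality is the crux: it is regular and Lindelof,
  because a closed set in finitely many metrizable fibres over a perfectly normal base is G-delta,
  and its complement in a compactum is sigma-compact.

  In the construction a point near \<open>x\<close> is described by its would-be distances to the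
  points of \<open>Y x\<close>. Such functions form a convex set, so that a connected
  \<open>Y x\<close> can be traversed along short segments. The ray revisits a countable dense set
  infinitely often; hence, arbitrarily close to \<open>x\<close>, there are level sets of its
  parameter on which the would-be distance to a given \<open>y\<close> is small, and these bound the
  ring-like neighbourhoods.\<close>

definition small_image :: "'a topology \<Rightarrow> 'b topology \<Rightarrow> ('a \<Rightarrow> 'b) \<Rightarrow> 'a set \<Rightarrow> 'b set" where
  "small_image Z X f U = topspace X - f ` (topspace Z - U)"

lemma small_image_iff:
  "x \<in> small_image Z X f U \<longleftrightarrow> x \<in> topspace X \<and> (\<forall>z\<in>topspace Z. f z = x \<longrightarrow> z \<in> U)"
  by (auto simp: small_image_def)

lemma openin_subset_closure_of: "openin X U \<Longrightarrow> U \<subseteq> X closure_of U"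
  by (simp add: closure_of_subset openin_subset)

lemma regular_space_open_closure:
  assumes "regular_space X" "openin X U" "x \<in> U"
  obtains V where "openin X V" "x \<in> V" "X closure_of V \<subseteq> U"
proof -
  have "closedin X (topspace X - U)" "x \<in> topspace X - (topspace X - U)"
    using assms openin_subset by blast+
  then obtain V where "openin X V" "x \<in> V" "disjnt (topspace X - U) (X closure_of V)"
    using assms(1) unfolding regular_space by blast
  moreover have "X closure_of V \<subseteq> topspace X" by (rule closure_of_subset_topspace)
  ultimately show ?thesis using that unfolding disjnt_iff by blast
qed

locale continuous_surjection_of_compacta =
  fixes Z :: "'c topology" and X :: "'a topology" and f :: "'c \<Rightarrow> 'a"
  assumes compact_Z: "compact_space Z" and Hausdorff_Z: "Hausdorff_space Z"
    and Hausdorff_X: "Hausdorff_space X"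
    and cont: "continuous_map Z X f" and surj: "f ` topspace Z = topspace X"
begin

lemma compact_X: "compact_space X"
  using compact_Z cont surj by (metis compact_space_def image_compactin)

lemma normal_Z: "normal_space Z"
  using compact_Z Hausdorff_Z by (simp add: compact_Hausdorff_or_regular_imp_normal_space)

lemma regular_Z: "regular_space Z" and regular_X: "regular_space X"
  using compact_Z compact_X Hausdorff_Z Hausdorff_X
  by (auto intro: compact_Hausdorff_imp_regular_space)

lemma closed_map: "closed_map Z X f"
  using compact_Z Hausdorff_X cont by (simp add: continuous_imp_closed_map)

lemma closedin_image: "closedin Z C \<Longrightarrow> closedin X (f ` C)"
  using closed_map by (auto simp: closed_map_def)

lemma closedin_preimage: "closedin X C \<Longrightarrow> closedin Z {z \<in> topspace Z. f z \<in> C}"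
  using cont by (rule closedin_continuous_map_preimage)

lemma openin_preimage: "openin X U \<Longrightarrow> openin Z {z \<in> topspace Z. f z \<in> U}"
  using cont by (rule openin_continuous_map_preimage)

lemma f_in: "z \<in> topspace Z \<Longrightarrow> f z \<in> topspace X"
  using surj by blast

lemma closedin_finite_X: "finite S \<Longrightarrow> S \<subseteq> topspace X \<Longrightarrow> closedin X S"
  by (meson Hausdorff_X Hausdorff_imp_t1_space t1_space_closedin_finite)

lemma closedin_fibre: "x \<in> topspace X \<Longrightarrow> closedin Z {z \<in> topspace Z. f z = x}"
  using closedin_preimage[of "{x}"] closedin_finite_X[of "{x}"] by simp

lemma image_subset: "K \<subseteq> topspace Z \<Longrightarrow> f ` K \<subseteq> topspace X"
  using surj by (metis image_mono)

lemma fibre_nonempty: "x \<in> topspace X \<Longrightarrow> \<exists>z. z \<in> topspace Z \<and> f z = x"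
  using surj by (metis imageE)

text \<open>The complement of the small image is the image of a closed set, and \<open>f\<close> is
  a closed map. The small image, usually written f^#(U), is the device by which open sets of
  \<open>Z\<close> are carried down to \<open>X\<close>.\<close>

lemma openin_small_image: "openin Z U \<Longrightarrow> openin X (small_image Z X f U)"
  unfolding small_image_def by (intro openin_diff closedin_image openin_topspace) auto

lemma small_image_subset: "small_image Z X f U \<subseteq> f ` U"
proof
  fix x assume x: "x \<in> small_image Z X f U"
  then obtain z where "z \<in> topspace Z" "f z = x"
    using surj by (metis imageE small_image_iff)
  then show "x \<in> f ` U" using x by (auto simp: small_image_iff)
qed

end

locale fully_closed_surjection = continuous_surjection_of_compacta Z X f
  for Z :: "'c topology" and X :: "'a topology" and f +
  assumes fully_closed: "fully_closed Z X f"
begin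

text \<open>The intersection is closed in the compactum \<open>X\<close> and discrete by full
  closedness, hence finite. All finiteness statements about exceptional fibres start here.\<close>

lemma finite_image_Int:
  assumes "closedin Z F" "closedin Z G" "disjnt F G"
  shows "finite (f ` F \<inter> f ` G)"
proof -
  let ?S = "f ` F \<inter> f ` G"
  have "subtopology X ?S = discrete_topology ?S"
    using fully_closed assms unfolding fully_closed_def by blast
  moreover have "compactin X ?S"
    using compact_X assms closedin_compact_space closedin_image by blast
  ultimately show ?thesis
    by (metis compact_space_discrete_topology compact_space_subtopology)
qed

text \<open>Shrink the cover to finitely many open sets \<open>N z\<close> whose closures lie in
  members \<open>u z\<close>. A fibre contained in no member meets some \<open>N z\<close> and
  leaves \<open>u z\<close>, so its base point lies in the image of the closure of
  \<open>N z\<close> and in that of the complement of \<open>u z\<close>; these images have a finite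
  intersection.\<close>

lemma finite_fibres_not_in_cover_member:
  assumes U: "\<And>U. U \<in> \<U> \<Longrightarrow> openin Z U" and cover: "\<Union>\<U> = topspace Z"
  shows "finite (topspace X - (\<Union>U\<in>\<U>. small_image Z X f U))"
proof -
  have "\<exists>U N. U \<in> \<U> \<and> openin Z N \<and> z \<in> N \<and> Z closure_of N \<subseteq> U" if "z \<in> topspace Z" for z
    using that cover U regular_space_open_closure[OF regular_Z] by (metis UnionE)
  then obtain u N where uN: "\<And>z. z \<in> topspace Z \<Longrightarrow>
      u z \<in> \<U> \<and> openin Z (N z) \<and> z \<in> N z \<and> Z closure_of (N z) \<subseteq> u z" by metis
  have "\<exists>\<F>. finite \<F> \<and> \<F> \<subseteq> N ` topspace Z \<and> topspace Z \<subseteq> \<Union>\<F>"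
    using compact_Z uN unfolding compact_space_alt by (smt (verit) UN_I image_iff subsetI)
  then obtain T where T: "finite T" "T \<subseteq> topspace Z" "topspace Z \<subseteq> (\<Union>z\<in>T. N z)"
    by (metis finite_subset_image)
  have "finite (f ` (Z closure_of (N z)) \<inter> f ` (topspace Z - u z))" if "z \<in> T" for z
  proof (rule finite_image_Int)
    have z: "z \<in> topspace Z" using T that by blast
    show "closedin Z (topspace Z - u z)" using uN[OF z] U by blast
    show "disjnt (Z closure_of N z) (topspace Z - u z)"
      using uN[OF z] by (auto simp: disjnt_iff)
  qed simp
  moreover have "topspace X - (\<Union>U\<in>\<U>. small_image Z X f U)
      \<subseteq> (\<Union>z\<in>T. f ` (Z closure_of (N z)) \<inter> f ` (topspace Z - u z))"
  proof
    fix x assume x: "x \<in> topspace X - (\<Union>U\<in>\<U>. small_image Z X f U)"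
    then obtain w where w: "w \<in> topspace Z" "f w = x" using surj by (metis DiffD1 imageE)
    then obtain z where z: "z \<in> T" "w \<in> N z" using T(3) by auto
    then have uz: "u z \<in> \<U>" "w \<in> Z closure_of (N z)"
      using T uN[of z] openin_subset_closure_of[of Z "N z"] by auto
    then have "x \<in> f ` (Z closure_of (N z))" using w by blast
    moreover have "x \<notin> small_image Z X f (u z)" using x uz by blast
    then have "x \<in> f ` (topspace Z - u z)" using x by (auto simp: small_image_def)
    ultimately show "x \<in> (\<Union>z\<in>T. f ` (Z closure_of (N z)) \<inter> f ` (topspace Z - u z))"
      using z by blast
  qed
  ultimately show ?thesis using T(1) by (meson finite_UN finite_subset)
qed

text \<open>The danger is a point of \<open>U\<close> over \<open>Q\<close> that is a limit of
  fibres sticking out of \<open>U\<close>. Full closedness lets only finitely many fibres meet a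
  small neighbourhood and yet leave \<open>U\<close>; those not over \<open>Q\<close> can be
  deleted.\<close>

lemma openin_saturate_outside_finite:
  assumes "openin Z U" "finite Q"
  shows "openin Z {z \<in> topspace Z. f z \<in> Q \<and> z \<in> U \<or> f z \<in> small_image Z X f U}"
proof (subst openin_subopen, intro ballI)
  let ?W = "{z \<in> topspace Z. f z \<in> Q \<and> z \<in> U \<or> f z \<in> small_image Z X f U}"
  fix z assume z: "z \<in> ?W"
  then consider "f z \<in> Q" "z \<in> U" | "f z \<in> small_image Z X f U" by blast
  then show "\<exists>T. openin Z T \<and> z \<in> T \<and> T \<subseteq> ?W"
  proof cases
    case 1
    obtain N where N: "openin Z N" "z \<in> N" "Z closure_of N \<subseteq> U"
      using regular_space_open_closure[OF regular_Z assms(1) 1(2)] .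
    define E where "E = f ` (Z closure_of N) \<inter> f ` (topspace Z - U)"
    have E: "finite E" unfolding E_def
      using N assms by (intro finite_image_Int) (auto simp: disjnt_iff)
    have "openin X (topspace X - (E - Q))"
    proof (rule openin_diff[OF openin_topspace closedin_finite_X])
      show "finite (E - Q)" using E by blast
      show "E - Q \<subseteq> topspace X" using f_in by (auto simp: E_def)
    qed
    then have "openin Z (N \<inter> {z \<in> topspace Z. f z \<in> topspace X - (E - Q)})"
      using N openin_preimage by (intro openin_Int)
    moreover have "N \<inter> {z \<in> topspace Z. f z \<in> topspace X - (E - Q)} \<subseteq> ?W"
    proof
      fix w assume w: "w \<in> N \<inter> {z \<in> topspace Z. f z \<in> topspace X - (E - Q)}"
      then have wN: "w \<in> Z closure_of N" using openin_subset_closure_of[OF N(1)] by blast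
      show "w \<in> ?W"
      proof (cases "f w \<in> Q")
        case True then show ?thesis using w wN N by blast
      next
        case False
        then have "f w \<notin> f ` (topspace Z - U)" using w wN by (auto simp: E_def)
        then show ?thesis using w by (auto simp: small_image_def)
      qed
    qed
    ultimately show ?thesis using N z 1 f_in
      by (intro exI[of _ "N \<inter> {z \<in> topspace Z. f z \<in> topspace X - (E - Q)}"]) auto
  next
    case 2
    then show ?thesis using z openin_preimage[OF openin_small_image[OF assms(1)]]
      by (intro exI[of _ "{z \<in> topspace Z. f z \<in> small_image Z X f U}"]) auto
  qed
qed

end

section \<open>Subcontinua under ring-like maps\<close>

lemma two_points_if_not_subset_singleton:
  assumes "S \<subseteq> T" "S \<noteq> {}" "\<not> (\<exists>x\<in>T. S \<subseteq> {x})"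
  shows "\<exists>x\<in>S. \<exists>y\<in>S. x \<noteq> y"
proof -
  obtain x where "x \<in> S" using assms(2) by blast
  moreover have "\<not> S \<subseteq> {x}" using assms calculation by blast
  ultimately show ?thesis by blast
qed

lemma subcontinuum_of_iff:
  assumes "compact_space X" "Hausdorff_space X"
  shows "subcontinuum_of K X \<longleftrightarrow> K \<noteq> {} \<and> closedin X K \<and> connectedin X K"
proof -
  have "compactin X K \<longleftrightarrow> closedin X K"
    using assms by (meson closedin_compact_space compactin_imp_closedin)
  then show ?thesis
    unfolding subcontinuum_of_def continuum_def connectedin_def
    using assms by (auto simp: compactin_subspace Hausdorff_space_subtopology topspace_subtopology_subset closedin_subset)
qed

lemma nondegenerate_subtopology_iff:
  "K \<subseteq> topspace X \<Longrightarrow> nondegenerate (subtopology X K) \<longleftrightarrow> (\<exists>x\<in>K. \<exists>y\<in>K. x \<noteq> y)"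
  by (auto simp: nondegenerate_def)

text \<open>Being a subcontinuum is intrinsic, so it does not matter whether it is tested in
  \<open>K\<close> or in \<open>X\<close>. Decompositions of \<open>K\<close> can thus be handled as
  sets in \<open>X\<close>.\<close>

lemma decomposable_subtopology_iff:
  assumes "K \<subseteq> topspace X"
  shows "decomposable (subtopology X K) \<longleftrightarrow>
    (\<exists>A B. subcontinuum_of A X \<and> subcontinuum_of B X \<and> A \<noteq> K \<and> B \<noteq> K \<and> A \<union> B = K)"
proof -
  have "subcontinuum_of A (subtopology X K) \<longleftrightarrow> subcontinuum_of A X \<and> A \<subseteq> K" for A
    using assms by (auto simp: subcontinuum_of_def subtopology_subtopology inf.absorb2)
  then show ?thesis
    using assms unfolding decomposable_def topspace_subtopology_subset[OF assms] by blast
qed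


section \<open>Transport of decomposability along homeomorphisms\<close>

lemma homeomorphic_map_subcontinuum:
  assumes h: "homeomorphic_map X Y h" and K: "subcontinuum_of K X"
  shows "subcontinuum_of (h ` K) Y"
proof -
  have sub: "K \<subseteq> topspace X" using K by (simp add: subcontinuum_of_def)
  then have hK: "h ` K \<subseteq> topspace Y"
    using h by (metis homeomorphic_imp_surjective_map image_mono)
  have "homeomorphic_map (subtopology X K) (subtopology Y (h ` K)) h"
    using h sub hK by (intro homeomorphic_map_subtopologies) (simp_all add: inf.absorb2)
  then have hom: "subtopology X K homeomorphic_space subtopology Y (h ` K)"
    by (rule homeomorphic_map_imp_homeomorphic_space)
  then have "continuum (subtopology Y (h ` K))"
    using K homeomorphic_Hausdorff_space[OF hom] homeomorphic_compact_space[OF hom]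
      homeomorphic_connected_space[OF hom] topspace_subtopology_subset[OF sub]
      topspace_subtopology_subset[OF hK]
    unfolding subcontinuum_of_def continuum_def by (metis image_is_empty)
  then show ?thesis using hK by (simp add: subcontinuum_of_def)
qed

lemma homeomorphic_map_decomposable:
  assumes h: "homeomorphic_map X Y h" and K: "K \<subseteq> topspace X"
    and dec: "decomposable (subtopology X K)"
  shows "decomposable (subtopology Y (h ` K))"
proof -
  have hK: "h ` K \<subseteq> topspace Y"
    using h K by (metis homeomorphic_imp_surjective_map image_mono)
  have inj: "inj_on h (topspace X)" using h by (rule homeomorphic_imp_injective_map)
  obtain A B where AB: "subcontinuum_of A X" "subcontinuum_of B X" "A \<noteq> K" "B \<noteq> K" "A \<union> B = K"
    using dec K by (auto simp: decomposable_subtopology_iff)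
  have "h ` A \<noteq> h ` K" "h ` B \<noteq> h ` K"
    using AB K inj by (metis Un_subset_iff inj_on_image_eq_iff)+
  moreover have "h ` A \<union> h ` B = h ` K" using AB by blast
  ultimately show ?thesis
    using homeomorphic_map_subcontinuum[OF h AB(1)] homeomorphic_map_subcontinuum[OF h AB(2)]
    unfolding decomposable_subtopology_iff[OF hK] by blast
qed

lemma hereditarily_decomposable_homeomorphic:
  assumes "hereditarily_decomposable Y" and hom: "X homeomorphic_space Y"
  shows "hereditarily_decomposable X"
  unfolding hereditarily_decomposable_def
proof (intro allI impI, elim conjE)
  fix K assume K: "subcontinuum_of K X" and nd: "nondegenerate (subtopology X K)"
  obtain h g where hg: "homeomorphic_maps X Y h g"
    using hom by (auto simp: homeomorphic_space_def)
  then have h: "homeomorphic_map X Y h" and g: "homeomorphic_map Y X g"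
    by (auto simp: homeomorphic_maps_map)
  have sub: "K \<subseteq> topspace X" using K by (simp add: subcontinuum_of_def)
  then have gh: "g ` h ` K = K" using hg by (force simp: homeomorphic_maps_def image_iff)
  have hK: "subcontinuum_of (h ` K) Y" using homeomorphic_map_subcontinuum[OF h K] .
  then have subY: "h ` K \<subseteq> topspace Y" by (simp add: subcontinuum_of_def)
  have "nondegenerate (subtopology Y (h ` K))"
    using nd sub subY homeomorphic_imp_injective_map[OF h]
    by (auto simp: nondegenerate_subtopology_iff inj_on_def) blast
  then have "decomposable (subtopology Y (h ` K))"
    using assms hK by (simp add: hereditarily_decomposable_def)
  then show "decomposable (subtopology X K)"
    using homeomorphic_map_decomposable[OF g subY] gh by simp
qed

lemma hereditarily_indecomposable_homeomorphic:
  assumes "hereditarily_indecomposable Y" and hom: "X homeomorphic_space Y"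
  shows "hereditarily_indecomposable X"
  unfolding hereditarily_indecomposable_def
proof (intro allI impI notI)
  fix K assume K: "subcontinuum_of K X" and dec: "decomposable (subtopology X K)"
  obtain h where h: "homeomorphic_map X Y h" using hom by (auto simp: homeomorphic_space)
  have "subcontinuum_of (h ` K) Y" using homeomorphic_map_subcontinuum[OF h K] .
  moreover have "decomposable (subtopology Y (h ` K))"
    using homeomorphic_map_decomposable[OF h _ dec] K by (simp add: subcontinuum_of_def)
  ultimately show False using assms by (simp add: hereditarily_indecomposable_def)
qed

text \<open>Union of finite nets for the radii 1/(n + 1). Density is expressed by the metric because
  the construction of the ray uses it in this form.\<close>

lemma (in Metric_space) compact_imp_countable_dense:
  assumes "compact_space mtopology"
  obtains C where "countable C" "C \<subseteq> M" "\<And>x e. x \<in> M \<Longrightarrow> 0 < e \<Longrightarrow> \<exists>c\<in>C. d c x < e"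
proof -
  have "\<forall>n. \<exists>K. finite K \<and> K \<subseteq> M \<and> M \<subseteq> (\<Union>x\<in>K. mball x (inverse (Suc n)))"
    using assms compact_space_eq_mcomplete_mtotally_bounded
    by (metis inverse_positive_iff_positive mtotally_bounded_def of_nat_0_less_iff zero_less_Suc)
  then obtain K where K: "\<And>n. finite (K n)" "\<And>n. K n \<subseteq> M"
    "\<And>n. M \<subseteq> (\<Union>x\<in>K n. mball x (inverse (Suc n)))" by metis
  show ?thesis
  proof (rule that[of "\<Union>n. K n"])
    fix x and e :: real assume "x \<in> M" "0 < e"
    obtain n where "inverse (Suc n) < e" using \<open>0 < e\<close> reals_Archimedean by blast
    moreover obtain c where "c \<in> K n" "d c x < inverse (Suc n)"
      using K(3)[of n] \<open>x \<in> M\<close> by (auto simp: subset_iff)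
    ultimately show "\<exists>c\<in>\<Union>n. K n. d c x < e" by (meson UNIV_I UN_I less_trans)
  qed (use K in \<open>auto intro: countable_finite\<close>)
qed

lemma compact_metrizable_imp_separable:
  assumes "compact_space X" "metrizable_space X"
  shows "separable_space X"
proof -
  obtain M d where "Metric_space M d" and X: "X = Metric_space.mtopology M d"
    using assms(2) by (auto simp: metrizable_space_def)
  then interpret Metric_space M d by simp
  obtain C where C: "countable C" "C \<subseteq> M" "\<And>x e. x \<in> M \<Longrightarrow> 0 < e \<Longrightarrow> \<exists>c\<in>C. d c x < e"
    using compact_imp_countable_dense assms(1) X by blast
  have "M \<subseteq> mtopology closure_of C"
    unfolding metric_closure_of using C(2,3) by (force simp: commute subset_iff)
  then have "mtopology closure_of C = topspace mtopology"
    using closure_of_subset_topspace[of mtopology C] by auto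
  then show ?thesis unfolding separable_space_def X using C(1,2) by auto
qed

section \<open>Images and preimages of subcontinua\<close>

context continuous_surjection_of_compacta begin

lemma subcontinuum_image: "subcontinuum_of K Z \<Longrightarrow> subcontinuum_of (f ` K) X"
  using closedin_image connectedin_continuous_map_image[OF cont]
  by (auto simp: subcontinuum_of_iff compact_Z Hausdorff_Z compact_X Hausdorff_X)

end

text \<open>The fibres are described by topological properties instead of homeomorphisms to
  prescribed spaces, so that the family \<open>Y\<close> disappears from all arguments about a given
  map.\<close>

locale ring_like_surjection = fully_closed_surjection Z X f
  for Z :: "'c topology" and X :: "'a topology" and f +
  assumes ring_like: "ring_like Z X f"
    and connected_X: "connected_space X"
    and connected_fibre: "x \<in> topspace X \<Longrightarrow> connectedin Z {z \<in> topspace Z. f z = x}"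
    and metrizable_fibre: "x \<in> topspace X \<Longrightarrow> metrizable_space (fibre Z f x)"
begin

text \<open>\<open>V\<close> is first shrunk to \<open>V0\<close> with closure inside
  \<open>V\<close>; a ring-like neighbourhood chosen in \<open>V0\<close> then has its closure in
  \<open>V\<close>. The condition on the preimage of the frontier says that the frontier lies in a
  small image.\<close>

lemma ring_neighbourhood:
  assumes "openin Z U" "z \<in> U" "openin X V" "f z \<in> V"
  obtains W where "openin X W" "f z \<in> W" "X closure_of W \<subseteq> V"
    "X frontier_of W \<subseteq> small_image Z X f U"
proof -
  have z: "z \<in> topspace Z" using assms openin_subset by blast
  obtain V0 where V0: "openin X V0" "f z \<in> V0" "X closure_of V0 \<subseteq> V"
    using regular_space_open_closure[OF regular_X assms(3,4)] .
  obtain W where W: "openin X W" "f z \<in> W" "W \<subseteq> V0"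
    "{z \<in> topspace Z. f z \<in> X frontier_of W} \<subseteq> U"
    using ring_like[unfolded ring_like_def, THEN bspec, OF z, rule_format, of U V0] assms V0
    by auto
  show ?thesis
  proof (rule that[OF W(1,2)])
    show "X closure_of W \<subseteq> V" using closure_of_mono[OF W(3)] V0(3) by blast
    show "X frontier_of W \<subseteq> small_image Z X f U"
      using W(4) frontier_of_subset_topspace[of X W] by (auto simp: small_image_iff)
  qed
qed

text \<open>If \<open>z\<close> were outside \<open>K\<close>, there would be a ring neighbourhood
  \<open>W\<close> of \<open>x\<close> that avoids \<open>y\<close> and whose frontier carries only
  fibres disjoint from \<open>K\<close>. But the image of \<open>K\<close> is connected and meets
  both \<open>W\<close> and its complement, hence also the frontier.\<close>

lemma fibre_subset_of_nondegenerate_image: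
  assumes K: "connectedin Z K" "closedin Z K" and y: "x \<in> f ` K" "y \<in> f ` K" "x \<noteq> y"
    and z: "z \<in> topspace Z" "f z = x"
  shows "z \<in> K"
proof (rule ccontr)
  assume "z \<notin> K"
  have "f ` K \<subseteq> topspace X" using K image_subset closedin_subset by metis
  then have "y \<in> topspace X" using y by blast
  then have V: "openin X (topspace X - {y})" by (simp add: closedin_finite_X openin_diff)
  have "openin Z (topspace Z - K)" using K by blast
  then obtain W where W: "openin X W" "f z \<in> W" "X closure_of W \<subseteq> topspace X - {y}"
    "X frontier_of W \<subseteq> small_image Z X f (topspace Z - K)"
    using ring_neighbourhood[of "topspace Z - K" z "topspace X - {y}"] V z y \<open>z \<notin> K\<close> f_in[OF z(1)]
    by (metis Diff_iff singletonD)
  have "f ` K \<inter> X frontier_of W \<noteq> {}"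
  proof (rule connectedin_Int_frontier_of)
    show "connectedin X (f ` K)" using cont K(1) by (rule connectedin_continuous_map_image)
    show "f ` K \<inter> W \<noteq> {}" using W y z by blast
    show "f ` K - W \<noteq> {}" using W y openin_subset_closure_of[OF W(1)] by blast
  qed
  then obtain k where "k \<in> K" "f k \<in> small_image Z X f (topspace Z - K)" using W by blast
  then show False using K closedin_subset[OF K(2)] by (auto simp: small_image_iff)
qed

lemma subcontinuum_eq_preimage:
  assumes K: "subcontinuum_of K Z" and nd: "x \<in> f ` K" "y \<in> f ` K" "x \<noteq> y"
  shows "{z \<in> topspace Z. f z \<in> f ` K} = K"
proof -
  have K': "connectedin Z K" "closedin Z K"
    using K by (auto simp: subcontinuum_of_iff compact_Z Hausdorff_Z)
  have "z \<in> K" if "z \<in> topspace Z" "f z \<in> f ` K" for z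
    using fibre_subset_of_nondegenerate_image[OF K'] nd that by metis
  then show ?thesis using closedin_subset[OF K'(2)] by blast
qed

text \<open>Connected fibres make \<open>f\<close> monotone, and under a closed monotone surjection
  preimages of connected sets are connected.\<close>

lemma subcontinuum_preimage:
  assumes "subcontinuum_of C X"
  shows "subcontinuum_of {z \<in> topspace Z. f z \<in> C} Z"
proof -
  have C: "C \<noteq> {}" "closedin X C" "connectedin X C"
    using assms by (auto simp: subcontinuum_of_iff compact_X Hausdorff_X)
  have "monotone_map Z X f" unfolding monotone_map_def
    using connected_fibre surj by (simp add: equalityD1)
  then have "connectedin Z {z \<in> topspace Z. f z \<in> C}"
    using C monotone_closed_map[OF cont closed_map surj] by blast
  moreover obtain c where "c \<in> C" "c \<in> topspace X" using C closedin_subset by blast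
  then have "{z \<in> topspace Z. f z \<in> C} \<noteq> {}" using fibre_nonempty[of c] by auto
  ultimately show ?thesis
    using closedin_preimage[OF C(2)] by (simp add: subcontinuum_of_iff compact_Z Hausdorff_Z)
qed

lemma fibre_subcontinuum:
  assumes "subcontinuum_of K Z" "f ` K \<subseteq> {x}" "x \<in> topspace X"
  shows "subcontinuum_of K (fibre Z f x)" "subtopology (fibre Z f x) K = subtopology Z K"
proof -
  have "K \<subseteq> {z \<in> topspace Z. f z = x}"
    using assms by (auto simp: subcontinuum_of_def)
  then show "subtopology (fibre Z f x) K = subtopology Z K"
    by (simp add: fibre_def subtopology_subtopology inf.absorb2)
  with assms show "subcontinuum_of K (fibre Z f x)"
    using \<open>K \<subseteq> {z \<in> topspace Z. f z = x}\<close> by (auto simp: subcontinuum_of_def fibre_def)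
qed

text \<open>Let \<open>K\<close> have a non-degenerate image. If \<open>K\<close> is the union of
  two subcontinua, indecomposability of the image forces one of them to have the same image as
  \<open>K\<close>; both are full preimages of that image, so they coincide.\<close>

lemma hereditarily_indecomposable_total_space:
  assumes X: "hereditarily_indecomposable X"
    and Y: "\<And>x. x \<in> topspace X \<Longrightarrow> hereditarily_indecomposable (fibre Z f x)"
  shows "hereditarily_indecomposable Z"
  unfolding hereditarily_indecomposable_def
proof (intro allI impI notI)
  fix K assume K: "subcontinuum_of K Z" and dec: "decomposable (subtopology Z K)"
  have KZ: "K \<subseteq> topspace Z" using K by (simp add: subcontinuum_of_def)
  show False
  proof (cases "\<exists>x\<in>topspace X. f ` K \<subseteq> {x}")
    case True
    then show False using fibre_subcontinuum[OF K] Y dec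
      by (metis hereditarily_indecomposable_def)
  next
    case False
    have "K \<noteq> {}" using K by (simp add: subcontinuum_of_iff compact_Z Hausdorff_Z)
    then obtain x y where xy: "x \<in> f ` K" "y \<in> f ` K" "x \<noteq> y"
      using two_points_if_not_subset_singleton[OF image_subset[OF KZ] _ False] by (metis image_is_empty)
    obtain A B where AB: "subcontinuum_of A Z" "subcontinuum_of B Z" "A \<noteq> K" "B \<noteq> K" "A \<union> B = K"
      using dec KZ by (auto simp: decomposable_subtopology_iff)
    have "f ` A \<union> f ` B = f ` K" using AB by blast
    moreover have "\<not> decomposable (subtopology X (f ` K))"
      using X subcontinuum_image[OF K] by (simp add: hereditarily_indecomposable_def)
    moreover have "f ` K \<subseteq> topspace X" using KZ by (rule image_subset)
    ultimately have "f ` A = f ` K \<or> f ` B = f ` K"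
      using AB(1,2) subcontinuum_image by (metis decomposable_subtopology_iff)
    then show False
      using subcontinuum_eq_preimage[OF AB(1), of x y] subcontinuum_eq_preimage[OF AB(2), of x y]
        subcontinuum_eq_preimage[OF K xy] xy AB(3,4) by metis
  qed
qed

text \<open>A subcontinuum with non-degenerate image is a full preimage, so the preimages of two
  pieces of the image decompose it. They are proper because \<open>f\<close> is surjective.\<close>

lemma hereditarily_decomposable_total_space:
  assumes X: "hereditarily_decomposable X"
    and Y: "\<And>x. x \<in> topspace X \<Longrightarrow> hereditarily_decomposable (fibre Z f x)"
  shows "hereditarily_decomposable Z"
  unfolding hereditarily_decomposable_def
proof (intro allI impI, elim conjE)
  fix K assume K: "subcontinuum_of K Z" and nd: "nondegenerate (subtopology Z K)"
  have KZ: "K \<subseteq> topspace Z" using K by (simp add: subcontinuum_of_def)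
  show "decomposable (subtopology Z K)"
  proof (cases "\<exists>x\<in>topspace X. f ` K \<subseteq> {x}")
    case True
    then show ?thesis using fibre_subcontinuum[OF K] Y nd
      by (metis hereditarily_decomposable_def)
  next
    case False
    have "K \<noteq> {}" using K by (simp add: subcontinuum_of_iff compact_Z Hausdorff_Z)
    then obtain x y where xy: "x \<in> f ` K" "y \<in> f ` K" "x \<noteq> y"
      using two_points_if_not_subset_singleton[OF image_subset[OF KZ] _ False] by (metis image_is_empty)
    have fK: "f ` K \<subseteq> topspace X" using KZ by (rule image_subset)
    have "nondegenerate (subtopology X (f ` K))"
      using xy fK by (auto simp: nondegenerate_subtopology_iff)
    then have "decomposable (subtopology X (f ` K))"
      using X subcontinuum_image[OF K] by (simp add: hereditarily_decomposable_def)
    then obtain A B where AB: "subcontinuum_of A X" "subcontinuum_of B X"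
        "A \<noteq> f ` K" "B \<noteq> f ` K" "A \<union> B = f ` K"
      using fK by (auto simp: decomposable_subtopology_iff)
    let ?p = "\<lambda>C. {z \<in> topspace Z. f z \<in> C}"
    have eq: "?p (f ` K) = K" using subcontinuum_eq_preimage[OF K xy] .
    have fp: "f ` ?p C = C" if C: "C \<subseteq> topspace X" for C
    proof
      show "C \<subseteq> f ` ?p C"
      proof
        fix c assume c: "c \<in> C"
        then obtain z where "z \<in> topspace Z" "f z = c" using fibre_nonempty[OF subsetD[OF C c]] by auto
        then show "c \<in> f ` ?p C" using c by (intro image_eqI[of _ _ z]) auto
      qed
    qed auto
    have sub: "A \<subseteq> topspace X" "B \<subseteq> topspace X" using AB fK by auto
    have "?p A \<noteq> K" "?p B \<noteq> K" using fp[OF sub(1)] fp[OF sub(2)] AB by auto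
    moreover have "?p A \<union> ?p B = K" using eq AB(5) by blast
    ultimately show ?thesis
      using subcontinuum_preimage[OF AB(1)] subcontinuum_preimage[OF AB(2)]
      unfolding decomposable_subtopology_iff[OF KZ] by blast
  qed
qed

text \<open>A point of \<open>U\<close> has a ring neighbourhood \<open>W\<close> below it that is
  not all of \<open>X\<close>. As \<open>X\<close> is connected, the frontier of \<open>W\<close> is
  non-empty, and every fibre over it lies in \<open>U\<close>.\<close>

lemma openin_contains_fibre:
  assumes nd: "a \<in> topspace X" "b \<in> topspace X" "a \<noteq> b" and U: "openin Z U" "U \<noteq> {}"
  shows "small_image Z X f U \<noteq> {}"
proof -
  obtain z where z: "z \<in> U" "z \<in> topspace Z" using U openin_subset by blast
  obtain y where y: "y \<in> topspace X" "y \<noteq> f z" using nd by metis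
  have V: "openin X (topspace X - {y})" by (simp add: closedin_finite_X openin_diff y)
  obtain W where W: "openin X W" "f z \<in> W" "X closure_of W \<subseteq> topspace X - {y}"
    "X frontier_of W \<subseteq> small_image Z X f U"
    using ring_neighbourhood[OF U(1) z(1) V] y f_in[OF z(2)] by blast
  have "topspace X \<inter> X frontier_of W \<noteq> {}"
  proof (rule connectedin_Int_frontier_of)
    show "connectedin X (topspace X)" using connected_X by (simp add: connectedin_topspace)
    show "topspace X \<inter> W \<noteq> {}" using W f_in[OF z(2)] by blast
    show "topspace X - W \<noteq> {}" using W y openin_subset_closure_of[OF W(1)] by blast
  qed
  then show ?thesis using W by blast
qed

text \<open>Unite countable dense sets of the fibres over a countable dense set \<open>D\<close>. A
  non-empty open set contains all fibres over some non-empty open set of the base, hence a fibre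
  over a point of \<open>D\<close>. Over a single point no frontier is available, but there
  \<open>Z\<close> is itself a metrizable fibre.\<close>

lemma separable_total_space:
  assumes "separable_space X"
  shows "separable_space Z"
proof (cases "\<exists>a\<in>topspace X. \<exists>b\<in>topspace X. a \<noteq> b")
  case False
  show ?thesis
  proof (cases "topspace X = {}")
    case True
    then have "topspace Z = {}" using surj by simp
    then show ?thesis by (auto simp: separable_space_def)
  next
    case ne: False
    then obtain x where "topspace X = {x}" using False by blast
    then have "{z \<in> topspace Z. f z = x} = topspace Z" using f_in by auto
    then have "fibre Z f x = Z" by (simp add: fibre_def)
    then show ?thesis
      using compact_metrizable_imp_separable[OF compact_Z] metrizable_fibre \<open>topspace X = {x}\<close> by auto
  qed
next
  case True
  then obtain a b where ab: "a \<in> topspace X" "b \<in> topspace X" "a \<noteq> b" by blast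
  obtain D where D: "countable D" "D \<subseteq> topspace X" "X closure_of D = topspace X"
    using assms by (auto simp: separable_space_def)
  have "separable_space (fibre Z f x)" if "x \<in> D" for x
  proof (rule compact_metrizable_imp_separable)
    have "closedin X {x}" using that D by (auto intro: closedin_finite_X)
    then show "compact_space (fibre Z f x)"
      using closedin_preimage[of "{x}"] compact_Z
      by (simp add: fibre_def closedin_compact_space compact_space_subtopology)
    show "metrizable_space (fibre Z f x)" using that D metrizable_fibre by blast
  qed
  then have "\<forall>x\<in>D. \<exists>C. countable C \<and> C \<subseteq> topspace (fibre Z f x) \<and>
      fibre Z f x closure_of C = topspace (fibre Z f x)"
    by (simp add: separable_space_def)
  then obtain C where C: "\<And>x. x \<in> D \<Longrightarrow> countable (C x)"
    "\<And>x. x \<in> D \<Longrightarrow> C x \<subseteq> topspace (fibre Z f x)"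
    "\<And>x. x \<in> D \<Longrightarrow> fibre Z f x closure_of C x = topspace (fibre Z f x)" by metis
  have "z \<in> Z closure_of (\<Union>x\<in>D. C x)" if z: "z \<in> topspace Z" for z
    unfolding in_closure_of
  proof (intro conjI z allI impI, elim conjE)
    fix U assume U: "z \<in> U" "openin Z U"
    then have "small_image Z X f U \<noteq> {}" using openin_contains_fibre[OF ab U(2)] by blast
    then have "D \<inter> small_image Z X f U \<noteq> {}"
      using openin_small_image[OF U(2)] D dense_intersects_open by (metis inf.commute)
    then obtain x where x: "x \<in> D" "x \<in> small_image Z X f U" by blast
    then obtain w where "w \<in> topspace Z" "f w = x" using fibre_nonempty[of x] D by auto
    then have "fibre Z f x closure_of C x \<noteq> {}" using C(3)[OF x(1)] by (auto simp: fibre_def)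
    then have "C x \<noteq> {}" by auto
    moreover have "C x \<subseteq> U" using C(2)[OF x(1)] x(2) by (auto simp: fibre_def small_image_iff)
    ultimately show "\<exists>y. y \<in> (\<Union>x\<in>D. C x) \<and> y \<in> U" using x by blast
  qed
  moreover have "(\<Union>x\<in>D. C x) \<subseteq> topspace Z" using C(2) by (fastforce simp: fibre_def)
  ultimately show ?thesis unfolding separable_space_def
    using C(1) D(1) closure_of_subset_topspace[of Z "\<Union>x\<in>D. C x"]
    by (intro exI[of _ "\<Union>x\<in>D. C x"]) (auto simp: subset_antisym)
qed

text \<open>Extend the balls of radius 1/(n + 1) in \<open>P\<close> to open sets of
  \<open>Z\<close> and add the complement of \<open>P\<close>. A fibre containing two points of
  \<open>P\<close> at distance at least 2/(n + 1) lies in no member of this cover, so for each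
  \<open>n\<close> there are finitely many such fibres.\<close>

lemma countable_nondegenerate_fibres:
  assumes P: "closedin Z P" "metrizable_space (subtopology Z P)"
  shows "countable {x. \<exists>a\<in>P. \<exists>b\<in>P. a \<noteq> b \<and> f a = x \<and> f b = x}"
proof -
  obtain M d where "Metric_space M d" and top: "subtopology Z P = Metric_space.mtopology M d"
    using P(2) by (auto simp: metrizable_space_def)
  then interpret Metric_space M d by simp
  have "M = topspace (subtopology Z P)" by (simp add: top)
  then have M: "M = P" using closedin_subset[OF P(1)] by auto
  have cpt: "compact_space mtopology"
    using P(1) compact_Z closedin_compact_space compact_space_subtopology by (metis top)
  \<comment> \<open>Twice the radius of the balls below, so that no ball contains both
    points.\<close>
  define S where "S n = {x. \<exists>a\<in>P. \<exists>b\<in>P. d a b \<ge> 2 * inverse (Suc n) \<and> f a = x \<and> f b = x}" for n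
  have "finite (S n)" for n
  proof -
    obtain K where K: "finite K" "K \<subseteq> M" "M \<subseteq> (\<Union>x\<in>K. mball x (inverse (Suc n)))"
      using cpt compact_space_eq_mcomplete_mtotally_bounded
      by (metis inverse_positive_iff_positive mtotally_bounded_def of_nat_0_less_iff zero_less_Suc)
    have "\<exists>U. openin Z U \<and> mball x (inverse (Suc n)) = U \<inter> P" for x
      using openin_mball[of x] by (metis openin_subtopology top)
    then obtain U where U: "\<And>x. openin Z (U x)" "\<And>x. mball x (inverse (Suc n)) = U x \<inter> P" by metis
    let ?\<U> = "insert (topspace Z - P) (U ` K)"
    have cov: "finite (topspace X - (\<Union>V\<in>?\<U>. small_image Z X f V))"
    proof (rule finite_fibres_not_in_cover_member)
      show op: "openin Z V" if "V \<in> ?\<U>" for V using that U P by auto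
      show "\<Union>?\<U> = topspace Z"
      proof
        show "\<Union>?\<U> \<subseteq> topspace Z" using op openin_subset by (meson Union_least)
        have "P \<subseteq> \<Union>(U ` K)" using K(3) U(2) M by auto
        then show "topspace Z \<subseteq> \<Union>?\<U>" by blast
      qed
    qed
    have "S n \<subseteq> topspace X - (\<Union>V\<in>?\<U>. small_image Z X f V)"
    proof
      fix x assume "x \<in> S n"
      then obtain a b where ab: "a \<in> P" "b \<in> P" "d a b \<ge> 2 * inverse (Suc n)" "f a = x" "f b = x"
        by (auto simp: S_def)
      have Z: "a \<in> topspace Z" "b \<in> topspace Z" using ab P closedin_subset by auto
      have False if V: "V \<in> ?\<U>" "x \<in> small_image Z X f V" for V
      proof -
        have "a \<in> V" "b \<in> V" using that(2) ab Z by (auto simp: small_image_iff)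
        then obtain c where "c \<in> K" "a \<in> U c \<inter> P" "b \<in> U c \<inter> P" using V ab by auto
        then have *: "d c a < inverse (Suc n)" "d c b < inverse (Suc n)" "c \<in> M"
          using U(2)[of c] K(2) by auto
        then have "d a b < 2 * inverse (Suc n)"
          using triangle[of a c b] ab M commute[of a c] by auto
        then show False using ab by simp
      qed
      then show "x \<in> topspace X - (\<Union>V\<in>?\<U>. small_image Z X f V)" using Z ab f_in by blast
    qed
    then show ?thesis using cov finite_subset by blast
  qed
  moreover have "{x. \<exists>a\<in>P. \<exists>b\<in>P. a \<noteq> b \<and> f a = x \<and> f b = x} \<subseteq> (\<Union>n. S n)"
  proof clarify
    fix a b assume ab: "a \<in> P" "b \<in> P" "a \<noteq> b" "f b = f a"
    then have "0 < d a b / 2" using M by simp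
    then obtain n where "inverse (Suc n) < d a b / 2" using reals_Archimedean by blast
    then have "2 * inverse (Suc n) \<le> d a b" by simp
    then have "f a \<in> S n" unfolding S_def using ab by blast
    then show "f a \<in> (\<Union>n. S n)" by blast
  qed
  ultimately show ?thesis by (meson countable_UN countable_finite countable_subset countableI_type)
qed

text \<open>If the image had two points, \<open>P\<close> would be a full preimage and contain only
  non-degenerate fibres, so its image would be countable. A connected normal T1 space with more than
  one point is at least as large as the real line.\<close>

lemma metrizable_subcontinuum_in_fibre:
  assumes nd: "\<And>x. x \<in> topspace X \<Longrightarrow> nondegenerate (fibre Z f x)"
    and P: "subcontinuum_of P Z" "metrizable_space (subtopology Z P)"
  shows "\<exists>x. f ` P = {x}"
proof (rule ccontr)
  assume contr: "\<not> ?thesis"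
  have P': "P \<noteq> {}" "closedin Z P" "connectedin Z P"
    using P(1) by (auto simp: subcontinuum_of_iff compact_Z Hausdorff_Z)
  have "\<not> (\<exists>x\<in>topspace X. f ` P \<subseteq> {x})"
    using contr P'(1) by (metis image_is_empty subset_singletonD)
  then obtain x y where xy: "x \<in> f ` P" "y \<in> f ` P" "x \<noteq> y"
    using two_points_if_not_subset_singleton[OF image_subset[OF closedin_subset[OF P'(2)]]] P'(1)
    by (metis image_is_empty)
  have eq: "{z \<in> topspace Z. f z \<in> f ` P} = P" using subcontinuum_eq_preimage[OF P(1) xy] .
  have sub: "f ` P \<subseteq> topspace X" using P' image_subset closedin_subset by metis
  have "f ` P \<subseteq> {x. \<exists>a\<in>P. \<exists>b\<in>P. a \<noteq> b \<and> f a = x \<and> f b = x}"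
  proof
    fix w assume w: "w \<in> f ` P"
    then obtain a b where "a \<in> topspace Z" "b \<in> topspace Z" "f a = w" "f b = w" "a \<noteq> b"
      using nd[of w] sub by (auto simp: nondegenerate_def fibre_def)
    then show "w \<in> {x. \<exists>a\<in>P. \<exists>b\<in>P. a \<noteq> b \<and> f a = x \<and> f b = x}"
      using w eq by blast
  qed
  then have "countable (f ` P)"
    using countable_nondegenerate_fibres[OF P'(2) P(2)] countable_subset by blast
  moreover have "(UNIV::real set) \<lesssim> topspace (subtopology X (f ` P))"
  proof (rule connected_space_imp_card_ge)
    have "subcontinuum_of (f ` P) X" using P(1) by (rule subcontinuum_image)
    then have C: "continuum (subtopology X (f ` P))" by (simp add: subcontinuum_of_def)
    then show "connected_space (subtopology X (f ` P))" "normal_space (subtopology X (f ` P))"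
      "t1_space (subtopology X (f ` P))"
      by (auto simp: continuum_def compact_Hausdorff_or_regular_imp_normal_space Hausdorff_imp_t1_space)
    show "\<nexists>a. topspace (subtopology X (f ` P)) \<subseteq> {a}" using sub xy by auto
  qed
  ultimately show False
    using sub countable_lepoll uncountable_UNIV_real by (metis topspace_subtopology_subset)
qed

end

section \<open>Covering dimension\<close>

text \<open>The admissible bounds are integers and closed upwards, so the largest integer below
  \<open>r\<close> decides; this remains true when the infimum is minus infinity. Both dimension
  functions are evaluated through this equivalence.\<close>

lemma Inf_int_le_iff:
  fixes P :: "int \<Rightarrow> bool"
  assumes up: "\<And>n m. P n \<Longrightarrow> n \<le> m \<Longrightarrow> P m"
  shows "Inf {ereal (real_of_int n) | n. P n} \<le> ereal r \<longleftrightarrow> P \<lfloor>r\<rfloor>"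
proof
  assume "P \<lfloor>r\<rfloor>"
  then have "Inf {ereal (real_of_int n) | n. P n} \<le> ereal (real_of_int \<lfloor>r\<rfloor>)"
    by (intro Inf_lower) blast
  also have "\<dots> \<le> ereal r" by simp
  finally show "Inf {ereal (real_of_int n) | n. P n} \<le> ereal r" .
next
  assume le: "Inf {ereal (real_of_int n) | n. P n} \<le> ereal r"
  have "\<exists>n. P n \<and> n < \<lfloor>r\<rfloor> + 1"
  proof (rule ccontr)
    assume none: "\<nexists>n. P n \<and> n < \<lfloor>r\<rfloor> + 1"
    have "ereal (real_of_int (\<lfloor>r\<rfloor> + 1)) \<le> Inf {ereal (real_of_int n) | n. P n}"
    proof (rule Inf_greatest)
      fix e assume "e \<in> {ereal (real_of_int n) | n. P n}"
      then obtain n where n: "e = ereal (real_of_int n)" "P n" by blast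
      then have "real_of_int (\<lfloor>r\<rfloor> + 1) \<le> real_of_int n"
        using none by (metis not_less of_int_le_iff)
      then show "ereal (real_of_int (\<lfloor>r\<rfloor> + 1)) \<le> e" using n(1) by simp
    qed
    also have "\<dots> \<le> ereal r" by (rule le)
    finally have "real_of_int (\<lfloor>r\<rfloor> + 1) \<le> r" by (simp only: ereal_less_eq)
    then show False by linarith
  qed
  then show "P \<lfloor>r\<rfloor>" using up by auto
qed

lemma Inf_int_ge_minus_one:
  fixes P :: "int \<Rightarrow> bool"
  assumes "\<And>n. P n \<Longrightarrow> -1 \<le> n"
  shows "-1 \<le> Inf {ereal (real_of_int n) | n. P n}"
proof (rule Inf_greatest)
  fix e assume "e \<in> {ereal (real_of_int n) | n. P n}"
  then obtain n where n: "e = ereal (real_of_int n)" "P n" by blast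
  then have "real_of_int (-1) \<le> real_of_int n" using assms of_int_le_iff by blast
  then show "-1 \<le> e" unfolding n one_ereal_def by simp
qed

lemma covering_dim_le_ge: "covering_dim_le X n \<Longrightarrow> -1 \<le> n"
  by (simp add: covering_dim_le_def)

lemma covering_dim_leD:
  assumes "covering_dim_le X n" "finite \<U>" "\<And>U. U \<in> \<U> \<Longrightarrow> openin X U" "\<Union>\<U> = topspace X"
  shows "\<exists>\<V>. finite \<V> \<and> (\<forall>V\<in>\<V>. openin X V) \<and> \<Union>\<V> = topspace X \<and>
      (\<forall>V\<in>\<V>. \<exists>U\<in>\<U>. V \<subseteq> U) \<and> (\<forall>x\<in>topspace X. int (card {V\<in>\<V>. x \<in> V}) \<le> n + 1)"
  using assms(1)[unfolded covering_dim_le_def, THEN conjunct2, rule_format, of \<U>] assms(2-4)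
  by simp

lemma covering_dim_antimono:
  assumes "\<And>n. covering_dim_le Z n \<Longrightarrow> covering_dim_le X n"
  shows "covering_dim X \<le> covering_dim Z"
  unfolding covering_dim_def by (rule Inf_superset_mono) (use assms in blast)

text \<open>The refinement can be indexed by the cover itself: unite the members with a common target.\<close>

lemma covering_dim_le_indexed:
  assumes "covering_dim_le X n" "finite I" "\<And>i. i \<in> I \<Longrightarrow> openin X (U i)" "(\<Union>i\<in>I. U i) = topspace X"
  obtains V where "\<And>i. i \<in> I \<Longrightarrow> openin X (V i)" "\<And>i. i \<in> I \<Longrightarrow> V i \<subseteq> U i"
    "(\<Union>i\<in>I. V i) = topspace X"
    "\<And>x. x \<in> topspace X \<Longrightarrow> int (card {i\<in>I. x \<in> V i}) \<le> n + 1"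
proof -
  have "\<exists>\<V>. finite \<V> \<and> (\<forall>V\<in>\<V>. openin X V) \<and> \<Union>\<V> = topspace X \<and>
      (\<forall>V\<in>\<V>. \<exists>W\<in>U ` I. V \<subseteq> W) \<and> (\<forall>x\<in>topspace X. int (card {V\<in>\<V>. x \<in> V}) \<le> n + 1)"
    by (rule covering_dim_leD[OF assms(1)]) (use assms(2-4) in auto)
  then obtain \<V> where "finite \<V> \<and> (\<forall>V\<in>\<V>. openin X V) \<and> \<Union>\<V> = topspace X \<and>
      (\<forall>V\<in>\<V>. \<exists>W\<in>U ` I. V \<subseteq> W) \<and> (\<forall>x\<in>topspace X. int (card {V\<in>\<V>. x \<in> V}) \<le> n + 1)" ..
  then have \<V>: "finite \<V>" "\<And>V. V \<in> \<V> \<Longrightarrow> openin X V" "\<Union>\<V> = topspace X"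
    "\<And>V. V \<in> \<V> \<Longrightarrow> \<exists>W\<in>U ` I. V \<subseteq> W"
    "\<And>x. x \<in> topspace X \<Longrightarrow> int (card {V\<in>\<V>. x \<in> V}) \<le> n + 1" by simp_all
  have "\<forall>V\<in>\<V>. \<exists>i\<in>I. V \<subseteq> U i" using \<V>(4) by blast
  then obtain t where t: "\<And>V. V \<in> \<V> \<Longrightarrow> t V \<in> I \<and> V \<subseteq> U (t V)" by metis
  show ?thesis
  proof (rule that[of "\<lambda>i. \<Union>{V\<in>\<V>. t V = i}"])
    show "openin X (\<Union>{V\<in>\<V>. t V = i})" for i using \<V>(2) by auto
    show "\<Union>{V\<in>\<V>. t V = i} \<subseteq> U i" for i using t by blast
    show "(\<Union>i\<in>I. \<Union>{V\<in>\<V>. t V = i}) = topspace X" using \<V>(3) t by blast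
    fix x assume x: "x \<in> topspace X"
    have "{i\<in>I. x \<in> \<Union>{V\<in>\<V>. t V = i}} \<subseteq> t ` {V\<in>\<V>. x \<in> V}" by blast
    then have "card {i\<in>I. x \<in> \<Union>{V\<in>\<V>. t V = i}} \<le> card {V\<in>\<V>. x \<in> V}"
      using \<V>(1) by (simp add: surj_card_le)
    then show "int (card {i\<in>I. x \<in> \<Union>{V\<in>\<V>. t V = i}}) \<le> n + 1" using \<V>(5)[OF x] by linarith
  qed
qed

text \<open>Covers may be indexed families and the order is counted by indices: passing to the set
  of members can only lower it. The free index type makes room for covers indexed by sums and
  products.\<close>

lemma covering_dim_leI:
  assumes n: "-1 \<le> n" and
    ex: "\<And>\<U>. finite \<U> \<Longrightarrow> (\<And>U. U \<in> \<U> \<Longrightarrow> openin X U) \<Longrightarrow> \<Union>\<U> = topspace X \<Longrightarrow>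
      \<exists>(I :: 'i set) V. finite I \<and> (\<forall>i\<in>I. openin X (V i)) \<and> topspace X \<subseteq> (\<Union>i\<in>I. V i) \<and>
        (\<forall>i\<in>I. \<exists>U\<in>\<U>. V i \<subseteq> U) \<and> (\<forall>x\<in>topspace X. int (card {i\<in>I. x \<in> V i}) \<le> n + 1)"
  shows "covering_dim_le X n"
  unfolding covering_dim_le_def
proof (intro conjI n allI impI, elim conjE)
  fix \<U> assume \<U>: "finite \<U>" "\<forall>U\<in>\<U>. openin X U" "\<Union>\<U> = topspace X"
  have ex': "\<exists>(I :: 'i set) V. finite I \<and> (\<forall>i\<in>I. openin X (V i)) \<and> topspace X \<subseteq> (\<Union>i\<in>I. V i) \<and>
        (\<forall>i\<in>I. \<exists>U\<in>\<U>. V i \<subseteq> U) \<and> (\<forall>x\<in>topspace X. int (card {i\<in>I. x \<in> V i}) \<le> n + 1)"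
    by (rule ex) (use \<U> in auto)
  obtain I :: "'i set" and V where I: "finite I" "\<And>i. i \<in> I \<Longrightarrow> openin X (V i)"
     "topspace X \<subseteq> (\<Union>i\<in>I. V i)" "\<And>i. i \<in> I \<Longrightarrow> \<exists>U\<in>\<U>. V i \<subseteq> U"
     "\<And>x. x \<in> topspace X \<Longrightarrow> int (card {i\<in>I. x \<in> V i}) \<le> n + 1"
    using ex' by (elim exE conjE) (rule that; assumption?; simp)
  show "\<exists>\<V>. finite \<V> \<and> (\<forall>V\<in>\<V>. openin X V) \<and> \<Union>\<V> = topspace X \<and> (\<forall>V\<in>\<V>. \<exists>U\<in>\<U>. V \<subseteq> U) \<and>
      (\<forall>x\<in>topspace X. int (card {V\<in>\<V>. x \<in> V}) \<le> n + 1)"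
  proof (intro exI[of _ "V ` I"] conjI ballI)
    show "finite (V ` I)" using I by blast
    show "openin X W" if "W \<in> V ` I" for W using that I(2) by blast
    then have "\<Union>(V ` I) \<subseteq> topspace X" using openin_subset by (meson Union_least)
    then show "\<Union>(V ` I) = topspace X" using I(3) by blast
    show "\<exists>U\<in>\<U>. W \<subseteq> U" if "W \<in> V ` I" for W using that I(4) by blast
    fix x assume x: "x \<in> topspace X"
    have "{W \<in> V ` I. x \<in> W} \<subseteq> V ` {i\<in>I. x \<in> V i}" by blast
    then have "card {W \<in> V ` I. x \<in> W} \<le> card {i\<in>I. x \<in> V i}" using I(1) by (simp add: surj_card_le)
    then show "int (card {W \<in> V ` I. x \<in> W}) \<le> n + 1" using I(5)[OF x] by linarith
  qed
qed

lemma covering_dim_le_mono: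
  assumes "covering_dim_le X n" "n \<le> m"
  shows "covering_dim_le X m"
proof (rule covering_dim_leI)
  show "-1 \<le> m" using assms covering_dim_le_ge by fastforce
  fix \<U> assume \<U>: "finite \<U>" "\<And>U. U \<in> \<U> \<Longrightarrow> openin X U" "\<Union>\<U> = topspace X"
  from covering_dim_leD[OF assms(1) \<U>] obtain \<V> where \<V>: "finite \<V> \<and> (\<forall>V\<in>\<V>. openin X V) \<and>
      \<Union>\<V> = topspace X \<and> (\<forall>V\<in>\<V>. \<exists>U\<in>\<U>. V \<subseteq> U) \<and>
      (\<forall>x\<in>topspace X. int (card {V\<in>\<V>. x \<in> V}) \<le> n + 1)" ..
  have "int (card {V\<in>\<V>. x \<in> V}) \<le> m + 1" if "x \<in> topspace X" for x
    using \<V> that assms(2) by fastforce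
  then show "\<exists>(I :: 'a set set) V. finite I \<and> (\<forall>i\<in>I. openin X (V i)) \<and> topspace X \<subseteq> (\<Union>i\<in>I. V i) \<and>
      (\<forall>i\<in>I. \<exists>U\<in>\<U>. V i \<subseteq> U) \<and> (\<forall>x\<in>topspace X. int (card {i\<in>I. x \<in> V i}) \<le> m + 1)"
    using \<V> by (intro exI[of _ \<V>] exI[of _ "\<lambda>V. V"]) simp
qed

lemma covering_dim_le_iff: "covering_dim X \<le> ereal r \<longleftrightarrow> covering_dim_le X \<lfloor>r\<rfloor>"
  unfolding covering_dim_def
  by (rule Inf_int_le_iff[OF covering_dim_le_mono])

lemma covering_dim_ge: "-1 \<le> covering_dim X"
  unfolding covering_dim_def by (rule Inf_int_ge_minus_one[OF covering_dim_le_ge])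

lemma covering_dim_le_closed_subset:
  assumes "covering_dim_le X n" "closedin X C"
  shows "covering_dim_le (subtopology X C) n"
proof (rule covering_dim_leI)
  show "-1 \<le> n" using assms(1) by (simp add: covering_dim_le_def)
  have top: "topspace (subtopology X C) = C" using closedin_subset[OF assms(2)] by auto
  fix \<U> assume \<U>: "finite \<U>" "\<And>U. U \<in> \<U> \<Longrightarrow> openin (subtopology X C) U"
    "\<Union>\<U> = topspace (subtopology X C)"
  then have "\<forall>U\<in>\<U>. \<exists>T. openin X T \<and> U = T \<inter> C" by (simp add: openin_subtopology)
  then obtain e where e: "\<And>U. U \<in> \<U> \<Longrightarrow> openin X (e U) \<and> U = e U \<inter> C" by metis
  \<comment> \<open>The index \<open>None\<close> stands for the complement of \<open>C\<close>,
    added to obtain a cover of \<open>X\<close>; its refinement misses \<open>C\<close> and is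
    dropped at the end.\<close>
  let ?W = "\<lambda>U. case U of None \<Rightarrow> topspace X - C | Some U \<Rightarrow> e U"
  let ?I = "insert None (Some ` \<U>)"
  have fin: "finite ?I" using \<U>(1) by simp
  have op: "openin X (?W i)" if "i \<in> ?I" for i
    using that e openin_diff[OF openin_topspace assms(2)] by auto
  have "C \<subseteq> \<Union>(e ` \<U>)" using \<U>(3) top e by blast
  then have "topspace X \<subseteq> (\<Union>i\<in>?I. ?W i)" by auto
  moreover have "(\<Union>i\<in>?I. ?W i) \<subseteq> topspace X" using op openin_subset by (meson UN_least)
  ultimately have cov: "(\<Union>i\<in>?I. ?W i) = topspace X" by (rule subset_antisym[rotated])
  obtain V where V: "\<And>i. i \<in> ?I \<Longrightarrow> openin X (V i)" "\<And>i. i \<in> ?I \<Longrightarrow> V i \<subseteq> ?W i"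
    "(\<Union>i\<in>?I. V i) = topspace X" "\<And>x. x \<in> topspace X \<Longrightarrow> int (card {i\<in>?I. x \<in> V i}) \<le> n + 1"
    using covering_dim_le_indexed[OF assms(1) fin op cov] by blast
  show "\<exists>(I :: 'a set option set) V. finite I \<and> (\<forall>i\<in>I. openin (subtopology X C) (V i)) \<and>
      topspace (subtopology X C) \<subseteq> (\<Union>i\<in>I. V i) \<and> (\<forall>i\<in>I. \<exists>U\<in>\<U>. V i \<subseteq> U) \<and>
      (\<forall>x\<in>topspace (subtopology X C). int (card {i\<in>I. x \<in> V i}) \<le> n + 1)"
  proof (intro exI[of _ "Some ` \<U>"] exI[of _ "\<lambda>i. V i \<inter> C"] conjI ballI)
    show "finite (Some ` \<U>)" using \<U>(1) by simp
    show "openin (subtopology X C) (V i \<inter> C)" if "i \<in> Some ` \<U>" for i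
      using V(1)[of i] that by (simp add: openin_subtopology_Int)
    show "topspace (subtopology X C) \<subseteq> (\<Union>i\<in>Some ` \<U>. V i \<inter> C)"
    proof
      fix x assume "x \<in> topspace (subtopology X C)"
      then have x: "x \<in> topspace X" "x \<in> C" by auto
      then obtain i where "i \<in> ?I" "x \<in> V i" using V(3) by auto
      moreover have "i \<noteq> None" using V(2)[of None] x \<open>x \<in> V i\<close> by (cases i) auto
      ultimately show "x \<in> (\<Union>i\<in>Some ` \<U>. V i \<inter> C)" using x by auto
    qed
    show "\<exists>U\<in>\<U>. V i \<inter> C \<subseteq> U" if i: "i \<in> Some ` \<U>" for i
    proof -
      obtain U where "U \<in> \<U>" "i = Some U" using i by blast
      then show ?thesis using V(2)[of i] e[of U] by auto
    qed
    fix x assume "x \<in> topspace (subtopology X C)"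
    then have x: "x \<in> topspace X" by auto
    have "card {i\<in>Some ` \<U>. x \<in> V i \<inter> C} \<le> card {i\<in>?I. x \<in> V i}"
      using fin by (intro card_mono) auto
    then show "int (card {i\<in>Some ` \<U>. x \<in> V i \<inter> C}) \<le> n + 1" using V(4)[OF x] by linarith
  qed
qed

text \<open>Finitely many open sets with closures inside members cover the compact set. Those
  assigned to the same index are united; closure commutes with such finite unions.\<close>

lemma compactin_cover_shrink:
  assumes "compactin Z F" "regular_space Z" and e: "\<And>i. i \<in> I \<Longrightarrow> openin Z (e i)" "F \<subseteq> (\<Union>i\<in>I. e i)"
  obtains O' where "\<And>i. openin Z (O' i)" "\<And>i. i \<in> I \<Longrightarrow> Z closure_of (O' i) \<subseteq> e i"
    "F \<subseteq> (\<Union>i\<in>I. O' i)"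
proof -
  have "\<exists>i N. i \<in> I \<and> openin Z N \<and> z \<in> N \<and> Z closure_of N \<subseteq> e i" if z: "z \<in> F" for z
  proof -
    obtain i where i: "i \<in> I" "z \<in> e i" using z e(2) by blast
    then show ?thesis using regular_space_open_closure[OF assms(2) e(1)[OF i(1)] i(2)] by metis
  qed
  then obtain i N where iN: "\<And>z. z \<in> F \<Longrightarrow> i z \<in> I \<and> openin Z (N z) \<and> z \<in> N z \<and>
      Z closure_of (N z) \<subseteq> e (i z)" by metis
  have "\<exists>\<F>. finite \<F> \<and> \<F> \<subseteq> N ` F \<and> F \<subseteq> \<Union>\<F>"
    by (rule compactinD[OF assms(1)]) (use iN in auto)
  then obtain T where T: "finite T" "T \<subseteq> F" "F \<subseteq> (\<Union>z\<in>T. N z)"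
    by (metis finite_subset_image)
  show ?thesis
  proof (rule that[of "\<lambda>j. \<Union>z\<in>{z\<in>T. i z = j}. N z"])
    fix j
    show "openin Z (\<Union>z\<in>{z\<in>T. i z = j}. N z)" using iN T(2) by (intro openin_Union) auto
    have "Z closure_of (\<Union>z\<in>{z\<in>T. i z = j}. N z) = (\<Union>z\<in>{z\<in>T. i z = j}. Z closure_of N z)"
      using T(1) closure_of_Union[of "N ` {z\<in>T. i z = j}" Z] by simp
    also have "\<dots> \<subseteq> e j" using iN T(2) by fastforce
    finally show "Z closure_of (\<Union>z\<in>{z\<in>T. i z = j}. N z) \<subseteq> e j" .
  next
    show "F \<subseteq> (\<Union>j\<in>I. \<Union>z\<in>{z\<in>T. i z = j}. N z)"
    proof
      fix w assume "w \<in> F"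
      then obtain z where "z \<in> T" "w \<in> N z" using T(3) by auto
      then show "w \<in> (\<Union>j\<in>I. \<Union>z\<in>{z\<in>T. i z = j}. N z)"
        using iN[of z] T(2) by (intro UN_I[of "i z"]) auto
    qed
  qed
qed

text \<open>Lying in more than \<open>k\<close> of the sets means lying in all sets of some
  subfamily with more than \<open>k\<close> indices. There are finitely many subfamilies, each
  giving a closed intersection.\<close>

lemma closedin_card_gt:
  assumes "finite I" "\<And>i. i \<in> I \<Longrightarrow> closedin Z (C i)"
  shows "closedin Z {z \<in> topspace Z. k < card {i\<in>I. z \<in> C i}}"
proof -
  have "{z \<in> topspace Z. k < card {i\<in>I. z \<in> C i}} =
      (\<Union>J\<in>{J. J \<subseteq> I \<and> k < card J}. {z \<in> topspace Z. \<forall>i\<in>J. z \<in> C i})" (is "?L = ?R")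
  proof
    show "?L \<subseteq> ?R"
    proof
      fix z assume "z \<in> ?L"
      then show "z \<in> ?R" by (intro UN_I[of "{i\<in>I. z \<in> C i}"]) auto
    qed
    show "?R \<subseteq> ?L"
    proof
      fix z assume "z \<in> ?R"
      then obtain J where J: "J \<subseteq> I" "k < card J" "z \<in> topspace Z" "\<forall>i\<in>J. z \<in> C i" by blast
      then have "card J \<le> card {i\<in>I. z \<in> C i}" using assms(1) by (intro card_mono) auto
      then show "z \<in> ?L" using J by simp
    qed
  qed
  moreover have "closedin Z {z \<in> topspace Z. \<forall>i\<in>J. z \<in> C i}" if "J \<subseteq> I" for J
  proof -
    have "{z \<in> topspace Z. \<forall>i\<in>J. z \<in> C i} = topspace Z - (\<Union>i\<in>J. topspace Z - C i)" by auto
    moreover have "openin Z (\<Union>i\<in>J. topspace Z - C i)"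
      using that assms(2) by (intro openin_Union) auto
    ultimately show ?thesis by (simp add: closedin_diff)
  qed
  ultimately show ?thesis using assms(1) by (auto intro!: closedin_Union)
qed

section \<open>Covering dimension of the base and of the total space\<close>

context ring_like_surjection begin

text \<open>The points of \<open>B\<close> are separated from each other before the ring
  neighbourhoods are chosen inside the separating sets; this makes the closures disjoint.\<close>

lemma finitely_many_ring_neighbourhoods:
  assumes B: "finite B" and z: "\<And>x. x \<in> B \<Longrightarrow> z x \<in> U x \<and> f (z x) = x"
    and U: "\<And>x. x \<in> B \<Longrightarrow> openin Z (U x)" and V: "\<And>x. x \<in> B \<Longrightarrow> openin X (V x) \<and> x \<in> V x"
  obtains W where "\<And>x. x \<in> B \<Longrightarrow> openin X (W x) \<and> x \<in> W x \<and> X closure_of (W x) \<subseteq> V x \<and>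
      X frontier_of (W x) \<subseteq> small_image Z X f (U x)"
    "\<And>x y. x \<in> B \<Longrightarrow> y \<in> B \<Longrightarrow> x \<noteq> y \<Longrightarrow> disjnt (X closure_of (W x)) (X closure_of (W y))"
proof -
  have BX: "B \<subseteq> topspace X" using V openin_subset by blast
  have "\<forall>x\<in>B. \<forall>y\<in>B. \<exists>S T. x \<noteq> y \<longrightarrow> openin X S \<and> openin X T \<and> x \<in> S \<and> y \<in> T \<and> disjnt S T"
    using Hausdorff_X BX unfolding Hausdorff_space_def by (metis subsetD)
  then obtain S T where ST: "\<And>x y. x \<in> B \<Longrightarrow> y \<in> B \<Longrightarrow> x \<noteq> y \<Longrightarrow>
      openin X (S x y) \<and> openin X (T x y) \<and> x \<in> S x y \<and> y \<in> T x y \<and> disjnt (S x y) (T x y)" by metis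
  \<comment> \<open>Both \<open>S x y\<close> and \<open>T y x\<close> are neighbourhoods of
    \<open>x\<close>: the ordered pairs (x, y) and (y, x) were separated independently. The factor
    \<open>topspace X\<close> takes over when the indexed intersection is empty.\<close>
  define N where "N x = V x \<inter> (topspace X \<inter> (\<Inter>y\<in>B - {x}. S x y \<inter> T y x))" for x
  have N: "openin X (N x) \<and> x \<in> N x" if "x \<in> B" for x
  proof
    have "openin X (topspace X \<inter> (\<Inter>y\<in>B - {x}. S x y \<inter> T y x))"
    proof (cases "B - {x} = {}")
      case False
      then have "openin X (\<Inter>y\<in>B - {x}. S x y \<inter> T y x)"
        using B ST that by (intro openin_Inter) auto
      then show ?thesis by blast
    qed (simp only: INT_empty Int_UNIV_right openin_topspace)
    then show "openin X (N x)" unfolding N_def using V that by blast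
    show "x \<in> N x" unfolding N_def using V that BX ST by auto
  qed
  have dis: "disjnt (N x) (N y)" if "x \<in> B" "y \<in> B" "x \<noteq> y" for x y
    using ST[OF that] that by (auto simp: N_def disjnt_iff)
  have "\<exists>W. openin X W \<and> x \<in> W \<and> X closure_of W \<subseteq> N x \<and>
      X frontier_of W \<subseteq> small_image Z X f (U x)" if "x \<in> B" for x
    using ring_neighbourhood[of "U x" "z x" "N x"] U z N that by metis
  then obtain W where W: "\<And>x. x \<in> B \<Longrightarrow> openin X (W x) \<and> x \<in> W x \<and> X closure_of W x \<subseteq> N x \<and>
      X frontier_of W x \<subseteq> small_image Z X f (U x)" by metis
  show ?thesis
  proof (rule that[of W])
    show "openin X (W x) \<and> x \<in> W x \<and> X closure_of W x \<subseteq> V x \<and>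
      X frontier_of W x \<subseteq> small_image Z X f (U x)" if "x \<in> B" for x
      using W[OF that] by (auto simp: N_def)
    show "disjnt (X closure_of W x) (X closure_of W y)" if "x \<in> B" "y \<in> B" "x \<noteq> y" for x y
      using dis[OF that] W[OF that(1)] W[OF that(2)] by (meson disjnt_subset1 disjnt_subset2)
  qed
qed

text \<open>Small images carry a refinement of the pulled-back cover down to \<open>X\<close>,
  except for finitely many points. Each of these receives a ring neighbourhood \<open>W x\<close>
  inside one member \<open>c x\<close>, and within \<open>W x\<close> no other member is
  used.\<close>

lemma covering_dim_le_base:
  assumes dim: "covering_dim_le Z n" and ne: "0 \<le> n"
  shows "covering_dim_le X n"
proof (rule covering_dim_leI)
  show "-1 \<le> n" using ne by simp
  fix \<U> assume \<U>: "finite \<U>" "\<And>U. U \<in> \<U> \<Longrightarrow> openin X U" "\<Union>\<U> = topspace X"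
  define U' where "U' U = {z \<in> topspace Z. f z \<in> U}" for U
  have "\<And>U. U \<in> \<U> \<Longrightarrow> openin Z (U' U)" unfolding U'_def using \<U>(2) openin_preimage by blast
  moreover have "(\<Union>U\<in>\<U>. U' U) = topspace Z" using \<U>(3) f_in by (fastforce simp: U'_def)
  ultimately obtain V where V: "\<And>U. U \<in> \<U> \<Longrightarrow> openin Z (V U)" "\<And>U. U \<in> \<U> \<Longrightarrow> V U \<subseteq> U' U"
    "(\<Union>U\<in>\<U>. V U) = topspace Z" "\<And>x. x \<in> topspace Z \<Longrightarrow> int (card {U\<in>\<U>. x \<in> V U}) \<le> n + 1"
    using covering_dim_le_indexed[OF dim \<U>(1), of U'] by blast
  define s where "s U = small_image Z X f (V U)" for U
  define B where "B = topspace X - (\<Union>U\<in>\<U>. s U)"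
  have "finite (topspace X - (\<Union>W\<in>V ` \<U>. small_image Z X f W))"
    using V by (intro finite_fibres_not_in_cover_member) auto
  then have B: "finite B" by (simp add: B_def s_def)
  have "\<forall>x\<in>B. \<exists>z U. z \<in> topspace Z \<and> f z = x \<and> U \<in> \<U> \<and> z \<in> V U"
    using V(3) fibre_nonempty unfolding B_def by (metis DiffD1 UN_E)
  then obtain z c where zc: "\<And>x. x \<in> B \<Longrightarrow> z x \<in> topspace Z \<and> f (z x) = x \<and> c x \<in> \<U> \<and> z x \<in> V (c x)"
    by metis
  have cx: "openin X (c x) \<and> x \<in> c x" if "x \<in> B" for x
    using zc[OF that] V(2)[of "c x"] \<U>(2)[of "c x"] by (auto simp: U'_def)
  obtain W where W: "\<And>x. x \<in> B \<Longrightarrow> openin X (W x) \<and> x \<in> W x \<and> X closure_of W x \<subseteq> c x \<and>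
      X frontier_of W x \<subseteq> small_image Z X f (V (c x))"
    "\<And>x y. x \<in> B \<Longrightarrow> y \<in> B \<Longrightarrow> x \<noteq> y \<Longrightarrow> disjnt (X closure_of W x) (X closure_of W y)"
    by (rule finitely_many_ring_neighbourhoods[of B z "\<lambda>x. V (c x)" c]) (use B zc V(1) cx in auto)
  \<comment> \<open>\<open>W x\<close> goes to the index \<open>c x\<close> alone, and sets with
    other indices retreat from its closure. Frontier points of \<open>W x\<close> stay covered: they
    lie in \<open>s (c x)\<close>, and no other neighbourhood has them in its closure.\<close>
  define G where "G U = (s U - (\<Union>x\<in>{x\<in>B. c x \<noteq> U}. X closure_of W x)) \<union> (\<Union>x\<in>{x\<in>B. c x = U}. W x)" for U
  have sU: "s U \<subseteq> U" if "U \<in> \<U>" for U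
    using small_image_subset[of "V U"] V(2)[OF that] by (auto simp: s_def U'_def)
  have clW: "W x \<subseteq> X closure_of W x" if "x \<in> B" for x using W(1)[OF that] openin_subset_closure_of by blast
  show "\<exists>(I :: 'a set set) V. finite I \<and> (\<forall>i\<in>I. openin X (V i)) \<and> topspace X \<subseteq> (\<Union>i\<in>I. V i) \<and>
      (\<forall>i\<in>I. \<exists>U\<in>\<U>. V i \<subseteq> U) \<and> (\<forall>x\<in>topspace X. int (card {i\<in>I. x \<in> V i}) \<le> n + 1)"
  proof (intro exI[of _ \<U>] exI[of _ G] conjI ballI)
    show "finite \<U>" by fact
    fix U assume U: "U \<in> \<U>"
    show "openin X (G U)" unfolding G_def
    proof (intro openin_Un openin_diff closedin_Union)
      show "openin X (s U)" using V(1)[OF U] by (simp add: s_def openin_small_image)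
      show "openin X (\<Union>x\<in>{x\<in>B. c x = U}. W x)" using W(1) by blast
    qed (use B in auto)
    show "\<exists>U'\<in>\<U>. G U \<subseteq> U'"
    proof (intro bexI[OF _ U])
      have "W x \<subseteq> U" if "x \<in> B" "c x = U" for x using W(1)[OF that(1)] clW[OF that(1)] that by blast
      then show "G U \<subseteq> U" using sU[OF U] by (auto simp: G_def)
    qed
  next
    show "topspace X \<subseteq> (\<Union>U\<in>\<U>. G U)"
    proof
      fix p assume p: "p \<in> topspace X"
      consider x where "x \<in> B" "p \<in> W x" | x where "x \<in> B" "p \<in> X closure_of W x" "p \<notin> W x"
        | "\<And>x. x \<in> B \<Longrightarrow> p \<notin> X closure_of W x" by blast
      then show "p \<in> (\<Union>U\<in>\<U>. G U)"
      proof cases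
        case 1 then show ?thesis using zc[OF 1(1)] by (auto simp: G_def)
      next
        case 2
        then have "p \<in> s (c x)" using W(1)[OF 2(1)] by (auto simp: frontier_of_openin s_def)
        moreover have "p \<notin> X closure_of W y" if "y \<in> B" "c y \<noteq> c x" for y
          using W(2)[OF 2(1) that(1)] that 2 by (auto simp: disjnt_iff)
        ultimately show ?thesis using zc[OF 2(1)] by (auto simp: G_def)
      next
        case 3
        have "p \<notin> B" using W(1)[of p] clW[of p] 3[of p] by blast
        then obtain U where "U \<in> \<U>" "p \<in> s U" using p by (auto simp: B_def)
        then show ?thesis using 3 by (auto simp: G_def)
      qed
    qed
    fix p assume p: "p \<in> topspace X"
    show "int (card {U\<in>\<U>. p \<in> G U}) \<le> n + 1"
    proof (cases "\<exists>x\<in>B. p \<in> W x")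
      case True
      then obtain x where x: "x \<in> B" "p \<in> W x" by blast
      have "{U\<in>\<U>. p \<in> G U} \<subseteq> {c x}"
      proof clarsimp
        fix U assume U: "U \<in> \<U>" "p \<in> G U"
        have "y = x" if "y \<in> B" "p \<in> W y" for y
          using W(2)[OF x(1) that(1)] clW[OF x(1)] clW[OF that(1)] x that by (auto simp: disjnt_iff)
        then have "c x = U" if "p \<in> (\<Union>y\<in>{y\<in>B. c y = U}. W y)" using that by blast
        moreover have "c x = U" if "p \<notin> (\<Union>y\<in>{y\<in>B. c y \<noteq> U}. X closure_of W y)"
          using that x clW[OF x(1)] by blast
        ultimately show "U = c x" using U(2) unfolding G_def by blast
      qed
      then have "card {U\<in>\<U>. p \<in> G U} \<le> 1"
        using card_mono[of "{c x}"] by fastforce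
      \<comment> \<open>A single member contains the points of \<open>W x\<close>; this is
        admissible for every \<open>n\<close> from 0 on.\<close>
      then show ?thesis using ne by linarith
    next
      case False
      \<comment> \<open>Outside all the sets \<open>W x\<close>, membership of \<open>p\<close> in
        \<open>G U\<close> puts the whole fibre into \<open>V U\<close>, so any point
        \<open>w\<close> of the fibre can do the counting.\<close>
      obtain w where w: "w \<in> topspace Z" "f w = p" using fibre_nonempty[OF p] by blast
      have "{U\<in>\<U>. p \<in> G U} \<subseteq> {U\<in>\<U>. w \<in> V U}"
        using False w by (auto simp: G_def s_def small_image_iff)
      then have "card {U\<in>\<U>. p \<in> G U} \<le> card {U\<in>\<U>. w \<in> V U}" using \<U>(1) by (intro card_mono) auto
      then show ?thesis using V(4)[OF w(1)] by linarith
    qed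
  qed
qed

text \<open>Extend a refinement on the fibre to open sets of \<open>Z\<close> and shrink these, so
  that on the fibre even their closures stay inside the refinement. The points lying in too many
  closures form a closed set that misses the fibre and is removed.\<close>

lemma fibre_order_neighbourhood:
  assumes x: "x \<in> topspace X" and dim: "covering_dim_le (fibre Z f x) n"
    and \<U>: "finite \<U>" "\<And>U. U \<in> \<U> \<Longrightarrow> openin Z U" "\<Union>\<U> = topspace Z"
  shows "\<exists>O' N. (\<forall>U. openin Z (O' U)) \<and> (\<forall>U\<in>\<U>. O' U \<subseteq> U) \<and>
    openin Z N \<and> {z \<in> topspace Z. f z = x} \<subseteq> N \<and> N \<subseteq> (\<Union>U\<in>\<U>. O' U) \<and>
    (\<forall>z\<in>N. int (card {U\<in>\<U>. z \<in> O' U}) \<le> n + 1)"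
proof -
  define F where "F = {z \<in> topspace Z. f z = x}"
  have top: "topspace (fibre Z f x) = F" by (auto simp: fibre_def F_def)
  have "openin (fibre Z f x) (U \<inter> F)" if "U \<in> \<U>" for U
    using \<U>(2)[OF that] by (simp add: fibre_def F_def openin_subtopology_Int)
  moreover have "(\<Union>U\<in>\<U>. U \<inter> F) = topspace (fibre Z f x)"
    using \<U>(3) unfolding top by (auto simp: F_def)
  ultimately have cov_F: "\<And>U. U \<in> \<U> \<Longrightarrow> openin (fibre Z f x) (U \<inter> F)"
    "(\<Union>U\<in>\<U>. U \<inter> F) = topspace (fibre Z f x)" by simp_all
  obtain E where E: "\<And>U. U \<in> \<U> \<Longrightarrow> openin (fibre Z f x) (E U)"
    "\<And>U. U \<in> \<U> \<Longrightarrow> E U \<subseteq> U \<inter> F" "(\<Union>U\<in>\<U>. E U) = topspace (fibre Z f x)"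
    "\<And>z. z \<in> topspace (fibre Z f x) \<Longrightarrow> int (card {U\<in>\<U>. z \<in> E U}) \<le> n + 1"
    by (rule covering_dim_le_indexed[OF dim \<U>(1) cov_F]) (assumption, rule that)
  have "\<forall>U\<in>\<U>. \<exists>T. openin Z T \<and> E U = T \<inter> F"
    using E(1) by (simp add: fibre_def F_def openin_subtopology)
  then obtain e where e: "\<And>U. U \<in> \<U> \<Longrightarrow> openin Z (e U) \<and> E U = e U \<inter> F" by metis
  have F: "closedin Z F" using closedin_fibre[OF x] by (simp add: F_def)
  then have cF: "compactin Z F" using compact_Z by (simp add: closedin_compact_space)
  have op: "openin Z (e U \<inter> U)" if "U \<in> \<U>" for U using e \<U>(2) that by blast
  have cov: "F \<subseteq> (\<Union>U\<in>\<U>. e U \<inter> U)" using E(2,3) e unfolding top by blast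
  obtain O' where O': "\<And>U. openin Z (O' U)" "\<And>U. U \<in> \<U> \<Longrightarrow> Z closure_of (O' U) \<subseteq> e U \<inter> U"
    "F \<subseteq> (\<Union>U\<in>\<U>. O' U)"
    by (rule compactin_cover_shrink[OF cF regular_Z, of \<U> "\<lambda>U. e U \<inter> U"]) (use op cov in auto)
  \<comment> \<open>Counting closures instead of the sets themselves makes \<open>S\<close> closed.
    The conversion \<open>nat (n + 1)\<close> yields 0 for the smallest admissible value -1.\<close>
  define S where "S = {z \<in> topspace Z. nat (n + 1) < card {U\<in>\<U>. z \<in> Z closure_of (O' U)}}"
  have clS: "closedin Z S" unfolding S_def by (rule closedin_card_gt[OF \<U>(1)]) simp
  have ge: "-1 \<le> n" using dim by (rule covering_dim_le_ge)
  have sub: "O' U \<subseteq> Z closure_of (O' U)" for U using O'(1) by (rule openin_subset_closure_of)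
  show ?thesis
  proof (intro exI[of _ O'] exI[of _ "(\<Union>U\<in>\<U>. O' U) - S"] conjI ballI)
    show "\<forall>U. openin Z (O' U)" using O'(1) by blast
    show "openin Z ((\<Union>U\<in>\<U>. O' U) - S)" using O'(1) clS by (intro openin_diff openin_Union) auto
    show "O' U \<subseteq> U" if "U \<in> \<U>" for U using O'(2)[OF that] sub by blast
    have "z \<notin> S" if "z \<in> F" for z
    proof -
      have "{U\<in>\<U>. z \<in> Z closure_of (O' U)} \<subseteq> {U\<in>\<U>. z \<in> E U}" using O'(2) e that by blast
      then have "card {U\<in>\<U>. z \<in> Z closure_of (O' U)} \<le> card {U\<in>\<U>. z \<in> E U}"
        using \<U>(1) by (intro card_mono) auto
      moreover have "int (card {U\<in>\<U>. z \<in> E U}) \<le> n + 1" using E(4)[of z] that by (simp add: top)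
      ultimately have "\<not> nat (n + 1) < card {U\<in>\<U>. z \<in> Z closure_of (O' U)}" by linarith
      then show ?thesis by (simp add: S_def)
    qed
    then show "{z \<in> topspace Z. f z = x} \<subseteq> (\<Union>U\<in>\<U>. O' U) - S"
      using O'(3) by (auto simp: F_def)
    fix z assume z: "z \<in> (\<Union>U\<in>\<U>. O' U) - S"
    then have "z \<in> topspace Z" using O'(1) openin_subset by blast
    then have "card {U\<in>\<U>. z \<in> Z closure_of (O' U)} \<le> nat (n + 1)" using z by (simp add: S_def)
    moreover have "card {U\<in>\<U>. z \<in> O' U} \<le> card {U\<in>\<U>. z \<in> Z closure_of (O' U)}"
      using sub \<U>(1) by (intro card_mono) auto
    ultimately show "int (card {U\<in>\<U>. z \<in> O' U}) \<le> n + 1" using ge by linarith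
  qed auto
qed

text \<open>Over the neighbourhood \<open>W x\<close> of an exceptional point the cover of the fibre
  is used, elsewhere a refinement \<open>G\<close> pulled back from the base. The frontier of
  \<open>W x\<close> is crossed by the set \<open>O' x (c x)\<close> only, which contains whole
  fibres there; hence the orders of the two covers never add up.\<close>

lemma covering_dim_le_total:
  assumes dimX: "covering_dim_le X n"
    and dimF: "\<And>x. x \<in> topspace X \<Longrightarrow> covering_dim_le (fibre Z f x) n"
  shows "covering_dim_le Z n"
proof (rule covering_dim_leI)
  show "-1 \<le> n" using dimX by (rule covering_dim_le_ge)
  fix \<U> assume \<U>: "finite \<U>" "\<And>U. U \<in> \<U> \<Longrightarrow> openin Z U" "\<Union>\<U> = topspace Z"
  define s where "s U = small_image Z X f U" for U
  have op_s: "openin X (s U)" if "openin Z U" for U unfolding s_def using openin_small_image[OF that] .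
  define B where "B = topspace X - (\<Union>U\<in>\<U>. s U)"
  have B: "finite B" unfolding B_def s_def by (rule finite_fibres_not_in_cover_member) (use \<U> in auto)
  have "\<forall>x\<in>B. \<exists>O' N. (\<forall>U. openin Z (O' U)) \<and> (\<forall>U\<in>\<U>. O' U \<subseteq> U) \<and>
      openin Z N \<and> {z \<in> topspace Z. f z = x} \<subseteq> N \<and> N \<subseteq> (\<Union>U\<in>\<U>. O' U) \<and>
      (\<forall>z\<in>N. int (card {U\<in>\<U>. z \<in> O' U}) \<le> n + 1)"
  proof
    fix x assume "x \<in> B"
    then have x: "x \<in> topspace X" by (simp add: B_def)
    show "\<exists>O' N. (\<forall>U. openin Z (O' U)) \<and> (\<forall>U\<in>\<U>. O' U \<subseteq> U) \<and>
      openin Z N \<and> {z \<in> topspace Z. f z = x} \<subseteq> N \<and> N \<subseteq> (\<Union>U\<in>\<U>. O' U) \<and>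
      (\<forall>z\<in>N. int (card {U\<in>\<U>. z \<in> O' U}) \<le> n + 1)"
      using fibre_order_neighbourhood[OF x dimF[OF x] \<U>] .
  qed
  from bchoice[OF this] obtain O' where "\<forall>x\<in>B. \<exists>N. (\<forall>U. openin Z (O' x U)) \<and> (\<forall>U\<in>\<U>. O' x U \<subseteq> U) \<and>
      openin Z N \<and> {z \<in> topspace Z. f z = x} \<subseteq> N \<and> N \<subseteq> (\<Union>U\<in>\<U>. O' x U) \<and>
      (\<forall>z\<in>N. int (card {U\<in>\<U>. z \<in> O' x U}) \<le> n + 1)" ..
  from bchoice[OF this] obtain N where "\<forall>x\<in>B. (\<forall>U. openin Z (O' x U)) \<and> (\<forall>U\<in>\<U>. O' x U \<subseteq> U) \<and>
      openin Z (N x) \<and> {z \<in> topspace Z. f z = x} \<subseteq> N x \<and> N x \<subseteq> (\<Union>U\<in>\<U>. O' x U) \<and>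
      (\<forall>z\<in>N x. int (card {U\<in>\<U>. z \<in> O' x U}) \<le> n + 1)" ..
  then have ON: "\<And>x. x \<in> B \<Longrightarrow> (\<forall>U. openin Z (O' x U)) \<and> (\<forall>U\<in>\<U>. O' x U \<subseteq> U) \<and>
      openin Z (N x) \<and> {z \<in> topspace Z. f z = x} \<subseteq> N x \<and> N x \<subseteq> (\<Union>U\<in>\<U>. O' x U) \<and>
      (\<forall>z\<in>N x. int (card {U\<in>\<U>. z \<in> O' x U}) \<le> n + 1)" by (rule bspec)
  have "\<exists>z U. z \<in> topspace Z \<and> f z = x \<and> U \<in> \<U> \<and> z \<in> O' x U" if x: "x \<in> B" for x
  proof -
    obtain z where z: "z \<in> topspace Z" "f z = x" using x fibre_nonempty[of x] by (auto simp: B_def)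
    moreover have "{z \<in> topspace Z. f z = x} \<subseteq> (\<Union>U\<in>\<U>. O' x U)"
      using ON[OF x] by (meson subset_trans)
    ultimately show ?thesis by blast
  qed
  then obtain z c where zc: "\<And>x. x \<in> B \<Longrightarrow> z x \<in> topspace Z \<and> f (z x) = x \<and> c x \<in> \<U> \<and> z x \<in> O' x (c x)"
    by metis
  have sN: "x \<in> s (N x)" if "x \<in> B" for x
    using ON[OF that] that by (auto simp: s_def small_image_iff B_def)
  obtain W where W: "\<And>x. x \<in> B \<Longrightarrow> openin X (W x) \<and> x \<in> W x \<and> X closure_of W x \<subseteq> s (N x) \<and>
      X frontier_of W x \<subseteq> small_image Z X f (O' x (c x))"
    "\<And>x y. x \<in> B \<Longrightarrow> y \<in> B \<Longrightarrow> x \<noteq> y \<Longrightarrow> disjnt (X closure_of W x) (X closure_of W y)"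
    by (rule finitely_many_ring_neighbourhoods[of B z "\<lambda>x. O' x (c x)" "\<lambda>x. s (N x)"])
      (use B zc ON sN op_s in auto)
  have clW: "W x \<subseteq> X closure_of W x" if "x \<in> B" for x using W(1)[OF that] openin_subset_closure_of by blast
  \<comment> \<open>The index \<open>Inr x\<close> collects the base points for which the fibre
    cover of \<open>x\<close> is responsible: those of \<open>W x\<close>, and further points whose
    fibres lie entirely in \<open>O' x (c x)\<close>.\<close>
  define R where "R = (\<lambda>i. case i of Inl U \<Rightarrow> s U - (\<Union>x\<in>B. X closure_of W x)
    | Inr x \<Rightarrow> W x \<union> (s (O' x (c x)) - (\<Union>y\<in>B - {x}. X closure_of W y)))"
  let ?J = "\<U> <+> B"
  have "openin X (R i)" if "i \<in> ?J" for i
    using that W(1) ON B op_s \<U>(2)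
    by (auto simp: R_def intro!: openin_Un openin_diff closedin_Union)
  moreover have "(\<Union>i\<in>?J. R i) = topspace X"
  proof
    show "(\<Union>i\<in>?J. R i) \<subseteq> topspace X" using calculation openin_subset by (meson UN_least)
    show "topspace X \<subseteq> (\<Union>i\<in>?J. R i)"
    proof
      fix p assume p: "p \<in> topspace X"
      consider x where "x \<in> B" "p \<in> W x" | x where "x \<in> B" "p \<in> X closure_of W x" "p \<notin> W x"
        | "\<And>x. x \<in> B \<Longrightarrow> p \<notin> X closure_of W x" by blast
      then show "p \<in> (\<Union>i\<in>?J. R i)"
      proof cases
        case 1 then show ?thesis by (intro UN_I[of "Inr x"]) (auto simp: R_def)
      next
        case 2
        then have "p \<in> s (O' x (c x))" using W(1)[OF 2(1)] by (auto simp: frontier_of_openin s_def)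
        moreover have "p \<notin> X closure_of W y" if "y \<in> B" "y \<noteq> x" for y
          using W(2)[OF 2(1) that(1)] that 2 by (auto simp: disjnt_iff)
        ultimately show ?thesis using 2 by (intro UN_I[of "Inr x"]) (auto simp: R_def)
      next
        case 3
        have "p \<notin> B" using W(1)[of p] clW[of p] 3[of p] by blast
        then obtain U where "U \<in> \<U>" "p \<in> s U" using p by (auto simp: B_def)
        then show ?thesis using 3 by (intro UN_I[of "Inl U"]) (auto simp: R_def)
      qed
    qed
  qed
  ultimately have cov_R: "\<And>i. i \<in> ?J \<Longrightarrow> openin X (R i)" "(\<Union>i\<in>?J. R i) = topspace X"
    by simp_all
  have "finite ?J" using B \<U>(1) by simp
  obtain G where G: "\<And>i. i \<in> ?J \<Longrightarrow> openin X (G i)" "\<And>i. i \<in> ?J \<Longrightarrow> G i \<subseteq> R i"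
    "(\<Union>i\<in>?J. G i) = topspace X"
    "\<And>x. x \<in> topspace X \<Longrightarrow> int (card {i\<in>?J. x \<in> G i}) \<le> n + 1"
    by (rule covering_dim_le_indexed[OF dimX \<open>finite ?J\<close> cov_R]) (assumption, rule that)
  have G_Inl: "p \<notin> G (Inl U)" if "x \<in> B" "p \<in> W x" "U \<in> \<U>" for x p U
    using G(2)[of "Inl U"] clW[OF that(1)] that by (auto simp: R_def)
  have G_Inr: "p \<notin> G (Inr y)" "p \<notin> W y" if "x \<in> B" "p \<in> W x" "y \<in> B" "y \<noteq> x" for x p y
    using G(2)[of "Inr y"] clW[OF that(1)] clW[OF that(3)] that W(2)[OF that(1,3)]
    by (auto simp: R_def disjnt_iff)
  \<comment> \<open>The index \<open>c x\<close> alone extends beyond \<open>W x\<close>, as far as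
    \<open>G (Inr x)\<close> reaches; all other sets of the fibre cover stop at
    \<open>W x\<close>.\<close>
  define H where "H = (\<lambda>i. case i of Inl U \<Rightarrow> {z \<in> topspace Z. f z \<in> G (Inl U)}
    | Inr (x, U) \<Rightarrow> {z \<in> topspace Z. f z \<in> (if U = c x then G (Inr x) else W x)} \<inter> O' x U)"
  let ?I = "\<U> <+> (B \<times> \<U>)"
  show "\<exists>(I :: ('c set + 'a \<times> 'c set) set) V. finite I \<and> (\<forall>i\<in>I. openin Z (V i)) \<and> topspace Z \<subseteq> (\<Union>i\<in>I. V i) \<and>
      (\<forall>i\<in>I. \<exists>U\<in>\<U>. V i \<subseteq> U) \<and> (\<forall>x\<in>topspace Z. int (card {i\<in>I. x \<in> V i}) \<le> n + 1)"
  proof (intro exI[of _ ?I] exI[of _ H] conjI ballI)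
    show "finite ?I" using \<U>(1) B by simp
    show "openin Z (H i)" if i: "i \<in> ?I" for i
    proof (cases i)
      case (Inl U) then show ?thesis using i G(1) by (auto simp: H_def intro!: openin_preimage)
    next
      case (Inr xU)
      then obtain x U where "i = Inr (x, U)" "x \<in> B" "U \<in> \<U>" using i by auto
      then show ?thesis using G(1)[of "Inr x"] W(1)[of x] ON[of x]
        by (auto simp: H_def intro!: openin_preimage openin_Int)
    qed
    show "\<exists>U\<in>\<U>. H i \<subseteq> U" if i: "i \<in> ?I" for i
    proof (cases i)
      case (Inl U)
      then have U: "U \<in> \<U>" using i by auto
      have "G (Inl U) \<subseteq> s U" using G(2)[OF InlI[OF U]] by (auto simp: R_def)
      then have "H i \<subseteq> U" using Inl by (auto simp: H_def s_def small_image_iff)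
      then show ?thesis using U by blast
    next
      case (Inr xU)
      then obtain x U where "i = Inr (x, U)" "x \<in> B" "U \<in> \<U>" using i by auto
      then show ?thesis using ON[of x] by (intro bexI[of _ U]) (auto simp: H_def)
    qed
    show "topspace Z \<subseteq> (\<Union>i\<in>?I. H i)"
    proof
      fix w assume w: "w \<in> topspace Z"
      show "w \<in> (\<Union>i\<in>?I. H i)"
      proof (cases "\<exists>x\<in>B. f w \<in> W x")
        case True
        then obtain x where x: "x \<in> B" "f w \<in> W x" by blast
        then have "f w \<in> s (N x)" using W(1)[OF x(1)] clW by blast
        then have "w \<in> N x" using w by (auto simp: s_def small_image_iff)
        then obtain U where U: "U \<in> \<U>" "w \<in> O' x U" using ON[OF x(1)] by blast
        \<comment> \<open>Over \<open>W x\<close> all other members of \<open>G\<close> are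
          excluded, so the one that covers the point must be this one.\<close>
        have "f w \<in> G (Inr x)"
        proof -
          obtain i where i: "i \<in> ?J" "f w \<in> G i" using G(3) f_in[OF w] by blast
          then show ?thesis using G_Inl[OF x] G_Inr[OF x] by (cases i) auto
        qed
        then show ?thesis using U x w by (intro UN_I[of "Inr (x, U)"]) (auto simp: H_def)
      next
        case False
        obtain i where i: "i \<in> ?J" "f w \<in> G i" using G(3) f_in[OF w] by blast
        show ?thesis
        proof (cases i)
          case (Inl U)
          then show ?thesis using i w by (intro UN_I[of "Inl U"]) (auto simp: H_def)
        next
          case (Inr x)
          then have x: "x \<in> B" using i by auto
          then have "f w \<in> s (O' x (c x))" using G(2)[OF i(1)] i Inr False by (auto simp: R_def)
          then have "w \<in> O' x (c x)" using w by (auto simp: s_def small_image_iff)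
          then show ?thesis using x zc i w Inr by (intro UN_I[of "Inr (x, c x)"]) (auto simp: H_def)
        qed
      qed
    qed
    fix w assume w: "w \<in> topspace Z"
    show "int (card {i\<in>?I. w \<in> H i}) \<le> n + 1"
    proof (cases "\<exists>x\<in>B. f w \<in> W x")
      case True
      then obtain x where x: "x \<in> B" "f w \<in> W x" by blast
      then have "f w \<in> s (N x)" using W(1)[OF x(1)] clW by blast
      then have "w \<in> N x" using w by (auto simp: s_def small_image_iff)
      then have le: "int (card {U\<in>\<U>. w \<in> O' x U}) \<le> n + 1" using ON[OF x(1)] by blast
      have "{i\<in>?I. w \<in> H i} \<subseteq> (\<lambda>U. Inr (x, U)) ` {U\<in>\<U>. w \<in> O' x U}"
      proof
        fix i assume i: "i \<in> {i\<in>?I. w \<in> H i}"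
        then obtain y U where yU: "i = Inr (y, U)" "y \<in> B" "U \<in> \<U>"
          using G_Inl[OF x] by (cases i) (auto simp: H_def)
        then have wH: "f w \<in> (if U = c y then G (Inr y) else W y)" "w \<in> O' y U"
          using i by (auto simp: H_def)
        then have "y = x" using G_Inr[OF x yU(2)] by (metis (full_types))
        then show "i \<in> (\<lambda>U. Inr (x, U)) ` {U\<in>\<U>. w \<in> O' x U}" using yU wH by blast
      qed
      then have "card {i\<in>?I. w \<in> H i} \<le> card {U\<in>\<U>. w \<in> O' x U}"
        using \<U>(1) by (intro surj_card_le) auto
      then show ?thesis using le by linarith
    next
      case False
      \<comment> \<open>Away from all \<open>W x\<close> each exceptional point contributes at most
        the index \<open>c x\<close>, so the members of \<open>H\<close> at \<open>w\<close> come
        from distinct members of \<open>G\<close> at its image.\<close>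
      have "{i\<in>?I. w \<in> H i} \<subseteq> (\<lambda>i. case i of Inl U \<Rightarrow> Inl U | Inr x \<Rightarrow> Inr (x, c x)) ` {i\<in>?J. f w \<in> G i}"
        (is "_ \<subseteq> ?h ` _")
      proof
        fix i assume i: "i \<in> {i\<in>?I. w \<in> H i}"
        show "i \<in> ?h ` {i\<in>?J. f w \<in> G i}"
        proof (cases i)
          case (Inl U) then show ?thesis using i by (intro image_eqI[of _ _ "Inl U"]) (auto simp: H_def)
        next
          case (Inr xU)
          then obtain x U where xU: "i = Inr (x, U)" "x \<in> B" "U \<in> \<U>" using i by auto
          then have "U = c x" "f w \<in> G (Inr x)" using i False by (auto simp: H_def split: if_splits)
          then show ?thesis using xU by (intro image_eqI[of _ _ "Inr x"]) auto
        qed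
      qed
      then have "card {i\<in>?I. w \<in> H i} \<le> card {i\<in>?J. f w \<in> G i}"
        using \<U>(1) B by (intro surj_card_le) auto
      then show ?thesis using G(4)[OF f_in[OF w]] by linarith
    qed
  qed
qed

lemma covering_dim_total:
  assumes ne: "topspace Z \<noteq> {}"
  shows "covering_dim Z = max (covering_dim X) (covering_dim_map Z X f)"
proof (rule antisym)
  have "covering_dim_le X n" if n: "covering_dim_le Z n" for n
  proof (rule covering_dim_le_base[OF n])
    \<comment> \<open>A non-empty space does not have dimension -1, as the cover by the whole space
      shows.\<close>
    show "0 \<le> n"
    proof (rule ccontr)
      assume "\<not> 0 \<le> n"
      then have n: "n + 1 \<le> 0" by simp
      from covering_dim_leD[OF \<open>covering_dim_le Z n\<close>, of "{topspace Z}"] obtain \<V> where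
        \<V>: "finite \<V> \<and> (\<forall>V\<in>\<V>. openin Z V) \<and> \<Union>\<V> = topspace Z \<and> (\<forall>V\<in>\<V>. \<exists>U\<in>{topspace Z}. V \<subseteq> U) \<and>
          (\<forall>x\<in>topspace Z. int (card {V\<in>\<V>. x \<in> V}) \<le> n + 1)" by auto
      obtain z where z: "z \<in> topspace Z" using ne by blast
      have "int (card {V\<in>\<V>. z \<in> V}) \<le> n + 1" using \<V> z by blast
      then have "card {V\<in>\<V>. z \<in> V} = 0" using n by linarith
      then have "{V\<in>\<V>. z \<in> V} = {}" using \<V> by simp
      then show False using \<V> z by blast
    qed
  qed
  then have "covering_dim X \<le> covering_dim Z" by (rule covering_dim_antimono)
  moreover have "covering_dim (fibre Z f x) \<le> covering_dim Z" if "x \<in> topspace X" for x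
    unfolding fibre_def
    by (rule covering_dim_antimono) (rule covering_dim_le_closed_subset[OF _ closedin_fibre[OF that]])
  ultimately show "max (covering_dim X) (covering_dim_map Z X f) \<le> covering_dim Z"
    unfolding covering_dim_map_def by (auto intro: SUP_least)
  show "covering_dim Z \<le> max (covering_dim X) (covering_dim_map Z X f)" (is "_ \<le> ?m")
  proof (cases ?m)
    case (real r)
    then have "covering_dim X \<le> ereal r" "covering_dim_map Z X f \<le> ereal r" by (metis max.cobounded1 max.cobounded2)+
    then have "covering_dim_le X \<lfloor>r\<rfloor>" "covering_dim_le (fibre Z f x) \<lfloor>r\<rfloor>" if "x \<in> topspace X" for x
      using that unfolding covering_dim_map_def covering_dim_le_iff[symmetric] by (auto simp: SUP_le_iff)
    then have "covering_dim_le Z \<lfloor>r\<rfloor>"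
      using ne surj by (metis covering_dim_le_total image_is_empty ex_in_conv)
    then show ?thesis unfolding real by (simp add: covering_dim_le_iff)
  next
    case MInf
    then show ?thesis using covering_dim_ge[of X] by (auto simp: max_def split: if_splits)
  qed simp
qed

end

section \<open>Large inductive dimension\<close>

lemma large_ind_le_ge: "large_ind_le X n \<Longrightarrow> -1 \<le> n"
  by (induction rule: large_ind_le.induct) auto

text \<open>The rule for the empty space yields only the bound -1; larger bounds have to be derived
  by the recursive rule.\<close>

lemma large_ind_le_empty:
  assumes "topspace X = {}" "-1 \<le> n"
  shows "large_ind_le X n"
  using assms(2)
proof (induction n rule: int_ge_induct)
  case base
  show ?case using assms(1) by (rule large_ind_le.empty)
next
  case (step n)
  have "X = trivial_topology" using assms(1) by simp
  then show ?case
    by (intro large_ind_le.step) (use step in \<open>auto intro!: exI[of _ "{}"]\<close>)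
qed

lemma large_ind_le_minus_one_iff: "large_ind_le X (-1) \<longleftrightarrow> topspace X = {}"
proof
  assume "large_ind_le X (-1)"
  then show "topspace X = {}" by cases auto
qed (rule large_ind_le.empty)

lemma large_ind_le_mono: "large_ind_le X n \<Longrightarrow> n \<le> m \<Longrightarrow> large_ind_le X m"
proof (induction arbitrary: m rule: large_ind_le.induct)
  case (empty X) then show ?case by (rule large_ind_le_empty)
next
  case (step n X)
  show ?case
  proof (rule large_ind_le.step)
    show "0 \<le> m" using step by simp
    have le: "n - 1 \<le> m - 1" using step by simp
    show "\<forall>A V. closedin X A \<and> openin X V \<and> A \<subseteq> V \<longrightarrow>
        (\<exists>U. openin X U \<and> A \<subseteq> U \<and> U \<subseteq> V \<and> large_ind_le (subtopology X (X frontier_of U)) (m - 1))"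
    proof (intro allI impI)
      fix A V assume AV: "closedin X A \<and> openin X V \<and> A \<subseteq> V"
      from step.IH[rule_format, OF AV] obtain U where "openin X U \<and> A \<subseteq> U \<and> U \<subseteq> V \<and>
        large_ind_le (subtopology X (X frontier_of U)) (n - 1) \<and>
        (\<forall>x\<ge>n - 1. large_ind_le (subtopology X (X frontier_of U)) x)" by blast
      then show "\<exists>U. openin X U \<and> A \<subseteq> U \<and> U \<subseteq> V \<and> large_ind_le (subtopology X (X frontier_of U)) (m - 1)"
        using le by blast
    qed
  qed
qed

text \<open>Adding the complement of \<open>C\<close> to a relatively open set turns the task into
  one in \<open>X\<close>. The frontier relative to \<open>C\<close> is a closed subset of the
  frontier in \<open>X\<close>, to which the induction hypothesis applies.\<close>

lemma large_ind_le_closed_subset: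
  "large_ind_le X n \<Longrightarrow> closedin X C \<Longrightarrow> large_ind_le (subtopology X C) n"
proof (induction arbitrary: C rule: large_ind_le.induct)
  case (empty X) then show ?case by (intro large_ind_le.empty) simp
next
  case (step n X)
  show ?case
  proof (rule large_ind_le.step[OF step(1)], intro allI impI, elim conjE)
    fix A V assume A: "closedin (subtopology X C) A" and V: "openin (subtopology X C) V" and sub: "A \<subseteq> V"
    obtain T where T: "openin X T" "V = T \<inter> C" using V by (auto simp: openin_subtopology)
    have A': "closedin X A" "A \<subseteq> C"
      using A step.prems by (auto simp: closedin_closed_subtopology)
    have "openin X (T \<union> (topspace X - C))" using T step.prems by blast
    moreover have "A \<subseteq> T \<union> (topspace X - C)" using sub T by blast
    ultimately obtain U where U: "openin X U" "A \<subseteq> U" "U \<subseteq> T \<union> (topspace X - C)"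
      "\<And>D. closedin (subtopology X (X frontier_of U)) D \<Longrightarrow>
        large_ind_le (subtopology (subtopology X (X frontier_of U)) D) (n - 1)"
      using step.IH[rule_format, of A "T \<union> (topspace X - C)"] A' by blast
    let ?D = "subtopology X C frontier_of (U \<inter> C)"
    have "?D = subtopology X C frontier_of U"
      using closedin_subset[OF step.prems] frontier_of_restrict[of "subtopology X C" U]
      by (metis inf.commute topspace_subtopology_subset)
    then have sub: "?D \<subseteq> X frontier_of U"
      using frontier_of_subtopology_subset[of C X U] frontier_of_subset_subtopology[of X C U] by blast
    have "closedin X ?D"
      using closedin_frontier_of[of "subtopology X C" "U \<inter> C"] step.prems by (simp add: closedin_closed_subtopology)
    then have "closedin (subtopology X (X frontier_of U)) ?D"
      using sub by (simp add: closedin_closed_subtopology closedin_frontier_of)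
    then have "large_ind_le (subtopology X ?D) (n - 1)"
      using U(4) sub by (metis inf.absorb2 subtopology_subtopology)
    moreover have "subtopology (subtopology X C) ?D = subtopology X ?D"
      using frontier_of_subset_subtopology[of X C "U \<inter> C"] by (simp add: subtopology_subtopology inf.absorb2)
    ultimately show "\<exists>U. openin (subtopology X C) U \<and> A \<subseteq> U \<and> U \<subseteq> V \<and>
        large_ind_le (subtopology (subtopology X C) (subtopology X C frontier_of U)) (n - 1)"
      using U A' T by (intro exI[of _ "U \<inter> C"]) (auto simp: openin_subtopology_Int)
  qed
qed

lemma large_ind_le_closed_subset':
  assumes "large_ind_le (subtopology X S) n" "C \<subseteq> S" "closedin (subtopology X S) C"
  shows "large_ind_le (subtopology X C) n"
  using large_ind_le_closed_subset[OF assms(1,3)] assms(2)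
  by (simp add: subtopology_subtopology inf.absorb2)

text \<open>The second side is the complement of the closure of \<open>U\<close>. Normality provides
  a \<open>V\<close> whose closure misses \<open>B\<close>, so that \<open>B\<close> falls into this
  side.\<close>

lemma large_ind_le_partition:
  assumes "large_ind_le X n" "0 \<le> n" "normal_space X" "closedin X A" "closedin X B" "disjnt A B"
  obtains G H where "openin X G" "openin X H" "disjnt G H" "A \<subseteq> G" "B \<subseteq> H"
    "large_ind_le (subtopology X (topspace X - (G \<union> H))) (n - 1)"
proof -
  obtain V where V: "openin X V" "A \<subseteq> V" "disjnt B (X closure_of V)"
    using assms(3)[unfolded normal_space, rule_format, of A B] assms(4-6) by blast
  have "\<exists>U. openin X U \<and> A \<subseteq> U \<and> U \<subseteq> V \<and> large_ind_le (subtopology X (X frontier_of U)) (n - 1)"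
    using assms(1)
  proof cases
    case empty then show ?thesis using assms(2) by simp
  next
    case step then show ?thesis using V assms(4) by blast
  qed
  then obtain U where U: "openin X U" "A \<subseteq> U" "U \<subseteq> V" "large_ind_le (subtopology X (X frontier_of U)) (n - 1)"
    by blast
  have "U \<subseteq> X closure_of U" using U(1) by (rule openin_subset_closure_of)
  show ?thesis
  proof (rule that[of U "topspace X - X closure_of U"])
    show "disjnt U (topspace X - X closure_of U)" using \<open>U \<subseteq> X closure_of U\<close> by (auto simp: disjnt_iff)
    show "B \<subseteq> topspace X - X closure_of U"
      using V(3) closure_of_mono[OF U(3), of X] closedin_subset[OF assms(5)]
      unfolding disjnt_def by blast
    have "topspace X - (U \<union> (topspace X - X closure_of U)) = X frontier_of U"
      using closure_of_subset_topspace[of X U] by (auto simp: frontier_of_openin[OF U(1)])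
    then show "large_ind_le (subtopology X (topspace X - (U \<union> (topspace X - X closure_of U)))) (n - 1)"
      using U(4) by simp
  qed (use U in auto)
qed

text \<open>With \<open>B\<close> the complement of \<open>V\<close>, the frontier of
  \<open>G\<close> is a closed subset of the partition and inherits its bound.\<close>

lemma large_ind_leI:
  assumes "0 \<le> n" and part: "\<And>A B. closedin X A \<Longrightarrow> closedin X B \<Longrightarrow> disjnt A B \<Longrightarrow>
    \<exists>G H. openin X G \<and> openin X H \<and> disjnt G H \<and> A \<subseteq> G \<and> B \<subseteq> H \<and>
      large_ind_le (subtopology X (topspace X - (G \<union> H))) (n - 1)"
  shows "large_ind_le X n"
proof (rule large_ind_le.step[OF assms(1)], intro allI impI, elim conjE)
  fix A V assume AV: "closedin X A" "openin X V" "A \<subseteq> V"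
  then have B: "closedin X (topspace X - V)" "disjnt A (topspace X - V)" by (auto simp: disjnt_iff)
  obtain G H where GH: "openin X G" "openin X H" "disjnt G H" "A \<subseteq> G" "topspace X - V \<subseteq> H"
      "large_ind_le (subtopology X (topspace X - (G \<union> H))) (n - 1)"
    using part[OF AV(1) B] by blast
  have "G \<subseteq> topspace X" "H \<subseteq> topspace X" using GH(1,2) openin_subset by auto
  have "X closure_of G \<subseteq> topspace X - H"
    using GH \<open>G \<subseteq> topspace X\<close> by (intro closure_of_minimal) (auto simp: disjnt_iff)
  then have sub: "X frontier_of G \<subseteq> topspace X - (G \<union> H)"
    using GH(1) by (auto simp: frontier_of_openin)
  have "closedin (subtopology X (topspace X - (G \<union> H))) (X frontier_of G)"
    using sub closedin_frontier_of by (intro closedin_subset_topspace) auto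
  then have "large_ind_le (subtopology X (X frontier_of G)) (n - 1)"
    using large_ind_le_closed_subset'[OF GH(6) sub] by blast
  moreover have "G \<subseteq> V" using GH(3,5) \<open>G \<subseteq> topspace X\<close> by (auto simp: disjnt_iff)
  ultimately show "\<exists>U. openin X U \<and> A \<subseteq> U \<and> U \<subseteq> V \<and> large_ind_le (subtopology X (X frontier_of U)) (n - 1)"
    using GH(1,4) by blast
qed

section \<open>Perfectly normal subspaces and countable unions of closed sets\<close>

lemma perfectly_normal_fsigma_subtopology:
  assumes X: "perfectly_normal X" and S: "fsigma_in X S"
  shows "perfectly_normal (subtopology X S)"
  unfolding perfectly_normal_def
proof (intro conjI allI impI)
  show "t1_space (subtopology X S)" using X by (simp add: perfectly_normal_def t1_space_subtopology)
  show "normal_space (subtopology X S)"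
    using X S by (simp add: perfectly_normal_def normal_space_fsigma_subtopology)
  fix C assume "closedin (subtopology X S) C"
  then obtain T where "closedin X T" "C = T \<inter> S" by (auto simp: closedin_subtopology)
  then show "gdelta_in (subtopology X S) C"
    using X by (auto simp: perfectly_normal_def gdelta_in_subtopology)
qed

lemma perfectly_normal_open_imp_fsigma:
  "perfectly_normal X \<Longrightarrow> openin X U \<Longrightarrow> fsigma_in X U"
  unfolding perfectly_normal_def fsigma_in_gdelta_in by (auto simp: openin_subset)

lemma perfectly_normal_subtopology:
  assumes "perfectly_normal X"
  shows "closedin X S \<Longrightarrow> perfectly_normal (subtopology X S)"
    and "openin X S \<Longrightarrow> perfectly_normal (subtopology X S)"
  using assms perfectly_normal_fsigma_subtopology perfectly_normal_open_imp_fsigma closed_imp_fsigma_in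
  by blast+

text \<open>The pieces have to be closed in the ambient space and not merely in \<open>S\<close>;
  therefore such sets can be united and can be restricted to any closed subspace.\<close>

definition sigma_large_ind :: "'a topology \<Rightarrow> int \<Rightarrow> 'a set \<Rightarrow> bool" where
  "sigma_large_ind X n S \<longleftrightarrow> (\<exists>\<C>. countable \<C> \<and> \<Union>\<C> = S \<and>
     (\<forall>C\<in>\<C>. closedin X C \<and> large_ind_le (subtopology X C) n))"

lemma sigma_large_ind_empty: "sigma_large_ind X n {}"
  unfolding sigma_large_ind_def by (intro exI[of _ "{}"]) simp

lemma sigma_large_ind_closed:
  "closedin X S \<Longrightarrow> large_ind_le (subtopology X S) n \<Longrightarrow> sigma_large_ind X n S"
  unfolding sigma_large_ind_def by (intro exI[of _ "{S}"]) simp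

lemma sigma_large_ind_Union:
  assumes "countable \<S>" "\<And>S. S \<in> \<S> \<Longrightarrow> sigma_large_ind X n S"
  shows "sigma_large_ind X n (\<Union>\<S>)"
proof -
  have "\<forall>S\<in>\<S>. \<exists>\<C>. countable \<C> \<and> \<Union>\<C> = S \<and> (\<forall>C\<in>\<C>. closedin X C \<and> large_ind_le (subtopology X C) n)"
    using assms(2) by (simp add: sigma_large_ind_def)
  from bchoice[OF this] obtain c where c: "\<forall>S\<in>\<S>. countable (c S) \<and> \<Union>(c S) = S \<and>
      (\<forall>C\<in>c S. closedin X C \<and> large_ind_le (subtopology X C) n)" ..
  show ?thesis unfolding sigma_large_ind_def
  proof (intro exI[of _ "\<Union>(c ` \<S>)"] conjI ballI)
    show "countable (\<Union>(c ` \<S>))" using assms(1) c by blast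
    have "\<Union>(\<Union>(c ` \<S>)) = (\<Union>S\<in>\<S>. \<Union>(c S))" by blast
    then show "\<Union>(\<Union>(c ` \<S>)) = \<Union>\<S>" using c by simp
  qed (use c in auto)
qed

lemma sigma_large_ind_Un:
  "sigma_large_ind X n S \<Longrightarrow> sigma_large_ind X n T \<Longrightarrow> sigma_large_ind X n (S \<union> T)"
  using sigma_large_ind_Union[of "{S, T}" X n] by auto

lemma sigma_large_ind_fsigma:
  assumes "fsigma_in X S" "large_ind_le (subtopology X S) n"
  shows "sigma_large_ind X n S"
proof -
  obtain C :: "nat \<Rightarrow> 'a set" where C: "\<And>i. closedin X (C i)" "\<Union>(range C) = S"
    using assms(1) unfolding fsigma_in_ascending by blast
  have "sigma_large_ind X n (C i)" for i
  proof (rule sigma_large_ind_closed[OF C(1)])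
    have "C i \<subseteq> S" using C(2) by blast
    moreover have "closedin (subtopology X S) (C i)"
      using \<open>C i \<subseteq> S\<close> C(1) closedin_subset_topspace by blast
    ultimately show "large_ind_le (subtopology X (C i)) n"
      using large_ind_le_closed_subset'[OF assms(2)] by blast
  qed
  then show ?thesis using sigma_large_ind_Union[of "range C" X n] C(2) by auto
qed

lemma sigma_large_ind_relative:
  assumes "sigma_large_ind X n S" "closedin X M" "M \<subseteq> S"
  shows "sigma_large_ind (subtopology X M) n (topspace (subtopology X M))"
proof -
  obtain \<C> where \<C>: "countable \<C>" "\<Union>\<C> = S" "\<And>C. C \<in> \<C> \<Longrightarrow> closedin X C \<and> large_ind_le (subtopology X C) n"
    using assms(1) unfolding sigma_large_ind_def by blast
  have top: "topspace (subtopology X M) = M" using closedin_subset[OF assms(2)] by auto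
  show ?thesis unfolding sigma_large_ind_def
  proof (intro exI[of _ "(\<inter>) M ` \<C>"] conjI ballI)
    show "countable ((\<inter>) M ` \<C>)" using \<C>(1) by simp
    show "\<Union>((\<inter>) M ` \<C>) = topspace (subtopology X M)" unfolding top using \<C>(2) assms(3) by blast
    fix D assume "D \<in> (\<inter>) M ` \<C>"
    then obtain C where C: "C \<in> \<C>" "D = M \<inter> C" by blast
    then have D: "closedin X D" using \<C>(3) assms(2) by blast
    then show "closedin (subtopology X M) D" using C by (intro closedin_subset_topspace) auto
    have "closedin (subtopology X C) D" using D C by (intro closedin_subset_topspace) auto
    then have "large_ind_le (subtopology X D) n"
      using large_ind_le_closed_subset'[of X C n D] \<C>(3) C by blast
    then show "large_ind_le (subtopology (subtopology X M) D) n"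
      using C by (simp add: subtopology_subtopology inf.absorb2)
  qed
qed

text \<open>The sum theorem for the bound \<open>n\<close> is made a predicate so that auxiliary
  lemmas can assume it one dimension lower. It speaks of all topologies on the type because the
  induction passes to subspaces.\<close>

definition large_ind_sum_property :: "'a itself \<Rightarrow> int \<Rightarrow> bool" where
  "large_ind_sum_property _ n \<longleftrightarrow> (\<forall>X :: 'a topology. perfectly_normal X \<longrightarrow>
     sigma_large_ind X n (topspace X) \<longrightarrow> large_ind_le X n)"

text \<open>An open set of a perfectly normal space is F-sigma. At each stage normality inserts an
  open set, with closure in \<open>E\<close>, around the previous stage and the next F-sigma
  piece.\<close>

lemma open_ascending_interiors:
  assumes X: "perfectly_normal X" and E: "openin X E"
  obtains F :: "nat \<Rightarrow> 'a set" where "\<And>i. closedin X (F i)" "(\<Union>i. F i) = E"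
    "\<And>i. F i \<subseteq> X interior_of F (Suc i)"
proof -
  have normal: "normal_space X" using X by (simp add: perfectly_normal_def)
  obtain C :: "nat \<Rightarrow> 'a set" where C: "\<And>i. closedin X (C i)" "\<Union>(range C) = E"
    using perfectly_normal_open_imp_fsigma[OF X E] unfolding fsigma_in_ascending by blast
  have "\<exists>F. \<forall>i. (closedin X (F i) \<and> F i \<subseteq> E \<and> C i \<subseteq> F i) \<and> F i \<subseteq> X interior_of F (Suc i)"
  proof (rule dependent_nat_choice)
    show "\<exists>D. closedin X D \<and> D \<subseteq> E \<and> C 0 \<subseteq> D" using C by (intro exI[of _ "C 0"]) auto
    fix D i assume D: "closedin X D \<and> D \<subseteq> E \<and> C i \<subseteq> D"
    then have "closedin X (D \<union> C (Suc i))" "D \<union> C (Suc i) \<subseteq> E" using C by auto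
    then obtain V where V: "openin X V" "D \<union> C (Suc i) \<subseteq> V" "X closure_of V \<subseteq> E"
      using normal[unfolded normal_space_alt, rule_format, of "D \<union> C (Suc i)" E] E by blast
    have "V \<subseteq> X interior_of (X closure_of V)"
      using V(1) openin_subset_closure_of by (intro interior_of_maximal) auto
    then show "\<exists>D'. (closedin X D' \<and> D' \<subseteq> E \<and> C (Suc i) \<subseteq> D') \<and> D \<subseteq> X interior_of D'"
      using V openin_subset_closure_of[OF V(1)] by (intro exI[of _ "X closure_of V"]) auto
  qed
  then obtain F where F: "\<And>i. closedin X (F i)" "\<And>i. F i \<subseteq> E" "\<And>i. C i \<subseteq> F i"
    "\<And>i. F i \<subseteq> X interior_of F (Suc i)" by blast
  have "(\<Union>i. F i) = E" using F(2,3) C(2) by blast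
  then show ?thesis using F that by blast
qed

text \<open>Cut \<open>E\<close> into layers of an exhaustion and separate \<open>A\<close> from
  \<open>B\<close> in each layer. The resulting open sets are locally finite in \<open>E\<close>, so
  the frontier of their union is covered by their own frontiers; the sum theorem one dimension lower
  bounds it.\<close>

lemma large_ind_le_open_subset_step:
  assumes sum: "large_ind_sum_property TYPE('a) (n - 1)"
    and X: "perfectly_normal (X :: 'a topology)" and ind: "large_ind_le X n" and n: "0 \<le> n"
    and E: "openin X E"
  shows "large_ind_le (subtopology X E) n"
proof (rule large_ind_leI[OF n])
  fix A B assume A: "closedin (subtopology X E) A" and B: "closedin (subtopology X E) B" and AB: "disjnt A B"
  have normal: "normal_space X" using X by (simp add: perfectly_normal_def)
  have EX: "E \<subseteq> topspace X" using E by (rule openin_subset)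
  obtain A' where A': "closedin X A'" "A = A' \<inter> E" using A by (auto simp: closedin_subtopology)
  obtain B' where B': "closedin X B'" "B = B' \<inter> E" using B by (auto simp: closedin_subtopology)
  obtain F :: "nat \<Rightarrow> 'a set" where F: "\<And>i. closedin X (F i)" "(\<Union>i. F i) = E"
    "\<And>i. F i \<subseteq> X interior_of F (Suc i)"
    by (rule open_ascending_interiors[OF X E]) (rule that)
  have F_Suc: "F i \<subseteq> F (Suc i)" for i
    using F(3)[of i] interior_of_subset[of X "F (Suc i)"] by (rule subset_trans)
  have F_mono: "F i \<subseteq> F j" if "i \<le> j" for i j
    using F_Suc that by (rule lift_Suc_mono_le)
  \<comment> \<open>\<open>K i\<close> is the part of \<open>A'\<close> in the i-th layer and
    \<open>N i\<close> confines its neighbourhood to the adjacent layers. The special values for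
    small \<open>i\<close> replace the missing sets with indices -1 and -2.\<close>
  define I where "I i = (if i = 0 then {} else X interior_of F (i - 1))" for i
  define D where "D i = (if i < 2 then {} else F (i - 2))" for i
  define K where "K i = A' \<inter> (F i - I i)" for i
  define N where "N i = X interior_of F (Suc i) - (D i \<union> B')" for i
  have "\<exists>U. openin X U \<and> K i \<subseteq> U \<and> X closure_of U \<subseteq> N i \<and>
      large_ind_le (subtopology X (X frontier_of U)) (n - 1)" for i
  proof -
    have "closedin X (K i)" unfolding K_def I_def using A'(1) F(1) by (auto intro!: closedin_diff)
    moreover have "openin X (N i)" unfolding N_def D_def using B'(1) F(1)
      by (auto intro!: openin_diff closedin_Un)
    moreover have "K i \<subseteq> N i"
    proof -
      have "D i \<subseteq> I i"
      proof (cases "i < 2")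
        case False
        then have "Suc (i - 2) = i - 1" by simp
        then show ?thesis using F(3)[of "i - 2"] False by (auto simp: D_def I_def)
      qed (simp add: D_def)
      moreover have "F i \<subseteq> E" using F(2) by blast
      ultimately show ?thesis using F(3)[of i] AB A'(2) B'(2) by (auto simp: K_def N_def disjnt_iff)
    qed
    ultimately obtain V where V: "openin X V" "K i \<subseteq> V" "X closure_of V \<subseteq> N i"
      using normal[unfolded normal_space_alt, rule_format, of "K i" "N i"] by blast
    have "\<exists>U. openin X U \<and> K i \<subseteq> U \<and> U \<subseteq> V \<and> large_ind_le (subtopology X (X frontier_of U)) (n - 1)"
      using ind
    proof cases
      case empty then show ?thesis using n by simp
    next
      case step then show ?thesis using V \<open>closedin X (K i)\<close> by blast
    qed
    then show ?thesis using V(3) closure_of_mono[of _ V X] by (meson subset_trans)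
  qed
  then obtain U where U: "\<And>i. openin X (U i)" "\<And>i. K i \<subseteq> U i" "\<And>i. X closure_of (U i) \<subseteq> N i"
    "\<And>i. large_ind_le (subtopology X (X frontier_of (U i))) (n - 1)" by metis
  define G where "G = (\<Union>i. U i)"
  have sub: "U i \<subseteq> X closure_of (U i)" for i using U(1) by (rule openin_subset_closure_of)
  have N_E: "N i \<subseteq> E" for i using interior_of_subset[of X "F (Suc i)"] F(2) by (auto simp: N_def)
  have G: "openin X G" "G \<subseteq> E" unfolding G_def using U(1) sub U(3) N_E by blast+
  have cl: "E \<inter> X closure_of G \<subseteq> (\<Union>i. X closure_of (U i))"
  proof
    fix x assume x: "x \<in> E \<inter> X closure_of G"
    then obtain j where "x \<in> F j" using F(2) by blast
    then have xj: "x \<in> X interior_of F (Suc j)" using F(3) by blast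
    \<comment> \<open>\<open>N i\<close> avoids \<open>F (i - 2)\<close>, so a set
      \<open>U i\<close> that reaches \<open>F (Suc j)\<close> has an index below
      \<open>j + 3\<close>. Only finitely many matter near \<open>x\<close>, and closure commutes
      with finite unions.\<close>
    have "X interior_of F (Suc j) \<inter> G \<subseteq> (\<Union>i<j+3. U i)"
    proof
      fix y assume y: "y \<in> X interior_of F (Suc j) \<inter> G"
      then obtain i where i: "y \<in> U i" by (auto simp: G_def)
      have "i < j + 3"
      proof (rule ccontr)
        assume "\<not> i < j + 3"
        then have "F (Suc j) \<subseteq> D i" using F_mono[of "Suc j" "i - 2"] by (simp add: D_def)
        moreover have "y \<in> F (Suc j)" using y interior_of_subset[of X "F (Suc j)"] by blast
        moreover have "y \<notin> D i" using i sub[of i] U(3)[of i] by (auto simp: N_def)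
        ultimately show False by blast
      qed
      then show "y \<in> (\<Union>i<j+3. U i)" using i by blast
    qed
    moreover have "x \<in> X closure_of (X interior_of F (Suc j) \<inter> G)"
      using x xj openin_Int_closure_of_subset[of X "X interior_of F (Suc j)" G] by auto
    ultimately have "x \<in> X closure_of (\<Union>i<j+3. U i)" using closure_of_mono by blast
    also have "X closure_of (\<Union>i<j+3. U i) = (\<Union>i<j+3. X closure_of (U i))"
      using closure_of_Union[of "U ` {..<j+3}" X] by simp
    finally show "x \<in> (\<Union>i. X closure_of (U i))" by blast
  qed
  let ?E = "subtopology X E"
  define H where "H = E - X closure_of G"
  have M: "E - (G \<union> H) = (E \<inter> X closure_of G) - G" by (auto simp: H_def)
  define M where "M = E - (G \<union> H)"
  have opG: "openin ?E G" using G by (simp add: openin_subset_topspace_eq openin_open_subtopology E)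
  have opH: "openin ?E H" unfolding H_def using E by (simp add: openin_open_subtopology openin_diff)
  have clM: "closedin ?E M"
  proof -
    have "M = topspace ?E - (G \<union> H)" using EX by (auto simp: M_def)
    then show ?thesis using opG opH by (metis closedin_diff closedin_topspace openin_Un)
  qed
  have pM: "perfectly_normal (subtopology X M)"
  proof -
    have "perfectly_normal (subtopology ?E M)"
      using perfectly_normal_subtopology(1)[OF perfectly_normal_subtopology(2)[OF X E] clM] .
    then show ?thesis by (simp add: subtopology_subtopology M_def inf.absorb2)
  qed
  have "sigma_large_ind (subtopology X M) (n - 1) (\<Union>i. M \<inter> X frontier_of (U i))"
  proof (rule sigma_large_ind_Union, simp, clarify)
    fix i
    have "closedin (subtopology X M) (M \<inter> X frontier_of (U i))"
      using closedin_frontier_of[of X "U i"] by (simp add: closedin_subtopology_Int_closed)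
    moreover have "closedin X (M \<inter> X frontier_of (U i))"
    proof -
      have "X frontier_of (U i) \<subseteq> E" using U(1,3) N_E by (fastforce simp: frontier_of_openin)
      then have "M \<inter> X frontier_of (U i) = X closure_of G \<inter> X frontier_of (U i) - G"
        unfolding M_def M by blast
      then show ?thesis using G(1) closedin_frontier_of[of X "U i"]
        by (metis closedin_Int closedin_closure_of closedin_diff)
    qed
    then have "closedin (subtopology X (X frontier_of (U i))) (M \<inter> X frontier_of (U i))"
      by (intro closedin_subset_topspace) auto
    then have "large_ind_le (subtopology X (M \<inter> X frontier_of (U i))) (n - 1)"
      using large_ind_le_closed_subset'[OF U(4)] by blast
    then have "large_ind_le (subtopology (subtopology X M) (M \<inter> X frontier_of (U i))) (n - 1)"
      by (simp add: subtopology_subtopology inf.absorb2)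
    ultimately show "sigma_large_ind (subtopology X M) (n - 1) (M \<inter> X frontier_of (U i))"
      by (rule sigma_large_ind_closed)
  qed
  moreover have "(\<Union>i. M \<inter> X frontier_of (U i)) = topspace (subtopology X M)"
  proof -
    have "M \<subseteq> (\<Union>i. X frontier_of (U i))"
    proof
      fix x assume "x \<in> M"
      then have x: "x \<in> E \<inter> X closure_of G" "x \<notin> G" unfolding M_def M by blast+
      then obtain i where "x \<in> X closure_of (U i)" using cl by blast
      moreover have "x \<notin> U i" using x(2) by (auto simp: G_def)
      ultimately show "x \<in> (\<Union>i. X frontier_of (U i))" using U(1) by (auto simp: frontier_of_openin)
    qed
    moreover have "M \<subseteq> topspace X" using EX by (auto simp: M_def)
    ultimately show ?thesis by auto
  qed
  ultimately have "large_ind_le (subtopology X M) (n - 1)"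
    using sum pM unfolding large_ind_sum_property_def by simp
  moreover have "subtopology ?E (topspace ?E - (G \<union> H)) = subtopology X M"
    using EX by (simp add: M_def subtopology_subtopology Int_absorb1 inf.absorb2 Diff_subset)
  moreover have "A \<subseteq> G"
  proof
    fix a assume a: "a \<in> A"
    then have "\<exists>i. a \<in> F i" using A'(2) F(2) by blast
    define i where "i = (LEAST i. a \<in> F i)"
    have i: "a \<in> F i" "\<And>j. j < i \<Longrightarrow> a \<notin> F j"
      unfolding i_def using LeastI_ex[OF \<open>\<exists>i. a \<in> F i\<close>] not_less_Least by auto
    have "a \<notin> I i" using i(2)[of "i - 1"] interior_of_subset[of X "F (i - 1)"] by (auto simp: I_def)
    then have "a \<in> K i" using a i A'(2) by (auto simp: K_def)
    then show "a \<in> G" using U(2) by (auto simp: G_def)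
  qed
  moreover have "B \<subseteq> H"
  proof
    fix b assume b: "b \<in> B"
    then have "b \<notin> X closure_of (U i)" for i using U(3)[of i] B'(2) by (auto simp: N_def)
    then show "b \<in> H" using b cl B'(2) by (auto simp: H_def)
  qed
  moreover have "disjnt G H"
    using openin_subset_closure_of[OF G(1)] by (auto simp: H_def disjnt_iff)
  ultimately show "\<exists>G H. openin ?E G \<and> openin ?E H \<and> disjnt G H \<and> A \<subseteq> G \<and> B \<subseteq> H \<and>
      large_ind_le (subtopology ?E (topspace ?E - (G \<union> H))) (n - 1)"
    using opG opH by (intro exI[of _ G] exI[of _ H]) simp
qed

section \<open>The countable sum theorem\<close>

lemma normal_space_disjoint_nbhds:
  assumes "normal_space X" "closedin X A" "closedin X B" "disjnt A B"
  obtains U V where "openin X U" "openin X V" "A \<subseteq> U" "B \<subseteq> V" "disjnt (X closure_of U) (X closure_of V)"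
  using assms(1)[unfolded normal_space_disjoint_closures, rule_format, of A B] assms(2-4) by blast

text \<open>One stage of the sum theorem: the sides grow so as to split \<open>C\<close> as well,
  while the partition grows by a set \<open>L\<close> of smaller dimension. \<open>C - E\<close> is
  open in \<open>C\<close>, so the bound for \<open>C\<close> passes to it; \<open>L\<close> is
  closed there, and closed in \<open>X\<close> once \<open>E\<close> is added.\<close>

lemma large_ind_sum_step:
  assumes sum: "large_ind_sum_property TYPE('a) (n - 1)"
    and X: "perfectly_normal (X :: 'a topology)" and n: "0 \<le> n"
    and C: "closedin X C" "large_ind_le (subtopology X C) n"
    and UW: "openin X U" "openin X W" "X closure_of U \<inter> X closure_of W \<subseteq> E"
    and E: "closedin X E" "sigma_large_ind X (n - 1) E" "E \<inter> U = {}" "E \<inter> W = {}"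
  obtains U' W' E' where "openin X U'" "openin X W'" "X closure_of U' \<inter> X closure_of W' \<subseteq> E'"
    "closedin X E'" "sigma_large_ind X (n - 1) E'" "E' \<inter> U' = {}" "E' \<inter> W' = {}"
    "U \<subseteq> U'" "W \<subseteq> W'" "C \<subseteq> U' \<union> W' \<union> E'"
proof -
  define S where "S = C - E"
  have CX: "C \<subseteq> topspace X" using C(1) by (rule closedin_subset)
  have pC: "perfectly_normal (subtopology X C)" using perfectly_normal_subtopology(1)[OF X C(1)] .
  have opS: "openin (subtopology X C) S"
  proof -
    have "S = (topspace X - E) \<inter> C" using CX by (auto simp: S_def)
    moreover have "openin X (topspace X - E)" using E(1) by blast
    ultimately show ?thesis by (auto simp: openin_subtopology)
  qed
  have "subtopology (subtopology X C) S = subtopology X S"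
    by (simp add: S_def subtopology_subtopology Int_absorb1 Diff_subset)
  then have indS: "large_ind_le (subtopology X S) n" and pS: "perfectly_normal (subtopology X S)"
    using large_ind_le_open_subset_step[OF sum pC C(2) n opS] perfectly_normal_subtopology(2)[OF pC opS]
    by simp_all
  have topS: "topspace (subtopology X S) = S" using CX by (auto simp: S_def)
  have fS: "fsigma_in X S" unfolding S_def
    using C(1) E(1) X by (intro fsigma_in_diff) (auto simp: closed_imp_fsigma_in perfectly_normal_def)
  have cl: "closedin (subtopology X S) (S \<inter> X closure_of U)" "closedin (subtopology X S) (S \<inter> X closure_of W)"
    by (simp_all add: closedin_subtopology_Int_closed)
  have dis: "disjnt (S \<inter> X closure_of U) (S \<inter> X closure_of W)"
    using UW(3) by (auto simp: disjnt_iff S_def)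
  have normS: "normal_space (subtopology X S)" using pS by (simp add: perfectly_normal_def)
  obtain G H where GH: "openin (subtopology X S) G" "openin (subtopology X S) H" "disjnt G H"
    "S \<inter> X closure_of U \<subseteq> G" "S \<inter> X closure_of W \<subseteq> H"
    "large_ind_le (subtopology (subtopology X S) (topspace (subtopology X S) - (G \<union> H))) (n - 1)"
    by (rule large_ind_le_partition[OF indS n normS cl dis]) (rule that)
  define L where "L = S - (G \<union> H)"
  have L: "closedin (subtopology X S) L"
    using GH(1,2) unfolding L_def by (metis closedin_diff closedin_topspace openin_Un topS)
  have indL: "large_ind_le (subtopology X L) (n - 1)"
    using GH(6) unfolding topS L_def by (simp add: subtopology_subtopology Int_absorb1 Diff_subset)
  have LS: "L \<subseteq> S" by (auto simp: L_def)
  obtain T where T: "closedin X T" "L = T \<inter> S" using L by (auto simp: closedin_subtopology)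
  define E' where "E' = E \<union> L"
  have "E' = E \<union> (T \<inter> C)" using T(2) by (auto simp: E'_def S_def)
  then have clE': "closedin X E'" using E(1) T(1) C(1) by auto
  have "fsigma_in X L" using T fS by (simp add: closed_imp_fsigma_in fsigma_in_Int)
  then have sE': "sigma_large_ind X (n - 1) E'"
    unfolding E'_def using sigma_large_ind_Un[OF E(2) sigma_large_ind_fsigma] indL by blast
  define R where "R = topspace X - E'"
  have opR: "openin X R" unfolding R_def using clE' by blast
  have normR: "normal_space (subtopology X R)"
    using perfectly_normal_subtopology(2)[OF X opR] by (simp add: perfectly_normal_def)
  have GS: "G \<subseteq> S" "H \<subseteq> S" using openin_subset[OF GH(1)] openin_subset[OF GH(2)] topS by simp_all
  have "S \<subseteq> topspace X" "S \<inter> E = {}" using CX by (auto simp: S_def)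
  then have SR: "S \<inter> R = G \<union> H" using GS unfolding R_def E'_def L_def by blast
  \<comment> \<open>Inside \<open>R\<close> the set \<open>P\<close> is what is left of
    \<open>C\<close> after removing the open set that cuts out \<open>Q\<close>; hence it is
    relatively closed.\<close>
  have key: "closedin (subtopology X R) ((X closure_of V \<union> P) \<inter> R)"
    if P: "openin (subtopology X S) Q" "disjnt P Q" "P \<union> Q = G \<union> H" for V P Q
  proof -
    obtain O' where O': "openin X O'" "Q = O' \<inter> S" using P(1) by (auto simp: openin_subtopology)
    have "C \<inter> R \<subseteq> S \<inter> R" using R_def E'_def S_def by blast
    then have "P \<inter> R = (C - O') \<inter> R"
      using SR P(2,3) O'(2) S_def unfolding disjnt_def by blast
    then have "(X closure_of V \<union> P) \<inter> R = (X closure_of V \<union> (C - O')) \<inter> R" by blast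
    moreover have "closedin X (X closure_of V \<union> (C - O'))" using C(1) O'(1) by (simp add: closedin_Un closedin_diff)
    ultimately show ?thesis by (auto simp: closedin_subtopology)
  qed
  have clA: "closedin (subtopology X R) ((X closure_of U \<union> G) \<inter> R)"
    using key[OF GH(2,3)] by blast
  have clB: "closedin (subtopology X R) ((X closure_of W \<union> H) \<inter> R)"
    using key[OF GH(1)] GH(3) by (simp add: disjnt_sym Un_commute)
  have disAB: "disjnt ((X closure_of U \<union> G) \<inter> R) ((X closure_of W \<union> H) \<inter> R)"
    using UW(3) GH(3,4,5) GS unfolding R_def E'_def disjnt_def by blast
  obtain U' W' where U'W': "openin (subtopology X R) U'" "openin (subtopology X R) W'"
    "(X closure_of U \<union> G) \<inter> R \<subseteq> U'" "(X closure_of W \<union> H) \<inter> R \<subseteq> W'"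
    "disjnt (subtopology X R closure_of U') (subtopology X R closure_of W')"
    by (rule normal_space_disjoint_nbhds[OF normR clA clB disAB]) (rule that)
  have sub: "U' \<subseteq> R" "W' \<subseteq> R" and op: "openin X U'" "openin X W'"
    using U'W'(1,2) opR by (auto simp: openin_open_subtopology)
  have disc: "R \<inter> X closure_of U' \<inter> X closure_of W' = {}"
    using U'W'(5) sub by (simp add: closure_of_subtopology Int_absorb1 disjnt_def) blast
  show ?thesis
  proof (rule that[OF op _ clE' sE'])
    show "X closure_of U' \<inter> X closure_of W' \<subseteq> E'"
      using disc closure_of_subset_topspace[of X U'] unfolding R_def by blast
    show "E' \<inter> U' = {}" "E' \<inter> W' = {}" using sub R_def by auto
    have "L \<inter> X closure_of U = {}" "L \<inter> X closure_of W = {}" using GH(4,5) LS unfolding L_def by blast+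
    then have "U \<subseteq> R" "W \<subseteq> R"
      using E(3,4) openin_subset_closure_of[OF UW(1)] openin_subset_closure_of[OF UW(2)]
        openin_subset[OF UW(1)] openin_subset[OF UW(2)] unfolding R_def E'_def by blast+
    then show "U \<subseteq> U'" "W \<subseteq> W'"
      using U'W'(3,4) openin_subset_closure_of[OF UW(1)] openin_subset_closure_of[OF UW(2)] by blast+
    show "C \<subseteq> U' \<union> W' \<union> E'"
    proof
      fix x assume x: "x \<in> C"
      show "x \<in> U' \<union> W' \<union> E'"
      proof (cases "x \<in> E'")
        case False
        then have "x \<in> S \<inter> R" using x CX unfolding S_def R_def E'_def by blast
        then show ?thesis using SR U'W'(3,4) by blast
      qed blast
    qed
  qed
qed

text \<open>The pieces are processed one after another without revoking earlier decisions. Points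
  that neither side ever absorbs lie in the union of the countably many \<open>E i\<close>, to which
  the sum theorem one dimension lower applies.\<close>

lemma large_ind_sum_property_step:
  assumes sum: "large_ind_sum_property TYPE('a) (n - 1)" and n: "0 \<le> n"
  shows "large_ind_sum_property TYPE('a) n"
  unfolding large_ind_sum_property_def
proof (intro allI impI)
  fix X :: "'a topology" assume X: "perfectly_normal X" and sig: "sigma_large_ind X n (topspace X)"
  obtain \<C> where \<C>: "countable \<C>" "\<Union>\<C> = topspace X"
    "\<And>C. C \<in> \<C> \<Longrightarrow> closedin X C \<and> large_ind_le (subtopology X C) n"
    using sig unfolding sigma_large_ind_def by blast
  \<comment> \<open>The extra empty piece keeps the enumeration meaningful when there are no pieces
    at all.\<close>
  define C where "C = from_nat_into (insert {} \<C>)"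
  have rangeC: "range C = insert {} \<C>" unfolding C_def using \<C>(1) by (intro range_from_nat_into) auto
  have C: "closedin X (C i) \<and> large_ind_le (subtopology X (C i)) n" for i
  proof -
    have "C i \<in> insert {} \<C>" using rangeC by blast
    then show ?thesis using \<C>(3) n by (auto intro: large_ind_le_empty)
  qed
  have covC: "(\<Union>i. C i) = topspace X" using rangeC \<C>(2) by auto
  show "large_ind_le X n"
  proof (rule large_ind_leI[OF n])
    fix A B assume AB: "closedin X A" "closedin X B" "disjnt A B"
    have norm: "normal_space X" using X by (simp add: perfectly_normal_def)
    obtain U0 W0 where UW0: "openin X U0" "openin X W0" "A \<subseteq> U0" "B \<subseteq> W0"
      "disjnt (X closure_of U0) (X closure_of W0)"
      by (rule normal_space_disjoint_nbhds[OF norm AB]) (rule that)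
    define good where "good = (\<lambda>(U, W, E). A \<subseteq> U \<and> B \<subseteq> W \<and> openin X U \<and> openin X W \<and>
      X closure_of U \<inter> X closure_of W \<subseteq> E \<and> closedin X E \<and> sigma_large_ind X (n - 1) E \<and>
      E \<inter> U = {} \<and> E \<inter> W = {})"
    have "\<exists>s. \<forall>i. good (s i) \<and> fst (s i) \<subseteq> fst (s (Suc i)) \<and> fst (snd (s i)) \<subseteq> fst (snd (s (Suc i))) \<and>
        C i \<subseteq> fst (s (Suc i)) \<union> fst (snd (s (Suc i))) \<union> snd (snd (s (Suc i)))"
    proof (rule dependent_nat_choice[where P = "\<lambda>i. good" and Q = "\<lambda>i s t. fst s \<subseteq> fst t \<and> fst (snd s) \<subseteq> fst (snd t) \<and>
        C i \<subseteq> fst t \<union> fst (snd t) \<union> snd (snd t)"])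
      show "\<exists>s. good s"
        using UW0 by (intro exI[of _ "(U0, W0, {})"]) (auto simp: good_def sigma_large_ind_empty disjnt_def)
      fix s i assume s: "good s"
      obtain U W E where eq: "s = (U, W, E)" by (cases s)
      have g: "A \<subseteq> U" "B \<subseteq> W" "openin X U" "openin X W" "X closure_of U \<inter> X closure_of W \<subseteq> E"
        "closedin X E" "sigma_large_ind X (n - 1) E" "E \<inter> U = {}" "E \<inter> W = {}"
        using s by (simp_all add: eq good_def)
      obtain U' W' E' where "openin X U'" "openin X W'" "X closure_of U' \<inter> X closure_of W' \<subseteq> E'"
        "closedin X E'" "sigma_large_ind X (n - 1) E'" "E' \<inter> U' = {}" "E' \<inter> W' = {}"
        "U \<subseteq> U'" "W \<subseteq> W'" "C i \<subseteq> U' \<union> W' \<union> E'"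
        by (rule large_ind_sum_step[OF sum X n conjunct1[OF C] conjunct2[OF C] g(3-9)]) (rule that)
      then show "\<exists>t. good t \<and> fst s \<subseteq> fst t \<and> fst (snd s) \<subseteq> fst (snd t) \<and>
          C i \<subseteq> fst t \<union> fst (snd t) \<union> snd (snd t)"
        using g(1,2) by (intro exI[of _ "(U', W', E')"]) (auto simp: eq good_def)
    qed
    then obtain s where s: "\<And>i. good (s i)" "\<And>i. fst (s i) \<subseteq> fst (s (Suc i))"
      "\<And>i. fst (snd (s i)) \<subseteq> fst (snd (s (Suc i)))"
      "\<And>i. C i \<subseteq> fst (s (Suc i)) \<union> fst (snd (s (Suc i))) \<union> snd (snd (s (Suc i)))" by blast
    define U W E where "U i = fst (s i)" and "W i = fst (snd (s i))" and "E i = snd (snd (s i))" for i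
    have g: "A \<subseteq> U i \<and> B \<subseteq> W i \<and> openin X (U i) \<and> openin X (W i) \<and>
      X closure_of (U i) \<inter> X closure_of (W i) \<subseteq> E i \<and> closedin X (E i) \<and> sigma_large_ind X (n - 1) (E i) \<and>
      E i \<inter> U i = {} \<and> E i \<inter> W i = {}" for i
      using s(1)[of i] by (simp add: good_def U_def W_def E_def split: prod.splits)
    have "U i \<subseteq> U (Suc i)" "W i \<subseteq> W (Suc i)" for i using s(2,3) by (simp_all add: U_def W_def)
    then have mono: "U i \<subseteq> U j" "W i \<subseteq> W j" if "i \<le> j" for i j
      using that by (simp_all add: lift_Suc_mono_le)
    \<comment> \<open>The closures of the two sides meet only within \<open>E i\<close>, and
      \<open>E i\<close> meets neither side.\<close>
    have disi: "U i \<inter> W i = {}" for i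
      using g[of i] openin_subset_closure_of[of X "U i"] openin_subset_closure_of[of X "W i"] by blast
    define UU WW M where "UU = (\<Union>i. U i)" and "WW = (\<Union>i. W i)" and "M = topspace X - ((\<Union>i. U i) \<union> (\<Union>i. W i))"
    have op: "openin X UU" "openin X WW" unfolding UU_def WW_def using g by auto
    have "disjnt UU WW"
    proof (unfold disjnt_iff, clarify)
      fix x assume "x \<in> UU" "x \<in> WW"
      then obtain i j where "x \<in> U i" "x \<in> W j" by (auto simp: UU_def WW_def)
      then have "x \<in> U (max i j)" "x \<in> W (max i j)"
        using mono(1)[of i "max i j"] mono(2)[of j "max i j"] by auto
      then show False using disi by blast
    qed
    moreover have "large_ind_le (subtopology X M) (n - 1)"
    proof -
      have clM: "closedin X M" unfolding M_def using op unfolding UU_def WW_def by (simp add: closedin_diff openin_Un)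
      have "sigma_large_ind X (n - 1) (\<Union>i. E i)"
        using g by (intro sigma_large_ind_Union) auto
      moreover have "M \<subseteq> (\<Union>i. E i)"
      proof
        fix x assume x: "x \<in> M"
        then have "x \<in> (\<Union>i. C i)" unfolding covC by (simp add: M_def)
        then obtain i where "x \<in> C i" by blast
        then have "x \<in> U (Suc i) \<union> W (Suc i) \<union> E (Suc i)" using s(4)[of i] by (auto simp: U_def W_def E_def)
        then show "x \<in> (\<Union>i. E i)" using x by (auto simp: M_def)
      qed
      ultimately have "sigma_large_ind (subtopology X M) (n - 1) (topspace (subtopology X M))"
        using sigma_large_ind_relative clM by blast
      then show ?thesis
        using sum perfectly_normal_subtopology(1)[OF X clM] unfolding large_ind_sum_property_def by blast
    qed
    moreover have "A \<subseteq> UU" "B \<subseteq> WW" using g[of 0] by (auto simp: UU_def WW_def)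
    ultimately show "\<exists>G H. openin X G \<and> openin X H \<and> disjnt G H \<and> A \<subseteq> G \<and> B \<subseteq> H \<and>
        large_ind_le (subtopology X (topspace X - (G \<union> H))) (n - 1)"
      using op by (intro exI[of _ UU] exI[of _ WW]) (simp add: M_def UU_def WW_def)
  qed
qed

text \<open>Pieces of dimension -1 are empty, which starts the induction; the open subspace result
  needed at each stage rests on the preceding stage.\<close>

theorem large_ind_sum_property: "-1 \<le> n \<Longrightarrow> large_ind_sum_property TYPE('a) n"
proof (induction n rule: int_ge_induct)
  case base
  have "topspace X = {}" if "sigma_large_ind X (-1) (topspace X)" for X :: "'a topology"
  proof -
    from that[unfolded sigma_large_ind_def] obtain \<C> where "countable \<C> \<and> \<Union>\<C> = topspace X \<and>
      (\<forall>C\<in>\<C>. closedin X C \<and> large_ind_le (subtopology X C) (-1))" ..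
    then have "\<Union>\<C> = topspace X \<and> (\<forall>C\<in>\<C>. topspace X \<inter> C = {})"
      unfolding large_ind_le_minus_one_iff topspace_subtopology by auto
    then have "topspace X \<inter> topspace X = {}" by blast
    then show ?thesis by simp
  qed
  then show ?case unfolding large_ind_sum_property_def by (simp add: large_ind_le_minus_one_iff)
next
  case (step n)
  show ?case by (rule large_ind_sum_property_step) (use step in simp_all)
qed

lemma large_ind_le_sigma:
  assumes "perfectly_normal X" "sigma_large_ind X n (topspace X)" "-1 \<le> n"
  shows "large_ind_le X n"
  using large_ind_sum_property[OF assms(3)] assms(1,2) unfolding large_ind_sum_property_def by blast

lemma large_ind_le_open_subset:
  assumes "perfectly_normal X" "large_ind_le X n" "0 \<le> n" "openin X E"
  shows "large_ind_le (subtopology X E) n"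
  using large_ind_le_open_subset_step[OF large_ind_sum_property assms] assms(3) by simp

section \<open>Large inductive dimension of a fully closed preimage\<close>

lemma perfectly_normal_metrizable: "metrizable_space X \<Longrightarrow> perfectly_normal X"
  unfolding perfectly_normal_def
  by (simp add: metrizable_imp_t1_space metrizable_imp_normal_space closed_imp_gdelta_in)

context fully_closed_surjection begin

definition saturation :: "'a set \<Rightarrow> 'c set \<Rightarrow> 'c set" where
  "saturation Q U = {z \<in> topspace Z. f z \<in> Q \<and> z \<in> U \<or> f z \<in> small_image Z X f U}"

text \<open>The pullback of the quotient topology that collapses every fibre over a point outside \<open>Q\<close>.\<close>

definition collapsed_topology :: "'a set \<Rightarrow> 'c topology" where
  "collapsed_topology Q = topology (\<lambda>U. openin Z U \<and> (\<forall>z\<in>U. f z \<notin> Q \<longrightarrow> f z \<in> small_image Z X f U))"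

lemma openin_collapsed:
  "openin (collapsed_topology Q) U \<longleftrightarrow> openin Z U \<and> (\<forall>z\<in>U. f z \<notin> Q \<longrightarrow> f z \<in> small_image Z X f U)"
proof -
  have "istopology (\<lambda>U. openin Z U \<and> (\<forall>z\<in>U. f z \<notin> Q \<longrightarrow> f z \<in> small_image Z X f U))"
    unfolding istopology_def by (auto simp: small_image_iff)
  then show ?thesis by (simp add: collapsed_topology_def topology_inverse')
qed

lemma topspace_collapsed [simp]: "topspace (collapsed_topology Q) = topspace Z"
proof -
  have "openin (collapsed_topology Q) (topspace Z)"
    by (simp add: openin_collapsed small_image_iff f_in)
  then have "topspace Z \<subseteq> topspace (collapsed_topology Q)" by (rule openin_subset)
  moreover have "openin Z (topspace (collapsed_topology Q))"
    using openin_topspace[of "collapsed_topology Q"] unfolding openin_collapsed by blast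
  ultimately show ?thesis using openin_subset by blast
qed

lemma saturation_subset: "saturation Q U \<subseteq> U"
  by (auto simp: saturation_def small_image_iff)

lemma openin_saturation: "openin Z U \<Longrightarrow> finite Q \<Longrightarrow> openin (collapsed_topology Q) (saturation Q U)"
  unfolding openin_collapsed saturation_def
  by (simp add: openin_saturate_outside_finite) (auto simp: small_image_iff)

lemma openin_collapsed_preimage:
  "openin X V \<Longrightarrow> openin (collapsed_topology Q) {z \<in> topspace Z. f z \<in> V}"
  unfolding openin_collapsed by (simp add: openin_preimage small_image_iff f_in)

text \<open>The complement is open, so away from \<open>Q\<close> it contains every fibre that it
  meets.\<close>

lemma closedin_collapsed_fibre:
  assumes "closedin (collapsed_topology Q) C" "z \<in> C" "w \<in> topspace Z" "f w = f z" "f z \<notin> Q"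
  shows "w \<in> C"
proof (rule ccontr)
  assume "w \<notin> C"
  then have "f w \<in> small_image Z X f (topspace Z - C)"
    using assms unfolding closedin_def openin_collapsed topspace_collapsed by (metis DiffI)
  then show False using assms closedin_subset[OF assms(1)] by (auto simp: small_image_iff)
qed

text \<open>Regularity is meant without separation axioms: points of a collapsed fibre cannot be
  told apart. For a point over \<open>Q\<close>, disjoint open sets of \<open>Z\<close> are
  saturated; for any other point the separation is pulled back from \<open>X\<close>.\<close>

lemma regular_collapsed:
  assumes "finite Q" "Q \<subseteq> topspace X"
  shows "regular_space (collapsed_topology Q)"
  unfolding regular_space_def
proof (intro allI impI, elim conjE)
  fix C a assume C: "closedin (collapsed_topology Q) C" and a: "a \<in> topspace (collapsed_topology Q) - C"
  define U where "U = topspace Z - C"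
  have U: "openin (collapsed_topology Q) U" "openin Z U" "a \<in> U"
    using C a unfolding U_def closedin_def openin_collapsed by auto
  have CZ: "C \<subseteq> topspace Z" using closedin_subset[OF C] by simp
  show "\<exists>U V. openin (collapsed_topology Q) U \<and> openin (collapsed_topology Q) V \<and> a \<in> U \<and> C \<subseteq> V \<and> disjnt U V"
  proof (cases "f a \<in> Q")
    case True
    obtain N where N: "openin Z N" "a \<in> N" "Z closure_of N \<subseteq> U"
      using regular_space_open_closure[OF regular_Z U(2,3)] .
    let ?M = "topspace Z - Z closure_of N"
    have "openin Z ?M" by (simp add: openin_diff)
    have NM: "disjnt N ?M" using openin_subset_closure_of[OF N(1)] by (auto simp: disjnt_iff)
    show ?thesis
    proof (intro exI conjI)
      show "openin (collapsed_topology Q) (saturation Q N)" "openin (collapsed_topology Q) (saturation Q ?M)"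
        using openin_saturation N(1) \<open>openin Z ?M\<close> assms(1) by blast+
      show "a \<in> saturation Q N" using True N(2) a by (simp add: saturation_def)
      show "disjnt (saturation Q N) (saturation Q ?M)"
        using NM saturation_subset by (meson disjnt_subset1 disjnt_subset2)
      show "C \<subseteq> saturation Q ?M"
      proof
        fix z assume z: "z \<in> C"
        have "w \<in> ?M" if "w \<in> C" for w using that CZ N(3) U_def by blast
        moreover have "w \<in> C" if "w \<in> topspace Z" "f w = f z" "f z \<notin> Q" for w
          using closedin_collapsed_fibre[OF C z that] .
        ultimately show "z \<in> saturation Q ?M"
          using z CZ f_in by (auto simp: saturation_def small_image_iff)
      qed
    qed
  next
    case False
    then have fa: "f a \<in> small_image Z X f U - Q" using U unfolding openin_collapsed by blast
    have op: "openin X (small_image Z X f U - Q)"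
      using openin_small_image[OF U(2)] closedin_finite_X[OF assms] by blast
    obtain V where V: "openin X V" "f a \<in> V" "X closure_of V \<subseteq> small_image Z X f U - Q"
      using regular_space_open_closure[OF regular_X op fa] .
    show ?thesis
    proof (intro exI conjI)
      show "openin (collapsed_topology Q) {z \<in> topspace Z. f z \<in> V}"
        "openin (collapsed_topology Q) {z \<in> topspace Z. f z \<in> topspace X - X closure_of V}"
        using openin_collapsed_preimage[OF V(1)] openin_collapsed_preimage[of "topspace X - X closure_of V"]
        by (simp_all add: openin_diff)
      show "a \<in> {z \<in> topspace Z. f z \<in> V}" using a V by simp
      show "disjnt {z \<in> topspace Z. f z \<in> V} {z \<in> topspace Z. f z \<in> topspace X - X closure_of V}"
        using openin_subset_closure_of[OF V(1)] by (auto simp: disjnt_iff)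
      show "C \<subseteq> {z \<in> topspace Z. f z \<in> topspace X - X closure_of V}"
      proof
        fix z assume z: "z \<in> C"
        then have "f z \<notin> small_image Z X f U" using CZ by (auto simp: small_image_iff U_def)
        then show "z \<in> {z \<in> topspace Z. f z \<in> topspace X - X closure_of V}"
          using z CZ V(3) f_in by blast
      qed
    qed
  qed
qed

text \<open>Deleting a G-delta set from a compactum leaves a sigma-compact, hence Lindelof space.
  The collapsed topology is coarser and so Lindelof as well, and regular Lindelof spaces are
  normal.\<close>

lemma normal_collapsed_gdelta_complement:
  assumes "finite Q" "Q \<subseteq> topspace X" "gdelta_in Z P"
  shows "normal_space (subtopology (collapsed_topology Q) (topspace Z - P))"
proof (rule regular_Lindelof_imp_normal_space)
  let ?S = "topspace Z - P"
  show "regular_space (subtopology (collapsed_topology Q) ?S)"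
    using regular_collapsed assms by (simp add: regular_space_subtopology)
  obtain C :: "nat \<Rightarrow> 'c set" where C: "\<And>i. closedin Z (C i)" "\<Union>(range C) = ?S"
    using assms(3) unfolding gdelta_in_fsigma_in fsigma_in_ascending by blast
  have "Lindelof_space (subtopology Z (\<Union>(range C)))"
  proof (rule Lindelof_space_Union)
    show "Lindelof_space (subtopology Z D)" if "D \<in> range C" for D
      using that C(1) compact_Z by (auto intro: Lindelof_space_closedin_subtopology compact_imp_Lindelof_space)
  qed simp
  then have L: "Lindelof_space (subtopology Z ?S)" by (simp add: C(2))
  have "continuous_map Z (collapsed_topology Q) id"
    unfolding continuous_map_def using openin_subset
    by (auto simp: openin_collapsed Collect_conj_eq Int_absorb1)
  then have "continuous_map (subtopology Z ?S) (subtopology (collapsed_topology Q) ?S) id"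
    by (simp add: continuous_map_in_subtopology continuous_map_from_subtopology)
  then show "Lindelof_space (subtopology (collapsed_topology Q) ?S)"
    by (rule Lindelof_space_continuous_map_image[OF L]) auto
qed

lemma gdelta_in_preimage:
  assumes "gdelta_in X S"
  shows "gdelta_in Z {z \<in> topspace Z. f z \<in> S}"
proof -
  obtain C :: "nat \<Rightarrow> 'a set" where C: "\<And>i. closedin X (C i)" "\<Union>(range C) = topspace X - S"
    using assms unfolding gdelta_in_fsigma_in fsigma_in_ascending by blast
  have "topspace Z - {z \<in> topspace Z. f z \<in> S} = \<Union>(range (\<lambda>i. {z \<in> topspace Z. f z \<in> C i}))" (is "?L = ?R")
  proof -
    have "?L = {z \<in> topspace Z. f z \<in> topspace X - S}" using f_in by auto
    also have "\<dots> = ?R" unfolding C(2)[symmetric] by blast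
    finally show ?thesis .
  qed
  moreover have "fsigma_in Z ?R"
    using C(1) closedin_preimage by (intro fsigma_in_Union) (auto simp: closed_imp_fsigma_in)
  ultimately show ?thesis unfolding gdelta_in_fsigma_in by auto
qed

text \<open>Points of \<open>X\<close> are G-delta, hence so are the fibres, and in a metrizable
  fibre every closed set is G-delta. The sum theorem transfers the dimension bound to the union of
  the fibres over \<open>Q\<close>.\<close>

lemma finite_fibres:
  assumes X: "perfectly_normal X"
    and fib: "\<And>x. x \<in> topspace X \<Longrightarrow> metrizable_space (fibre Z f x) \<and> large_ind_le (fibre Z f x) m"
    and Q: "finite Q" "Q \<subseteq> topspace X" and m: "0 \<le> m"
  defines "F \<equiv> {z \<in> topspace Z. f z \<in> Q}"
  shows "closedin Z F" "perfectly_normal (subtopology Z F)" "large_ind_le (subtopology Z F) m"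
    "\<And>P. closedin Z P \<Longrightarrow> P \<subseteq> F \<Longrightarrow> gdelta_in Z P"
proof -
  show clF: "closedin Z F" unfolding F_def using closedin_preimage closedin_finite_X[OF Q] by blast
  show gdelta: "gdelta_in Z P" if P: "closedin Z P" "P \<subseteq> F" for P
  proof -
    let ?F = "\<lambda>x. {z \<in> topspace Z. f z = x}"
    have gd: "gdelta_in Z (P \<inter> ?F x)" if x: "x \<in> Q" for x
    proof -
      have xX: "x \<in> topspace X" using x Q by blast
      have "gdelta_in X {x}" using X closedin_finite_X[of "{x}"] xX by (simp add: perfectly_normal_def)
      then have "gdelta_in Z (?F x)" using gdelta_in_preimage[of "{x}"] by simp
      moreover have "closedin (fibre Z f x) (P \<inter> ?F x)"
        unfolding fibre_def using P(1) by (auto simp: closedin_subtopology)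
      then have "gdelta_in (fibre Z f x) (P \<inter> ?F x)"
        using perfectly_normal_metrizable fib[OF xX] unfolding perfectly_normal_def by blast
      ultimately show ?thesis unfolding fibre_def by (simp add: gdelta_in_gdelta_subtopology)
    qed
    have "gdelta_in Z (\<Union>x\<in>R. P \<inter> ?F x)" if "finite R" "R \<subseteq> Q" for R
      using that by (induction R rule: finite_induct) (simp_all add: gdelta_in_Un gd)
    then have "gdelta_in Z (\<Union>x\<in>Q. P \<inter> ?F x)" using Q(1) by blast
    moreover have "(\<Union>x\<in>Q. P \<inter> ?F x) = P" using P(2) by (auto simp: F_def)
    ultimately show ?thesis by simp
  qed
  show pn: "perfectly_normal (subtopology Z F)"
    unfolding perfectly_normal_def
  proof (intro conjI allI impI)
    show "t1_space (subtopology Z F)"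
      using Hausdorff_Z Hausdorff_imp_t1_space t1_space_subtopology by blast
    show "normal_space (subtopology Z F)"
      using normal_Z clF normal_space_closed_subtopology by blast
    fix C assume "closedin (subtopology Z F) C"
    then have "closedin Z C" "C \<subseteq> F" using clF by (auto simp: closedin_closed_subtopology)
    then have "gdelta_in Z (C \<inter> F)" using gdelta by (simp add: inf.absorb1)
    then show "gdelta_in (subtopology Z F) C"
      using \<open>C \<subseteq> F\<close> gdelta by (metis \<open>closedin Z C\<close> gdelta_in_subtopology inf.absorb1)
  qed
  have topF: "topspace (subtopology Z F) = F" by (auto simp: F_def)
  show "large_ind_le (subtopology Z F) m"
  proof (rule large_ind_le_sigma[OF pn])
    show "-1 \<le> m" using m by simp
    have "sigma_large_ind (subtopology Z F) m (\<Union>((\<lambda>x. {z \<in> topspace Z. f z = x}) ` Q))"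
    proof (rule sigma_large_ind_Union)
      show "countable ((\<lambda>x. {z \<in> topspace Z. f z = x}) ` Q)" using Q(1) by (simp add: countable_finite)
      fix S assume "S \<in> (\<lambda>x. {z \<in> topspace Z. f z = x}) ` Q"
      then obtain x where x: "x \<in> Q" "S = {z \<in> topspace Z. f z = x}" by blast
      have SF: "S \<subseteq> F" using x by (auto simp: F_def)
      have "closedin (subtopology Z F) S"
        using closedin_fibre[of x] x Q SF by (intro closedin_subset_topspace) auto
      moreover have "subtopology (subtopology Z F) S = fibre Z f x"
        using SF x by (simp add: fibre_def subtopology_subtopology inf.absorb2)
      ultimately show "sigma_large_ind (subtopology Z F) m S"
        using fib[of x] x Q by (intro sigma_large_ind_closed) auto
    qed
    moreover have "(\<Union>x\<in>Q. {z \<in> topspace Z. f z = x}) = F" by (auto simp: F_def)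
    ultimately show "sigma_large_ind (subtopology Z F) m (topspace (subtopology Z F))"
      unfolding topF by simp
  qed
qed

text \<open>Three separations: of the traces of \<open>A\<close> and \<open>B\<close> on the fibres
  over \<open>Q\<close>, leaving \<open>P\<close>; of the enlarged sets in the collapsed complement
  of \<open>P\<close>; and of the images of the resulting closures in \<open>X\<close> minus
  \<open>Q\<close>, leaving \<open>L\<close>. The second one makes the other two compatible near
  \<open>Q\<close>.\<close>

lemma large_ind_total_partition:
  assumes X: "perfectly_normal X" "large_ind_le X n" "0 \<le> n"
    and fib: "\<And>x. x \<in> topspace X \<Longrightarrow> metrizable_space (fibre Z f x) \<and> large_ind_le (fibre Z f x) m"
    and m: "0 \<le> m"
    and AB: "closedin Z A" "closedin Z B" "disjnt A B"
  obtains U W P L Q where "openin Z U" "openin Z W" "disjnt U W" "A \<subseteq> U" "B \<subseteq> W"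
    "finite Q" "Q \<subseteq> topspace X" "P \<subseteq> {z \<in> topspace Z. f z \<in> Q}" "L \<subseteq> topspace X - Q"
    "large_ind_le (subtopology Z P) (m - 1)" "large_ind_le (subtopology X L) (n - 1)"
    "closedin (subtopology X (topspace X - Q)) L"
    "topspace Z - (U \<union> W) \<subseteq> P \<union> {z \<in> topspace Z. f z \<in> L}"
proof -
  define Q where "Q = f ` A \<inter> f ` B"
  have Q: "finite Q" "Q \<subseteq> topspace X"
    using finite_image_Int[OF AB] image_subset[OF closedin_subset[OF AB(1)]] by (auto simp: Q_def)
  define F where "F = {z \<in> topspace Z. f z \<in> Q}"
  have F: "closedin Z F" "perfectly_normal (subtopology Z F)" "large_ind_le (subtopology Z F) m"
    unfolding F_def using finite_fibres(1-3)[OF X(1) _ Q m] fib by auto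
  have gdelta: "gdelta_in Z P" if "closedin Z P" "P \<subseteq> F" for P
    using finite_fibres(4)[OF X(1) _ Q m that(1)] fib that(2) unfolding F_def by auto
  have FZ: "F \<subseteq> topspace Z" by (auto simp: F_def)
  have topF: "topspace (subtopology Z F) = F" using FZ by auto
  have normF: "normal_space (subtopology Z F)" using F(2) by (simp add: perfectly_normal_def)
  have clAF: "closedin (subtopology Z F) (F \<inter> A)" "closedin (subtopology Z F) (F \<inter> B)"
    using AB by (simp_all add: closedin_subtopology_Int_closed)
  have disF: "disjnt (F \<inter> A) (F \<inter> B)" using AB(3) by (auto simp: disjnt_iff)
  obtain G0 H0 where G0H0: "openin (subtopology Z F) G0" "openin (subtopology Z F) H0" "disjnt G0 H0"
    "F \<inter> A \<subseteq> G0" "F \<inter> B \<subseteq> H0"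
    "large_ind_le (subtopology (subtopology Z F) (topspace (subtopology Z F) - (G0 \<union> H0))) (m - 1)"
    by (rule large_ind_le_partition[OF F(3) m normF clAF disF]) (rule that)
  have GHF: "G0 \<subseteq> F" "H0 \<subseteq> F" using G0H0(1,2) openin_subset topF by blast+
  define P where "P = F - (G0 \<union> H0)"
  have indP: "large_ind_le (subtopology Z P) (m - 1)"
    using G0H0(6) unfolding topF P_def by (simp add: subtopology_subtopology Int_absorb1 Diff_subset)
  have clFH: "closedin Z (F - H0)" "closedin Z (F - G0)" "closedin Z P"
  proof -
    have "closedin (subtopology Z F) (F - V)" if "openin (subtopology Z F) V" for V
      using that by (metis closedin_diff closedin_topspace topF)
    then show "closedin Z (F - H0)" "closedin Z (F - G0)" "closedin Z P"
      unfolding P_def using G0H0(1,2) F(1) by (auto simp: closedin_closed_subtopology openin_Un)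
  qed
  define R where "R = topspace Z - P"
  define K where "K = subtopology (collapsed_topology Q) R"
  have PF: "P \<subseteq> F" by (auto simp: P_def)
  have normK: "normal_space K" unfolding K_def R_def
    using normal_collapsed_gdelta_complement[OF Q gdelta[OF clFH(3) PF]] .
  have topK: "topspace K = R" by (auto simp: K_def R_def)
  have op_off: "openin (collapsed_topology Q) (topspace Z - D)" if "closedin Z D" "D \<subseteq> F" for D
    using that unfolding openin_collapsed by (auto simp: small_image_iff F_def f_in)
  have opR: "openin (collapsed_topology Q) R" unfolding R_def using op_off[OF clFH(3) PF] .
  \<comment> \<open>Over \<open>Q\<close> the set \<open>D\<close> is enlarged to a side
    \<open>V\<close> of the fibre partition, elsewhere to full fibres. The result is closed in the
    collapsed space once \<open>P\<close> has been removed.\<close>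
  define hat where "hat D V = {z \<in> topspace Z. f z \<notin> Q \<and> f z \<in> f ` D} \<union> V" for D V
  have hat_closed: "closedin K (hat D V)"
    if D: "closedin Z D" and V: "V \<subseteq> F" "F \<inter> D \<subseteq> V" "disjnt V V'" "V' \<subseteq> F" "F - (V \<union> V') = P"
      "closedin Z (F - V')" for D V V'
  proof -
    have "openin (collapsed_topology Q) (saturation Q (topspace Z - D) \<inter> (topspace Z - (F - V')))"
      using openin_saturation[of "topspace Z - D" Q] D Q(1) op_off[OF V(6)] by blast
    then have "openin K ((saturation Q (topspace Z - D) \<inter> (topspace Z - (F - V'))) \<inter> R)"
      unfolding K_def by (simp add: openin_subtopology_Int)
    moreover have "(saturation Q (topspace Z - D) \<inter> (topspace Z - (F - V'))) \<inter> R = topspace K - hat D V"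
      unfolding topK
    proof (intro set_eqI iffI)
      fix z assume z: "z \<in> (saturation Q (topspace Z - D) \<inter> (topspace Z - (F - V'))) \<inter> R"
      then have "f z \<notin> f ` D" if "f z \<notin> Q"
        using that closedin_subset[OF D] by (auto simp: saturation_def small_image_iff)
      moreover have "z \<notin> V" using z V(1,3) by (auto simp: disjnt_iff)
      ultimately show "z \<in> R - hat D V" using z by (auto simp: hat_def)
    next
      fix z assume z: "z \<in> R - hat D V"
      then have zZ: "z \<in> topspace Z" by (simp add: R_def)
      show "z \<in> (saturation Q (topspace Z - D) \<inter> (topspace Z - (F - V'))) \<inter> R"
      proof (cases "f z \<in> Q")
        case True
        then have "z \<in> F" using zZ by (simp add: F_def)
        then show ?thesis using z zZ True V(2,5) by (auto simp: hat_def saturation_def R_def)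
      next
        case False
        then have "f z \<notin> f ` D" using z zZ by (auto simp: hat_def)
        then have "f z \<in> small_image Z X f (topspace Z - D)"
          using f_in[OF zZ] by (auto simp: small_image_def)
        then show ?thesis using z zZ False by (auto simp: saturation_def F_def)
      qed
    qed
    moreover have "hat D V \<subseteq> topspace K" unfolding topK R_def hat_def using V(1) FZ V(5) by (auto simp: F_def)
    ultimately show ?thesis by (simp add: closedin_def)
  qed
  have clA: "closedin K (hat A G0)"
    by (rule hat_closed[OF AB(1) GHF(1) G0H0(4,3) GHF(2) _ clFH(1)]) (simp add: P_def)
  have clB: "closedin K (hat B H0)"
    by (rule hat_closed[OF AB(2) GHF(2) G0H0(5) _ GHF(1) _ clFH(2)])
      (use G0H0(3) in \<open>auto simp: P_def disjnt_sym\<close>)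
  have dis_hat: "disjnt (hat A G0) (hat B H0)"
    using G0H0(3) GHF unfolding disjnt_iff hat_def by (auto simp: F_def Q_def)
  obtain S1 S2 where S: "openin K S1" "openin K S2" "hat A G0 \<subseteq> S1" "hat B H0 \<subseteq> S2"
    "disjnt (K closure_of S1) (K closure_of S2)"
    by (rule normal_space_disjoint_nbhds[OF normK clA clB dis_hat]) (rule that)
  have opS: "openin Z S1" "openin Z S2"
    using S(1,2) opR unfolding K_def by (auto simp: openin_open_subtopology openin_collapsed)
  define E where "E = topspace X - Q"
  have opE: "openin X E" unfolding E_def using closedin_finite_X[OF Q] by blast
  \<comment> \<open>Away from \<open>Q\<close> closed sets consist of full fibres, so disjoint
    closures have disjoint images there; these images are closed in \<open>E\<close> because
    \<open>f\<close> is a closed map.\<close>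
  have shadow: "\<exists>C. closedin Z C \<and> f ` (K closure_of S) - Q = f ` C \<inter> E \<and>
      (\<forall>z\<in>K closure_of S. \<forall>w\<in>topspace Z. f w = f z \<longrightarrow> f z \<notin> Q \<longrightarrow> w \<in> K closure_of S)" for S
  proof -
    have "closedin K (K closure_of S)" by simp
    then obtain C where C: "closedin (collapsed_topology Q) C" "K closure_of S = C \<inter> R"
      unfolding K_def closedin_subtopology by blast
    have "closedin Z C" using C(1) unfolding closedin_def openin_collapsed by simp
    have CZ: "C \<subseteq> topspace Z" using C(1) closedin_subset by fastforce
    have inR: "w \<in> R" if "w \<in> topspace Z" "f w \<notin> Q" for w
      using that PF by (auto simp: R_def F_def)
    have "f ` (K closure_of S) - Q = f ` C \<inter> E"
      unfolding C(2) E_def using inR CZ f_in by blast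
    moreover have "w \<in> K closure_of S" if "z \<in> K closure_of S" "w \<in> topspace Z" "f w = f z" "f z \<notin> Q" for z w
      using closedin_collapsed_fibre[OF C(1), of z w] that inR[of w] unfolding C(2) by auto
    ultimately show ?thesis using \<open>closedin Z C\<close> by blast
  qed
  obtain C1 where C1: "closedin Z C1" "f ` (K closure_of S1) - Q = f ` C1 \<inter> E"
    "\<And>z w. z \<in> K closure_of S1 \<Longrightarrow> w \<in> topspace Z \<Longrightarrow> f w = f z \<Longrightarrow> f z \<notin> Q \<Longrightarrow> w \<in> K closure_of S1"
    using shadow[of S1] by blast
  obtain C2 where C2: "closedin Z C2" "f ` (K closure_of S2) - Q = f ` C2 \<inter> E"
    using shadow[of S2] by blast
  have clD: "closedin (subtopology X E) (f ` (K closure_of S1) - Q)"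
    "closedin (subtopology X E) (f ` (K closure_of S2) - Q)"
    unfolding C1(2) C2(2) using closedin_image[OF C1(1)] closedin_image[OF C2(1)]
    by (auto simp: closedin_subtopology)
  have clK: "K closure_of S \<subseteq> topspace Z" for S
    using closure_of_subset_topspace[of K S] by (auto simp: topK R_def)
  have disD: "disjnt (f ` (K closure_of S1) - Q) (f ` (K closure_of S2) - Q)"
  proof (rule ccontr)
    assume "\<not> ?thesis"
    then obtain z1 z2 where z: "z1 \<in> K closure_of S1" "z2 \<in> K closure_of S2" "f z1 = f z2" "f z2 \<notin> Q"
      by (auto simp: disjnt_def)
    then have "z2 \<in> K closure_of S1" using C1(3)[OF z(1), of z2] clK by auto
    then show False using S(5) z(2) by (auto simp: disjnt_iff)
  qed
  have pE: "perfectly_normal (subtopology X E)" "large_ind_le (subtopology X E) n"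
    using perfectly_normal_subtopology(2)[OF X(1) opE] large_ind_le_open_subset[OF X opE] .
  have normE: "normal_space (subtopology X E)" using pE(1) by (simp add: perfectly_normal_def)
  have topE: "topspace (subtopology X E) = E" by (auto simp: E_def)
  obtain G H where GH: "openin (subtopology X E) G" "openin (subtopology X E) H" "disjnt G H"
    "f ` (K closure_of S1) - Q \<subseteq> G" "f ` (K closure_of S2) - Q \<subseteq> H"
    "large_ind_le (subtopology (subtopology X E) (topspace (subtopology X E) - (G \<union> H))) (n - 1)"
    by (rule large_ind_le_partition[OF pE(2) X(3) normE clD disD]) (rule that)
  have opGH: "openin X G" "openin X H" "G \<subseteq> E" "H \<subseteq> E"
    using GH(1,2) opE by (auto simp: openin_open_subtopology)
  define L where "L = E - (G \<union> H)"
  have clL: "closedin (subtopology X E) L"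
    using GH(1,2) unfolding L_def by (metis closedin_diff closedin_topspace openin_Un topE)
  have indL: "large_ind_le (subtopology X L) (n - 1)"
    using GH(6) unfolding topE L_def by (simp add: subtopology_subtopology Int_absorb1 Diff_subset)
  \<comment> \<open>Over \<open>Q\<close> the sets \<open>S1\<close> and \<open>S2\<close> decide,
    elsewhere the partition of the base. The two rules agree off \<open>Q\<close>, where the images
    of \<open>S1\<close> and \<open>S2\<close> fall into \<open>G\<close> and
    \<open>H\<close>.\<close>
  define U W where "U = S1 \<union> {z \<in> topspace Z. f z \<in> G}" and "W = S2 \<union> {z \<in> topspace Z. f z \<in> H}"
  have SK: "S1 \<subseteq> K closure_of S1" "S2 \<subseteq> K closure_of S2"
    using openin_subset_closure_of S(1,2) by blast+
  have S1G: "f z \<in> G" if "z \<in> S1" "f z \<notin> Q" for z using that SK(1) GH(4) by blast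
  have S2H: "f z \<in> H" if "z \<in> S2" "f z \<notin> Q" for z using that SK(2) GH(5) by blast
  have notQ: "f z \<notin> Q" if "f z \<in> G \<or> f z \<in> H" for z using that opGH(3,4) by (auto simp: E_def)
  have "openin Z U" "openin Z W" unfolding U_def W_def
    using opS openin_preimage opGH(1,2) by (simp_all add: openin_Un)
  moreover have "disjnt U W"
  proof (unfold disjnt_iff, intro allI notI, elim conjE)
    fix z assume z: "z \<in> U" "z \<in> W"
    have "\<not> (z \<in> S1 \<and> z \<in> S2)" using SK S(5) by (auto simp: disjnt_iff)
    then show False using z S1G[of z] S2H[of z] notQ[of z] GH(3)
      unfolding U_def W_def disjnt_iff by blast
  qed
  moreover have "A \<subseteq> hat A G0" "B \<subseteq> hat B H0"
    using G0H0(4,5) closedin_subset[OF AB(1)] closedin_subset[OF AB(2)] by (auto simp: hat_def F_def)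
  then have "A \<subseteq> U" "B \<subseteq> W" using S(3,4) unfolding U_def W_def by blast+
  moreover have "topspace Z - (U \<union> W) \<subseteq> P \<union> {z \<in> topspace Z. f z \<in> L}"
  proof
    fix z assume z: "z \<in> topspace Z - (U \<union> W)"
    show "z \<in> P \<union> {z \<in> topspace Z. f z \<in> L}"
    proof (cases "f z \<in> Q")
      case True
      then have "z \<in> F" "z \<notin> G0" "z \<notin> H0" using z S(3,4) by (auto simp: F_def U_def W_def hat_def)
      then show ?thesis by (simp add: P_def)
    next
      case False
      then show ?thesis using z f_in[of z] by (auto simp: U_def W_def L_def E_def)
    qed
  qed
  moreover have "P \<subseteq> {z \<in> topspace Z. f z \<in> Q}" using PF by (simp add: F_def)
  moreover have "L \<subseteq> topspace X - Q" by (auto simp: L_def E_def)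
  ultimately show ?thesis using Q indP indL clL unfolding E_def by (intro that[of U W Q P L])
qed

lemma restriction:
  assumes "closedin X T"
  shows "fully_closed_surjection (subtopology Z {z \<in> topspace Z. f z \<in> T}) (subtopology X T) f"
    and "x \<in> T \<Longrightarrow> fibre (subtopology Z {z \<in> topspace Z. f z \<in> T}) f x = fibre Z f x"
proof -
  let ?S = "{z \<in> topspace Z. f z \<in> T}"
  have S: "closedin Z ?S" using assms by (rule closedin_preimage)
  show "fully_closed_surjection (subtopology Z ?S) (subtopology X T) f"
  proof
    show "compact_space (subtopology Z ?S)" using S compact_Z by (simp add: closedin_compact_space compact_space_subtopology)
    show "Hausdorff_space (subtopology Z ?S)" "Hausdorff_space (subtopology X T)"
      using Hausdorff_Z Hausdorff_X by (auto intro: Hausdorff_space_subtopology)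
    show "continuous_map (subtopology Z ?S) (subtopology X T) f"
      using cont by (auto simp: continuous_map_in_subtopology continuous_map_from_subtopology)
    show "f ` topspace (subtopology Z ?S) = topspace (subtopology X T)"
    proof
      show "f ` topspace (subtopology Z ?S) \<subseteq> topspace (subtopology X T)" using f_in by auto
      show "topspace (subtopology X T) \<subseteq> f ` topspace (subtopology Z ?S)"
      proof
        fix x assume "x \<in> topspace (subtopology X T)"
        then have x: "x \<in> topspace X" "x \<in> T" by auto
        obtain z where "z \<in> topspace Z" "f z = x" using fibre_nonempty[OF x(1)] by blast
        then show "x \<in> f ` topspace (subtopology Z ?S)" using x by auto
      qed
    qed
    show "fully_closed (subtopology Z ?S) (subtopology X T) f"
      unfolding fully_closed_def
    proof (intro allI impI, elim conjE)
      fix D D' assume D: "closedin (subtopology Z ?S) D" "closedin (subtopology Z ?S) D'" "disjnt D D'"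
      then have D': "closedin Z D" "closedin Z D'" "D \<subseteq> ?S" using S by (auto simp: closedin_closed_subtopology)
      then have "subtopology X (f ` D \<inter> f ` D') = discrete_topology (f ` D \<inter> f ` D')"
        using fully_closed D(3) unfolding fully_closed_def by blast
      moreover have "f ` D \<inter> f ` D' \<subseteq> T" using D'(3) by blast
      ultimately show "subtopology (subtopology X T) (f ` D \<inter> f ` D') = discrete_topology (f ` D \<inter> f ` D')"
        by (simp add: subtopology_subtopology inf.absorb2)
    qed
  qed
  have "{z \<in> topspace (subtopology Z ?S). f z = x} = {z \<in> topspace Z. f z = x}" "{z \<in> topspace Z. f z = x} \<subseteq> ?S"
    if "x \<in> T" for x using that by auto
  then show "fibre (subtopology Z ?S) f x = fibre Z f x" if "x \<in> T" for x
    using that by (simp add: fibre_def subtopology_subtopology inf.absorb2)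
qed

end

text \<open>\<open>L\<close> is closed only relative to the complement of \<open>Q\<close>, and
  adding \<open>Q\<close> closes it. Since \<open>L\<close> is F-sigma in \<open>X\<close> and
  single points have dimension 0, the sum theorem shows that the added points do not raise the
  bound.\<close>

lemma large_ind_le_finite_Un:
  assumes X: "perfectly_normal X" and Q: "finite Q" "Q \<subseteq> topspace X" and n: "0 \<le> n"
    and L: "closedin (subtopology X (topspace X - Q)) L" "large_ind_le (subtopology X L) n"
  shows "closedin X (L \<union> Q)" "large_ind_le (subtopology X (L \<union> Q)) n"
proof -
  have t1: "t1_space X" using X by (simp add: perfectly_normal_def)
  then have clQ: "closedin X Q" using Q by (simp add: t1_space_closedin_finite)
  obtain T where T: "closedin X T" "L = T \<inter> (topspace X - Q)" using L(1) by (auto simp: closedin_subtopology)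
  have "L \<union> Q = T \<union> Q" using T closedin_subset[OF T(1)] by blast
  then show cl: "closedin X (L \<union> Q)" using T(1) clQ by (simp add: closedin_Un)
  have "openin X (topspace X - Q)" using clQ by blast
  then have "fsigma_in X L" unfolding T(2) using X T(1)
    by (intro fsigma_in_Int perfectly_normal_open_imp_fsigma closed_imp_fsigma_in)
  then have "sigma_large_ind X n L" using L(2) by (rule sigma_large_ind_fsigma)
  moreover have "sigma_large_ind X n {q}" if "q \<in> Q" for q
  proof (rule sigma_large_ind_closed)
    show "closedin X {q}" using t1 that Q by (simp add: closedin_t1_singleton subsetD)
    have "topspace (subtopology X {q}) = {q}" using that Q by auto
    show "large_ind_le (subtopology X {q}) n"
    proof (rule large_ind_leI[OF n])
      fix A B assume AB: "closedin (subtopology X {q}) A" "closedin (subtopology X {q}) B" "disjnt A B"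
      then have sub: "A \<subseteq> {q}" "B \<subseteq> {q}" using closedin_subset \<open>topspace (subtopology X {q}) = {q}\<close> by blast+
      let ?Y = "subtopology X {q}"
      \<comment> \<open>At most one of \<open>A\<close> and \<open>B\<close> contains
        \<open>q\<close>, so the two sides can be chosen clopen and leave nothing between
        them.\<close>
      define G where "G = (if q \<in> B then {} else {q})"
      have op: "openin ?Y G" "openin ?Y (topspace ?Y - G)"
        using openin_topspace[of ?Y] \<open>topspace ?Y = {q}\<close> by (auto simp: G_def)
      have "large_ind_le (subtopology ?Y (topspace ?Y - (G \<union> (topspace ?Y - G)))) (n - 1)"
        by (rule large_ind_le_empty) (use n in auto)
      moreover have "A \<subseteq> G" "B \<subseteq> topspace ?Y - G" "disjnt G (topspace ?Y - G)"
        using sub AB(3) \<open>topspace ?Y = {q}\<close> by (auto simp: G_def disjnt_iff)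
      ultimately show "\<exists>G H. openin ?Y G \<and> openin ?Y H \<and> disjnt G H \<and> A \<subseteq> G \<and> B \<subseteq> H \<and>
          large_ind_le (subtopology ?Y (topspace ?Y - (G \<union> H))) (n - 1)"
        using op by blast
    qed
  qed
  then have "sigma_large_ind X n (\<Union>((\<lambda>q. {q}) ` Q))"
    using Q(1) by (intro sigma_large_ind_Union) (auto simp: countable_finite)
  ultimately have "sigma_large_ind X n (L \<union> Q)" by (intro sigma_large_ind_Un) simp_all
  then have "sigma_large_ind (subtopology X (L \<union> Q)) n (topspace (subtopology X (L \<union> Q)))"
    using sigma_large_ind_relative cl by blast
  then show "large_ind_le (subtopology X (L \<union> Q)) n"
    using large_ind_le_sigma[OF perfectly_normal_subtopology(1)[OF X cl]] n by simp
qed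

text \<open>Induction on the bound for \<open>X\<close>. The partition in \<open>Z\<close> lies over
  \<open>L\<close> together with \<open>Q\<close>, a closed set of smaller dimension, so the
  induction hypothesis bounds its preimage. For bound 0 the set \<open>L\<close> is empty and the
  partition lies in \<open>P\<close>, inside finitely many fibres.\<close>

lemma large_ind_le_total:
  fixes Z :: "'c topology" and X :: "'a topology"
  assumes "fully_closed_surjection Z X f" "perfectly_normal X" "large_ind_le X (int n)" "0 \<le> m"
    and "\<And>x. x \<in> topspace X \<Longrightarrow> metrizable_space (fibre Z f x) \<and> large_ind_le (fibre Z f x) m"
  shows "large_ind_le Z (int n + m)"
  using assms
proof (induction n arbitrary: Z X)
  case (0 Z X)
  interpret fully_closed_surjection Z X f by (rule 0)
  show ?case
  proof (rule large_ind_leI)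
    fix A B assume AB: "closedin Z A" "closedin Z B" "disjnt A B"
    obtain U W P L Q where *: "openin Z U" "openin Z W" "disjnt U W" "A \<subseteq> U" "B \<subseteq> W"
      "finite Q" "Q \<subseteq> topspace X" "P \<subseteq> {z \<in> topspace Z. f z \<in> Q}" "L \<subseteq> topspace X - Q"
      "large_ind_le (subtopology Z P) (m - 1)" "large_ind_le (subtopology X L) (int 0 - 1)"
      "closedin (subtopology X (topspace X - Q)) L"
      "topspace Z - (U \<union> W) \<subseteq> P \<union> {z \<in> topspace Z. f z \<in> L}"
      by (rule large_ind_total_partition[OF 0(2,3) of_nat_0_le_iff _ 0(4) AB]) (rule 0(5), assumption, rule that)
    have "topspace (subtopology X L) = {}" using *(11) by (simp add: large_ind_le_minus_one_iff)
    then have "L = {}" using *(9) by auto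
    then have sub: "topspace Z - (U \<union> W) \<subseteq> P" using *(13) by simp
    have "closedin Z (topspace Z - (U \<union> W))" using *(1,2) by (simp add: closedin_diff openin_Un)
    then have "closedin (subtopology Z P) (topspace Z - (U \<union> W))" using sub by (intro closedin_subset_topspace)
    then have "large_ind_le (subtopology Z (topspace Z - (U \<union> W))) (m - 1)"
      using large_ind_le_closed_subset'[OF *(10) sub] by blast
    then show "\<exists>G H. openin Z G \<and> openin Z H \<and> disjnt G H \<and> A \<subseteq> G \<and> B \<subseteq> H \<and>
        large_ind_le (subtopology Z (topspace Z - (G \<union> H))) (int 0 + m - 1)"
      using *(1-5) by auto
  qed (use 0 in simp)
next
  case (Suc n Z X)
  interpret fully_closed_surjection Z X f by (rule Suc)
  show ?case
  proof (rule large_ind_leI)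
    fix A B assume AB: "closedin Z A" "closedin Z B" "disjnt A B"
    obtain U W P L Q where *: "openin Z U" "openin Z W" "disjnt U W" "A \<subseteq> U" "B \<subseteq> W"
      "finite Q" "Q \<subseteq> topspace X" "P \<subseteq> {z \<in> topspace Z. f z \<in> Q}" "L \<subseteq> topspace X - Q"
      "large_ind_le (subtopology Z P) (m - 1)" "large_ind_le (subtopology X L) (int (Suc n) - 1)"
      "closedin (subtopology X (topspace X - Q)) L"
      "topspace Z - (U \<union> W) \<subseteq> P \<union> {z \<in> topspace Z. f z \<in> L}"
      by (rule large_ind_total_partition[OF Suc.prems(2,3) of_nat_0_le_iff _ Suc.prems(4) AB]) (rule Suc.prems(5), assumption, rule that)
    define T where "T = L \<union> Q"
    have T: "closedin X T" "large_ind_le (subtopology X T) (int n)"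
      using large_ind_le_finite_Un[OF Suc.prems(2) *(6,7) _ *(12), of "int n"] *(11) by (simp_all add: T_def)
    let ?S = "{z \<in> topspace Z. f z \<in> T}"
    have "large_ind_le (subtopology Z ?S) (int n + m)"
    proof (rule Suc.IH)
      show "fully_closed_surjection (subtopology Z ?S) (subtopology X T) f" by (rule restriction(1)[OF T(1)])
      show "perfectly_normal (subtopology X T)" using perfectly_normal_subtopology(1)[OF Suc.prems(2) T(1)] .
      show "metrizable_space (fibre (subtopology Z ?S) f x) \<and> large_ind_le (fibre (subtopology Z ?S) f x) m"
        if "x \<in> topspace (subtopology X T)" for x
        using that restriction(2)[OF T(1), of x] Suc.prems(5)[of x] by auto
    qed (use T Suc.prems in auto)
    moreover have sub: "topspace Z - (U \<union> W) \<subseteq> ?S" using *(8,13) unfolding T_def by blast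
    moreover have "closedin Z (topspace Z - (U \<union> W))" using *(1,2) by (simp add: closedin_diff openin_Un)
    then have "closedin (subtopology Z ?S) (topspace Z - (U \<union> W))" using sub by (intro closedin_subset_topspace)
    ultimately have "large_ind_le (subtopology Z (topspace Z - (U \<union> W))) (int n + m)"
      using large_ind_le_closed_subset' by blast
    then show "\<exists>G H. openin Z G \<and> openin Z H \<and> disjnt G H \<and> A \<subseteq> G \<and> B \<subseteq> H \<and>
        large_ind_le (subtopology Z (topspace Z - (G \<union> H))) (int (Suc n) + m - 1)"
      using *(1-5) by (intro exI[of _ U] exI[of _ W]) simp
  qed (use Suc in simp)
qed

lemma large_ind_le_iff: "large_ind X \<le> ereal r \<longleftrightarrow> large_ind_le X \<lfloor>r\<rfloor>"
  unfolding large_ind_def by (rule Inf_int_le_iff[OF large_ind_le_mono])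

lemma large_ind_nonneg:
  assumes "topspace X \<noteq> {}"
  shows "0 \<le> large_ind X"
  unfolding large_ind_def
proof (rule Inf_greatest)
  fix e assume "e \<in> {ereal (real_of_int n) | n. large_ind_le X n}"
  then obtain n where n: "e = ereal (real_of_int n)" "large_ind_le X n" by blast
  have "n \<noteq> -1" using n(2) assms by (auto simp: large_ind_le_minus_one_iff)
  then have "0 \<le> n" using large_ind_le_ge[OF n(2)] by simp
  then show "0 \<le> e" unfolding n by simp
qed

text \<open>Non-empty spaces make both summands at least 0, so opposite infinities never meet;
  finite values are replaced by their floors.\<close>

lemma (in fully_closed_surjection) large_ind_total:
  assumes X: "perfectly_normal X" and ne: "topspace X \<noteq> {}"
    and fib: "\<And>x. x \<in> topspace X \<Longrightarrow> metrizable_space (fibre Z f x)"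
  shows "large_ind Z \<le> large_ind X + large_ind_map Z X f"
proof -
  have nonneg: "0 \<le> large_ind (fibre Z f x)" if x: "x \<in> topspace X" for x
  proof (rule large_ind_nonneg)
    obtain z where "z \<in> topspace Z" "f z = x" using fibre_nonempty[OF x] by blast
    then show "topspace (fibre Z f x) \<noteq> {}" by (auto simp: fibre_def)
  qed
  obtain x0 where x0: "x0 \<in> topspace X" using ne by blast
  have "0 \<le> large_ind (fibre Z f x0)" using nonneg x0 by blast
  also have "\<dots> \<le> large_ind_map Z X f" unfolding large_ind_map_def using x0 by (rule SUP_upper)
  finally have nonneg_map: "0 \<le> large_ind_map Z X f" .
  have nonneg_X: "0 \<le> large_ind X" using ne by (rule large_ind_nonneg)
  show ?thesis
  proof (cases "large_ind X = \<infinity> \<or> large_ind_map Z X f = \<infinity>")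
    case True then show ?thesis using nonneg_X nonneg_map by (cases "large_ind X") auto
  next
    case False
    then obtain r s where r: "large_ind X = ereal r" and s: "large_ind_map Z X f = ereal s"
      using nonneg_X nonneg_map by (cases "large_ind X"; cases "large_ind_map Z X f") auto
    have rs: "0 \<le> r" "0 \<le> s" using nonneg_X nonneg_map r s by simp_all
    have "large_ind_le X \<lfloor>r\<rfloor>" using large_ind_le_iff[of X r] r by simp
    then have indX: "large_ind_le X (int (nat \<lfloor>r\<rfloor>))" using rs by simp
    have fibs: "metrizable_space (fibre Z f x) \<and> large_ind_le (fibre Z f x) \<lfloor>s\<rfloor>" if x: "x \<in> topspace X" for x
    proof -
      have "large_ind (fibre Z f x) \<le> ereal s"
        unfolding s[symmetric] large_ind_map_def using x by (rule SUP_upper)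
      then show ?thesis using fib[OF x] by (simp add: large_ind_le_iff)
    qed
    have "large_ind_le Z (int (nat \<lfloor>r\<rfloor>) + \<lfloor>s\<rfloor>)"
      by (rule large_ind_le_total[OF fully_closed_surjection_axioms X indX _ fibs]) (use rs in auto)
    then have "large_ind Z \<le> ereal (of_int (\<lfloor>r\<rfloor> + \<lfloor>s\<rfloor>))"
      using rs by (simp only: large_ind_le_iff floor_of_int) simp
    also have "\<dots> \<le> ereal (r + s)" by (simp add: add_mono)
    finally show ?thesis by (simp add: r s)
  qed
qed

section \<open>A ray that accumulates on a metrizable continuum\<close>

context Metric_space begin

text \<open>The Katetov functions: the possible distances from the points of \<open>M\<close> to one
  additional point of a pseudometric extension.\<close>

definition asymptotic_distance :: "('a \<Rightarrow> real) \<Rightarrow> bool" where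
  "asymptotic_distance \<psi> \<longleftrightarrow> (\<forall>y\<in>M. \<forall>y'\<in>M. \<psi> y \<le> d y y' + \<psi> y' \<and> d y y' \<le> \<psi> y + \<psi> y')"

definition near_distances :: "real \<Rightarrow> ('a \<Rightarrow> real) set" where
  "near_distances \<epsilon> = {\<psi>. asymptotic_distance \<psi> \<and> (\<exists>a\<in>M. \<psi> a < \<epsilon>)}"

text \<open>Distances to a point of \<open>M\<close> satisfy both inequalities, and convex
  combinations preserve them.\<close>

lemma asymptotic_distance_segment:
  assumes "a \<in> M" "b \<in> M" "0 \<le> s" "s \<le> (1::real)"
  shows "asymptotic_distance (\<lambda>y. (1 - s) * d y a + s * d y b)"
  unfolding asymptotic_distance_def
proof (intro ballI)
  fix y y' assume y: "y \<in> M" "y' \<in> M"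
  have a: "d y a \<le> d y y' + d y' a" "d y y' \<le> d y a + d y' a"
    using triangle[OF y assms(1)] triangle[OF y(1) assms(1) y(2)] commute[of a y'] by auto
  have b: "d y b \<le> d y y' + d y' b" "d y y' \<le> d y b + d y' b"
    using triangle[OF y assms(2)] triangle[OF y(1) assms(2) y(2)] commute[of b y'] by auto
  have "(1 - s) * d y a + s * d y b \<le> (1 - s) * (d y y' + d y' a) + s * (d y y' + d y' b)"
    using a b assms by (intro add_mono mult_left_mono) auto
  moreover have "(1 - s) * d y y' + s * d y y' \<le> (1 - s) * (d y a + d y' a) + s * (d y b + d y' b)"
    using a b assms by (intro add_mono mult_left_mono) auto
  ultimately show "(1 - s) * d y a + s * d y b \<le> d y y' + ((1 - s) * d y' a + s * d y' b) \<and>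
      d y y' \<le> (1 - s) * d y a + s * d y b + ((1 - s) * d y' a + s * d y' b)"
    by (simp add: algebra_simps)
qed

text \<open>At \<open>a\<close> the segment has the value s d(a, b), which is below \<epsilon>. So
  it stays close to \<open>M\<close> even though \<open>M\<close> may contain no arc from
  \<open>a\<close> to \<open>b\<close>.\<close>

lemma path_component_near_distances_step:
  assumes ab: "a \<in> M" "b \<in> M" "d a b < \<epsilon>"
  shows "path_component (near_distances \<epsilon>) (\<lambda>y. d y a) (\<lambda>y. d y b)"
proof -
  define \<gamma> where "\<gamma> s = (\<lambda>y. (1 - s) * d y a + s * d y b)" for s :: real
  have "path \<gamma>" unfolding path_def \<gamma>_def
    by (intro continuous_on_coordinatewise_then_product continuous_intros)
  moreover have "path_image \<gamma> \<subseteq> near_distances \<epsilon>"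
  proof (clarsimp simp: path_image_def)
    fix s :: real assume s: "0 \<le> s" "s \<le> 1"
    have "s * d a b \<le> 1 * d a b" using s by (intro mult_right_mono) auto
    then have "\<gamma> s a < \<epsilon>" using ab by (simp add: \<gamma>_def)
    then show "\<gamma> s \<in> near_distances \<epsilon>"
      using asymptotic_distance_segment[OF ab(1,2) s] ab(1) unfolding near_distances_def \<gamma>_def by blast
  qed
  moreover have "pathstart \<gamma> = (\<lambda>y. d y a)" "pathfinish \<gamma> = (\<lambda>y. d y b)"
    by (simp_all add: \<gamma>_def pathstart_def pathfinish_def)
  ultimately show ?thesis unfolding path_component_def by blast
qed

text \<open>Points closer than \<epsilon> belong to the same class, so the class of \<open>a\<close>
  is open and closed in \<open>M\<close>; connectedness makes it everything.\<close>

lemma path_component_near_distances: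
  assumes con: "connected_space mtopology" and "a \<in> M" "b \<in> M" "0 < \<epsilon>"
  shows "path_component (near_distances \<epsilon>) (\<lambda>y. d y a) (\<lambda>y. d y b)"
proof -
  define S where "S = {c \<in> M. path_component (near_distances \<epsilon>) (\<lambda>y. d y a) (\<lambda>y. d y c)}"
  have step: "c \<in> S \<longleftrightarrow> c' \<in> S" if "c \<in> M" "c' \<in> M" "d c c' < \<epsilon>" for c c'
    using path_component_near_distances_step[OF that] that path_component_trans path_component_sym
    unfolding S_def by blast
  have "openin mtopology S"
    unfolding openin_mtopology using step \<open>0 < \<epsilon>\<close> by (auto simp: S_def subset_iff intro!: exI[of _ \<epsilon>])
  moreover have "openin mtopology (M - S)"
    unfolding openin_mtopology using step \<open>0 < \<epsilon>\<close> by (auto simp: subset_iff intro!: exI[of _ \<epsilon>])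
  then have "closedin mtopology S" by (simp add: closedin_def S_def)
  moreover have "a \<in> S"
    using path_component_near_distances_step[OF \<open>a \<in> M\<close> \<open>a \<in> M\<close>, of \<epsilon>] assms by (simp add: S_def)
  ultimately have "S = M" using con unfolding connected_space_clopen_in by auto
  then show ?thesis using \<open>b \<in> M\<close> by (auto simp: S_def)
qed

text \<open>The distance functions \<open>d(\<sqdot>, y)\<close> of the points of \<open>M\<close> form a copy of \<open>M\<close> in a function space.
  The ray is a path in that function space which approaches the copy and accumulates at each of
  its points.\<close>

lemma approximating_ray:
  assumes cpt: "compact_space mtopology" and con: "connected_space mtopology" and ne: "M \<noteq> {}"
  shows "\<exists>\<phi> :: real \<Rightarrow> 'a \<Rightarrow> real. (\<forall>y. continuous_on {0..} (\<lambda>t. \<phi> t y)) \<and>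
    (\<forall>t\<ge>0. asymptotic_distance (\<phi> t)) \<and> (\<forall>\<epsilon>>0. \<exists>N. \<forall>t\<ge>N. \<exists>y\<in>M. \<phi> t y < \<epsilon>) \<and>
    (\<forall>y\<in>M. \<forall>\<epsilon>>0. \<forall>N. \<exists>t\<ge>N. \<phi> t y < \<epsilon>)"
proof -
  obtain C where C: "countable C" "C \<subseteq> M" "\<And>x e. x \<in> M \<Longrightarrow> 0 < e \<Longrightarrow> \<exists>c\<in>C. d c x < e"
    using compact_imp_countable_dense[OF cpt] by metis
  have "C \<noteq> {}" using C(3) ne zero_less_one by blast
  \<comment> \<open>Only the first component of the decoded pair is used, so every point of
    \<open>C\<close> recurs infinitely often. This is what makes the ray accumulate
    everywhere.\<close>
  define q where "q n = from_nat_into C (fst (prod_decode n))" for n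
  have qM: "q n \<in> M" for n using from_nat_into[OF \<open>C \<noteq> {}\<close>] C(2) by (auto simp: q_def)
  have often: "\<exists>n\<ge>N. q n = c" if "c \<in> C" for c N
  proof -
    obtain k where k: "from_nat_into C k = c" using from_nat_into_surj[OF C(1) \<open>c \<in> C\<close>] by blast
    have "q (prod_encode (k, N)) = c" by (simp add: q_def k)
    then show ?thesis using le_prod_encode_2 by blast
  qed
  have "\<exists>\<gamma>. path \<gamma> \<and> path_image \<gamma> \<subseteq> near_distances (inverse (Suc k)) \<and>
      pathstart \<gamma> = (\<lambda>y. d y (q k)) \<and> pathfinish \<gamma> = (\<lambda>y. d y (q (Suc k)))" for k
    using path_component_near_distances[OF con qM qM, of "inverse (Suc k)" k "Suc k"]
    unfolding path_component_def by simp
  then obtain \<gamma> where \<gamma>: "\<And>k. path (\<gamma> k)" "\<And>k. path_image (\<gamma> k) \<subseteq> near_distances (inverse (Suc k))"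
    "\<And>k. pathstart (\<gamma> k) = (\<lambda>y. d y (q k))" "\<And>k. pathfinish (\<gamma> k) = (\<lambda>y. d y (q (Suc k)))"
    by metis
  \<comment> \<open>On the interval from k to k + 1 the ray follows the k-th path, which stays
    within 1/(k + 1) of \<open>M\<close> and ends where the next one starts.\<close>
  define \<phi> where "\<phi> t = \<gamma> (nat \<lfloor>t\<rfloor>) (t - real_of_int \<lfloor>t\<rfloor>)" for t :: real
  have near: "\<phi> t \<in> near_distances (inverse (Suc (nat \<lfloor>t\<rfloor>)))" for t
  proof -
    have "t - real_of_int \<lfloor>t\<rfloor> \<in> {0..1}" by simp linarith
    then have "\<phi> t \<in> path_image (\<gamma> (nat \<lfloor>t\<rfloor>))" unfolding \<phi>_def path_image_def by blast
    then show ?thesis using \<gamma>(2) by blast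
  qed
  have \<phi>_nat: "\<phi> (real k) = (\<lambda>y. d y (q k))" for k
    using \<gamma>(3)[of k] by (simp add: \<phi>_def pathstart_def)
  have unit: "\<phi> t = \<gamma> k (t - real k)" if "t \<in> {real k..real (Suc k)}" for t k
  proof (cases "t = real (Suc k)")
    case True
    then show ?thesis using \<phi>_nat[of "Suc k"] \<gamma>(4)[of k] by (simp add: pathfinish_def)
  next
    case False
    then have "\<lfloor>t\<rfloor> = int k" using that by (intro floor_unique) auto
    then show ?thesis by (simp add: \<phi>_def)
  qed
  have cont_unit: "continuous_on {real k..real (Suc k)} (\<lambda>t. \<phi> t y)" for k y
  proof -
    have "continuous_on {0..1} (\<gamma> k)" using \<gamma>(1) by (simp add: path_def)
    then have "continuous_on {0..1} (\<lambda>s. \<gamma> k s y)" by (rule continuous_on_product_then_coordinatewise)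
    then have "continuous_on {real k..real (Suc k)} ((\<lambda>s. \<gamma> k s y) \<circ> (\<lambda>t. t - real k))"
      by (intro continuous_on_compose continuous_intros) (auto elim: continuous_on_subset)
    then show ?thesis by (rule continuous_on_eq) (simp add: unit)
  qed
  have cont_n: "continuous_on {0..real n} (\<lambda>t. \<phi> t y)" for n y
  proof (induction n)
    case (Suc n)
    have "{0..real (Suc n)} = {0..real n} \<union> {real n..real (Suc n)}" by auto
    then show ?case using continuous_on_closed_Un[OF _ _ Suc cont_unit] by simp
  qed simp
  show ?thesis
  proof (intro exI[of _ \<phi>] conjI allI impI ballI)
    show "continuous_on {0..} (\<lambda>t. \<phi> t y)" for y
      unfolding continuous_on_eq_continuous_within
    proof
      fix t :: real assume t: "t \<in> {0..}"
      obtain n where n: "t < real n" using reals_Archimedean2 by blast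
      have "at t within {0..} = at t within {0..real n}"
        by (rule at_within_nhd[of t "{..<real n}"]) (use n in auto)
      moreover have "continuous (at t within {0..real n}) (\<lambda>t. \<phi> t y)"
        using cont_n[of n y] t n by (simp add: continuous_on_eq_continuous_within)
      ultimately show "continuous (at t within {0..}) (\<lambda>t. \<phi> t y)" by simp
    qed
    show "asymptotic_distance (\<phi> t)" if "0 \<le> t" for t using near[of t] by (simp add: near_distances_def)
    show "\<exists>N. \<forall>t\<ge>N. \<exists>y\<in>M. \<phi> t y < \<epsilon>" if \<epsilon>: "0 < \<epsilon>" for \<epsilon>
    proof -
      obtain k where k: "inverse (Suc k) < \<epsilon>" using reals_Archimedean[OF \<epsilon>] by blast
      have "\<exists>y\<in>M. \<phi> t y < \<epsilon>" if "real k \<le> t" for t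
      proof -
        obtain y where y: "y \<in> M" "\<phi> t y < inverse (Suc (nat \<lfloor>t\<rfloor>))" using near[of t] by (auto simp: near_distances_def)
        have "k \<le> nat \<lfloor>t\<rfloor>" using that by (simp add: le_nat_iff le_floor_iff)
        then have "inverse (real (Suc (nat \<lfloor>t\<rfloor>))) \<le> inverse (real (Suc k))" by (intro le_imp_inverse_le) auto
        then have "\<phi> t y < \<epsilon>" using y(2) k by linarith
        then show ?thesis using y(1) by blast
      qed
      then show ?thesis by blast
    qed
    show "\<exists>t\<ge>N. \<phi> t y < \<epsilon>" if y: "y \<in> M" and \<epsilon>: "0 < \<epsilon>" for y \<epsilon> and N :: real
    proof -
      obtain c where c: "c \<in> C" "d c y < \<epsilon>" using C(3)[OF y \<epsilon>] by blast
      obtain n where n: "n \<ge> nat \<lceil>N\<rceil>" "q n = c" using often[OF c(1)] by blast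
      have "N \<le> real n" using n(1) by linarith
      moreover have "\<phi> (real n) y < \<epsilon>" using c(2) n(2) commute[of c y] by (simp add: \<phi>_nat)
      ultimately show ?thesis by blast
    qed
  qed
qed

end

section \<open>A function that tends to infinity exactly at a given point\<close>

lemma nested_neighbourhood_base:
  assumes "first_countable X" "regular_space X" "x \<in> topspace X"
  obtains V :: "nat \<Rightarrow> 'a set" where "\<And>n. openin X (V n)" "\<And>n. x \<in> V n"
    "\<And>n. X closure_of (V (Suc n)) \<subseteq> V n" "\<And>U. openin X U \<Longrightarrow> x \<in> U \<Longrightarrow> \<exists>n. V n \<subseteq> U"
proof -
  obtain \<B> where \<B>: "countable \<B>" "\<And>B. B \<in> \<B> \<Longrightarrow> openin X B"
    "\<And>U. openin X U \<Longrightarrow> x \<in> U \<Longrightarrow> \<exists>B\<in>\<B>. x \<in> B \<and> B \<subseteq> U"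
    using assms(1,3) unfolding first_countable_def by metis
  define \<B>' where "\<B>' = {B \<in> \<B>. x \<in> B}"
  have ne: "\<B>' \<noteq> {}" using \<B>(3)[OF openin_topspace assms(3)] by (auto simp: \<B>'_def)
  define b where "b = from_nat_into \<B>'"
  have b: "openin X (b n)" "x \<in> b n" for n
    using from_nat_into[OF ne, of n] \<B>(2) by (auto simp: b_def \<B>'_def)
  have "\<exists>V. \<forall>n. (openin X (V n) \<and> x \<in> V n \<and> V n \<subseteq> b n) \<and> X closure_of (V (Suc n)) \<subseteq> V n"
  proof (rule dependent_nat_choice)
    show "\<exists>V. openin X V \<and> x \<in> V \<and> V \<subseteq> b 0" using b by blast
    fix V n assume V: "openin X V \<and> x \<in> V \<and> V \<subseteq> b n"
    then have "openin X (V \<inter> b (Suc n))" "x \<in> V \<inter> b (Suc n)" using b by auto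
    from regular_space_open_closure[OF assms(2) this] obtain W where
      W: "openin X W" "x \<in> W" "X closure_of W \<subseteq> V \<inter> b (Suc n)" .
    then show "\<exists>W. (openin X W \<and> x \<in> W \<and> W \<subseteq> b (Suc n)) \<and> X closure_of W \<subseteq> V"
      using openin_subset_closure_of[OF W(1)] by blast
  qed
  then obtain V where V: "\<And>n. openin X (V n) \<and> x \<in> V n \<and> V n \<subseteq> b n" "\<And>n. X closure_of (V (Suc n)) \<subseteq> V n"
    by blast
  have "\<exists>n. V n \<subseteq> U" if U: "openin X U" "x \<in> U" for U
  proof -
    obtain B where B: "B \<in> \<B>'" "B \<subseteq> U" using \<B>(3)[OF U] by (auto simp: \<B>'_def)
    have "countable \<B>'" using \<B>(1) by (simp add: \<B>'_def)
    then obtain n where "b n = B" using from_nat_into_surj B(1) unfolding b_def by metis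
    then show ?thesis using V(1)[of n] B(2) by blast
  qed
  then show ?thesis using V by (intro that[of V]) simp_all
qed

text \<open>\<open>g\<close> is the sum of Urysohn functions for consecutive members of a nested
  neighbourhood base. Locally away from \<open>x\<close> finitely many terms survive, while each
  further neighbourhood contributes a full unit closer to \<open>x\<close>.\<close>

lemma proper_function_at_point:
  assumes X: "normal_space X" "Hausdorff_space X" "first_countable X" and x: "x \<in> topspace X"
  obtains g :: "'a \<Rightarrow> real"
  where "continuous_map (subtopology X (topspace X - {x})) euclideanreal g"
    "\<And>p. p \<in> topspace X \<Longrightarrow> 0 \<le> g p"
    "\<And>U. openin X U \<Longrightarrow> x \<in> U \<Longrightarrow> \<exists>N. \<forall>p\<in>topspace X - {x}. N < g p \<longrightarrow> p \<in> U"
    "\<And>N. \<exists>U. openin X U \<and> x \<in> U \<and> (\<forall>p\<in>U - {x}. N < g p)"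
proof -
  have reg: "regular_space X" using X(1,2) by (simp add: normal_t1_imp_regular_space Hausdorff_imp_t1_space)
  obtain V :: "nat \<Rightarrow> 'a set" where V: "\<And>n. openin X (V n)" "\<And>n. x \<in> V n"
    "\<And>n. X closure_of (V (Suc n)) \<subseteq> V n" "\<And>U. openin X U \<Longrightarrow> x \<in> U \<Longrightarrow> \<exists>n. V n \<subseteq> U"
    by (rule nested_neighbourhood_base[OF X(3) reg x]) (rule that)
  have clV: "V n \<subseteq> X closure_of (V n)" for n using V(1) by (rule openin_subset_closure_of)
  have V_Suc: "V (Suc n) \<subseteq> V n" for n using clV V(3) by (rule subset_trans)
  have V_mono: "V n \<subseteq> V m" if "m \<le> n" for m n using V_Suc that by (rule lift_Suc_antimono_le)
  have "\<exists>w. continuous_map X euclideanreal w \<and> w ` (X closure_of (V (Suc n))) \<subseteq> {1} \<and>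
      w ` (topspace X - V n) \<subseteq> {0} \<and> w ` topspace X \<subseteq> {0..1}" for n
  proof -
    have "closedin X (topspace X - V n)" using V(1) by blast
    moreover have "disjnt (topspace X - V n) (X closure_of (V (Suc n)))" using V(3)[of n] by (auto simp: disjnt_iff)
    ultimately obtain w :: "'a \<Rightarrow> real" where "continuous_map X (top_of_set {0..1}) w"
      "w ` (topspace X - V n) \<subseteq> {0}" "w ` (X closure_of (V (Suc n))) \<subseteq> {1}"
      using X(1) unfolding normal_space_iff_Urysohn by (meson closedin_closure_of)
    then show ?thesis
      by (intro exI[of _ w]) (auto simp: continuous_map_in_subtopology)
  qed
  then obtain w where w: "\<And>n. continuous_map X euclideanreal (w n)"
    "\<And>n. w n ` (X closure_of (V (Suc n))) \<subseteq> {1}" "\<And>n. w n ` (topspace X - V n) \<subseteq> {0}"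
    "\<And>n. w n ` topspace X \<subseteq> {0..1}" by metis
  \<comment> \<open>At \<open>x\<close> the index set is infinite and the sum has the default value
    0. So the lower bound holds there too, and \<open>g x\<close> is a legitimate parameter of the
    ray.\<close>
  define g where "g p = (\<Sum>n | p \<in> V n. w n p)" for p
  have g_eq: "g p = (\<Sum>n<m. w n p)" if "p \<in> topspace X" "p \<notin> V m" for p m
    unfolding g_def
  proof (rule sum.mono_neutral_left)
    show "{n. p \<in> V n} \<subseteq> {..<m}" using V_mono that(2) by (auto simp: not_le[symmetric] subset_iff)
    show "\<forall>n\<in>{..<m} - {n. p \<in> V n}. w n p = 0" using w(3) that(1) by auto
  qed simp
  have ex_m: "\<exists>m. p \<notin> X closure_of (V m)" if "p \<in> topspace X - {x}" for p
  proof -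
    have "openin X (topspace X - {p})" "x \<in> topspace X - {p}"
      using that x X(2) by (auto simp: closedin_Hausdorff_singleton)
    then obtain n where "V n \<subseteq> topspace X - {p}" using V(4) by blast
    then show ?thesis using V(3)[of n] by blast
  qed
  have w01: "0 \<le> w n p" "w n p \<le> 1" if "p \<in> topspace X" for n p using w(4)[of n] that by auto
  show ?thesis
  proof (rule that[of g])
    show "0 \<le> g p" if "p \<in> topspace X" for p unfolding g_def using w01 that by (intro sum_nonneg) auto
    show "continuous_map (subtopology X (topspace X - {x})) euclideanreal g"
      unfolding continuous_map_def
    proof (intro conjI allI impI)
      fix U :: "real set" assume U: "openin euclideanreal U"
      have "{p \<in> topspace X - {x}. g p \<in> U} =
          (\<Union>m. {p \<in> topspace X. (\<Sum>n<m. w n p) \<in> U} \<inter> (topspace X - X closure_of (V m)))" (is "?L = ?R")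
      proof (intro set_eqI iffI)
        fix p assume p: "p \<in> ?L"
        then obtain m where "p \<notin> X closure_of (V m)" using ex_m by blast
        moreover from this have "p \<notin> V m" using clV by blast
        ultimately show "p \<in> ?R" using p g_eq[of p m] by (auto intro!: exI[of _ m])
      next
        fix p assume "p \<in> ?R"
        then obtain m where m: "p \<in> topspace X" "(\<Sum>n<m. w n p) \<in> U" "p \<notin> X closure_of (V m)" by blast
        then have "p \<notin> V m" using clV by blast
        then show "p \<in> ?L" using m g_eq[of p m] V(2)[of m] by auto
      qed
      moreover have "openin X ({p \<in> topspace X. (\<Sum>n<m. w n p) \<in> U} \<inter> (topspace X - X closure_of (V m)))" for m
      proof (intro openin_Int)
        have "continuous_map X euclideanreal (\<lambda>p. \<Sum>n<m. w n p)" using w(1) by (intro continuous_map_sum) auto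
        then show "openin X {p \<in> topspace X. (\<Sum>n<m. w n p) \<in> U}" using U by (rule openin_continuous_map_preimage)
        show "openin X (topspace X - X closure_of (V m))" by (simp add: openin_diff)
      qed
      ultimately have "openin X {p \<in> topspace X - {x}. g p \<in> U}" by (metis (no_types, lifting) openin_Union imageE)
      then show "openin (subtopology X (topspace X - {x})) {p \<in> topspace (subtopology X (topspace X - {x})). g p \<in> U}"
        by (auto simp: openin_subtopology intro!: exI[of _ "{p \<in> topspace X - {x}. g p \<in> U}"])
    qed simp
    show "\<exists>N. \<forall>p\<in>topspace X - {x}. N < g p \<longrightarrow> p \<in> U" if U: "openin X U" "x \<in> U" for U
    proof -
      obtain m where m: "V m \<subseteq> U" using V(4)[OF U] by blast
      have "g p \<le> real m" if "p \<in> topspace X" "p \<notin> V m" for p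
      proof -
        have "g p \<le> (\<Sum>n<m. 1)" unfolding g_eq[OF that] using w01 that by (intro sum_mono) auto
        then show ?thesis by simp
      qed
      then show ?thesis using m by (intro exI[of _ "real m"]) force
    qed
    show "\<exists>U. openin X U \<and> x \<in> U \<and> (\<forall>p\<in>U - {x}. N < g p)" for N
    proof -
      obtain k where k: "N < real k" using reals_Archimedean2 by blast
      have "N < g p" if p: "p \<in> V k - {x}" for p
      proof -
        have pX: "p \<in> topspace X" using p V(1) openin_subset by blast
        obtain m where m: "p \<notin> X closure_of (V m)" using ex_m pX p by blast
        then have pm: "p \<notin> V m" using clV by blast
        then have "k \<le> m" using p V_mono[of m k] by (meson DiffD1 nat_le_linear subsetD)
        have "real k = (\<Sum>n<k. 1)" by simp
        also have "\<dots> = (\<Sum>n<k. w n p)"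
        proof (rule sum.cong[OF refl])
          fix n assume "n \<in> {..<k}"
          then have "p \<in> V (Suc n)" using V_mono[of "Suc n" k] p by auto
          then have "w n p \<in> {1}" using w(2)[of n] clV[of "Suc n"] by (meson image_subset_iff subsetD)
          then show "1 = w n p" by simp
        qed
        also have "\<dots> \<le> (\<Sum>n<m. w n p)" using \<open>k \<le> m\<close> w01[OF pX] by (intro sum_mono2) auto
        also have "\<dots> = g p" using g_eq[OF pX pm] by simp
        finally show ?thesis using k by simp
      qed
      then show ?thesis using V(1,2)[of k] by blast
    qed
  qed
qed

section \<open>Resolutions\<close>

text \<open>A fibre \<open>M x\<close> replaces each point \<open>x\<close>; \<open>D x y p\<close> measures how far \<open>p \<noteq> x\<close> is from the point \<open>y\<close>
  of the fibre over \<open>x\<close>.\<close>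

locale resolution =
  fixes X :: "'a topology" and M :: "'a \<Rightarrow> 'b set" and d :: "'a \<Rightarrow> 'b \<Rightarrow> 'b \<Rightarrow> real"
    and D :: "'a \<Rightarrow> 'b \<Rightarrow> 'a \<Rightarrow> real"
  assumes continuum_X: "continuum X" and first_countable_X: "first_countable X"
    and metric: "x \<in> topspace X \<Longrightarrow> Metric_space (M x) (d x)"
    and continuum_M: "x \<in> topspace X \<Longrightarrow> continuum (Metric_space.mtopology (M x) (d x))"
    and D_cont: "x \<in> topspace X \<Longrightarrow> y \<in> M x \<Longrightarrow>
      continuous_map (subtopology X (topspace X - {x})) euclideanreal (D x y)"
    and D_triangle: "x \<in> topspace X \<Longrightarrow> p \<in> topspace X \<Longrightarrow> y \<in> M x \<Longrightarrow> y' \<in> M x \<Longrightarrow>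
      D x y p \<le> d x y y' + D x y' p \<and> d x y y' \<le> D x y p + D x y' p"
    and D_near: "x \<in> topspace X \<Longrightarrow> 0 < \<epsilon> \<Longrightarrow>
      \<exists>V. openin X V \<and> x \<in> V \<and> (\<forall>p\<in>V - {x}. \<exists>y\<in>M x. D x y p < \<epsilon>)"
    and D_ring: "x \<in> topspace X \<Longrightarrow> y \<in> M x \<Longrightarrow> 0 < \<epsilon> \<Longrightarrow> openin X V \<Longrightarrow> x \<in> V \<Longrightarrow>
      \<exists>W. openin X W \<and> x \<in> W \<and> W \<subseteq> V \<and> (\<forall>p\<in>X frontier_of W. p \<in> V - {x} \<and> D x y p < \<epsilon>)"
begin

text \<open>A neighbourhood of (x, y) has two parts: a ball in the fibre over \<open>x\<close>, and
  the entire fibres over nearby points \<open>p\<close> with small \<open>D x y p\<close>.\<close>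

definition resolved_open :: "('a \<times> 'b) set \<Rightarrow> bool" where
  "resolved_open W \<longleftrightarrow> W \<subseteq> Sigma (topspace X) M \<and> (\<forall>x y. (x, y) \<in> W \<longrightarrow> (\<exists>\<epsilon> V. 0 < \<epsilon> \<and> openin X V \<and> x \<in> V \<and>
     (\<forall>y'\<in>M x. d x y y' < \<epsilon> \<longrightarrow> (x, y') \<in> W) \<and>
     (\<forall>p\<in>V - {x}. D x y p < \<epsilon> \<longrightarrow> {p} \<times> M p \<subseteq> W)))"

definition Z :: "('a \<times> 'b) topology" where "Z = topology resolved_open"

lemma istopology_resolved: "istopology resolved_open"
  unfolding istopology_def
proof (intro conjI allI impI)
  fix S T assume ST: "resolved_open S" "resolved_open T"
  show "resolved_open (S \<inter> T)"
    unfolding resolved_open_def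
  proof (intro conjI allI impI)
    show "S \<inter> T \<subseteq> Sigma (topspace X) M" using ST unfolding resolved_open_def by blast
    fix x y assume xy: "(x, y) \<in> S \<inter> T"
    obtain \<epsilon> V where 1: "0 < \<epsilon>" "openin X V" "x \<in> V" "\<forall>y'\<in>M x. d x y y' < \<epsilon> \<longrightarrow> (x, y') \<in> S"
      "\<forall>p\<in>V - {x}. D x y p < \<epsilon> \<longrightarrow> {p} \<times> M p \<subseteq> S"
      using ST(1) xy unfolding resolved_open_def by (metis IntD1)
    obtain \<epsilon>' V' where 2: "0 < \<epsilon>'" "openin X V'" "x \<in> V'" "\<forall>y'\<in>M x. d x y y' < \<epsilon>' \<longrightarrow> (x, y') \<in> T"
      "\<forall>p\<in>V' - {x}. D x y p < \<epsilon>' \<longrightarrow> {p} \<times> M p \<subseteq> T"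
      using ST(2) xy unfolding resolved_open_def by (metis IntD2)
    show "\<exists>\<epsilon> V. 0 < \<epsilon> \<and> openin X V \<and> x \<in> V \<and> (\<forall>y'\<in>M x. d x y y' < \<epsilon> \<longrightarrow> (x, y') \<in> S \<inter> T) \<and>
        (\<forall>p\<in>V - {x}. D x y p < \<epsilon> \<longrightarrow> {p} \<times> M p \<subseteq> S \<inter> T)"
      using 1 2 by (intro exI[of _ "min \<epsilon> \<epsilon>'"] exI[of _ "V \<inter> V'"]) auto
  qed
next
  fix \<K> assume K: "\<forall>K\<in>\<K>. resolved_open K"
  show "resolved_open (\<Union>\<K>)"
    unfolding resolved_open_def
  proof (intro conjI allI impI)
    show "\<Union>\<K> \<subseteq> Sigma (topspace X) M" using K unfolding resolved_open_def by blast
    fix x y assume "(x, y) \<in> \<Union>\<K>"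
    then obtain K where "K \<in> \<K>" "(x, y) \<in> K" by blast
    then obtain \<epsilon> V where "0 < \<epsilon>" "openin X V" "x \<in> V" "\<forall>y'\<in>M x. d x y y' < \<epsilon> \<longrightarrow> (x, y') \<in> K"
      "\<forall>p\<in>V - {x}. D x y p < \<epsilon> \<longrightarrow> {p} \<times> M p \<subseteq> K"
      using K unfolding resolved_open_def by metis
    then show "\<exists>\<epsilon> V. 0 < \<epsilon> \<and> openin X V \<and> x \<in> V \<and> (\<forall>y'\<in>M x. d x y y' < \<epsilon> \<longrightarrow> (x, y') \<in> \<Union>\<K>) \<and>
        (\<forall>p\<in>V - {x}. D x y p < \<epsilon> \<longrightarrow> {p} \<times> M p \<subseteq> \<Union>\<K>)"
      using \<open>K \<in> \<K>\<close> by (intro exI[of _ \<epsilon>] exI[of _ V]) blast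
  qed
qed

lemma openin_Z: "openin Z W \<longleftrightarrow> resolved_open W"
  unfolding Z_def using istopology_resolved by (simp add: topology_inverse')

lemma nbhd_in_open:
  assumes "openin Z W" "(x, y) \<in> W"
  obtains \<epsilon> V where "0 < \<epsilon>" "openin X V" "x \<in> V" "\<And>y'. y' \<in> M x \<Longrightarrow> d x y y' < \<epsilon> \<Longrightarrow> (x, y') \<in> W"
    "\<And>p. p \<in> V - {x} \<Longrightarrow> D x y p < \<epsilon> \<Longrightarrow> {p} \<times> M p \<subseteq> W"
proof -
  have "\<exists>\<epsilon> V. 0 < \<epsilon> \<and> openin X V \<and> x \<in> V \<and> (\<forall>y'\<in>M x. d x y y' < \<epsilon> \<longrightarrow> (x, y') \<in> W) \<and>
     (\<forall>p\<in>V - {x}. D x y p < \<epsilon> \<longrightarrow> {p} \<times> M p \<subseteq> W)"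
    using assms unfolding openin_Z resolved_open_def by blast
  then obtain \<epsilon> V where "0 < \<epsilon> \<and> openin X V \<and> x \<in> V \<and> (\<forall>y'\<in>M x. d x y y' < \<epsilon> \<longrightarrow> (x, y') \<in> W) \<and>
     (\<forall>p\<in>V - {x}. D x y p < \<epsilon> \<longrightarrow> {p} \<times> M p \<subseteq> W)" by (elim exE)
  then show ?thesis by (intro that[of \<epsilon> V]) simp_all
qed

lemma topspace_Z: "topspace Z = Sigma (topspace X) M"
proof
  show "topspace Z \<subseteq> Sigma (topspace X) M"
    using openin_topspace[of Z] unfolding openin_Z resolved_open_def by blast
  have "resolved_open (Sigma (topspace X) M)"
    unfolding resolved_open_def
  proof (intro conjI allI impI)
    fix x y assume "(x, y) \<in> Sigma (topspace X) M"
    then show "\<exists>\<epsilon> V. 0 < \<epsilon> \<and> openin X V \<and> x \<in> V \<and>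
        (\<forall>y'\<in>M x. d x y y' < \<epsilon> \<longrightarrow> (x, y') \<in> Sigma (topspace X) M) \<and>
        (\<forall>p\<in>V - {x}. D x y p < \<epsilon> \<longrightarrow> {p} \<times> M p \<subseteq> Sigma (topspace X) M)"
      by (intro exI[of _ 1] exI[of _ "topspace X"]) auto
  qed simp
  then show "Sigma (topspace X) M \<subseteq> topspace Z" using openin_Z openin_subset by metis
qed

lemma closedin_point: "x \<in> topspace X \<Longrightarrow> closedin X {x}"
  using continuum_X by (simp add: continuum_def closedin_Hausdorff_singleton)

lemma openin_D_less:
  assumes "x \<in> topspace X" "y \<in> M x"
  shows "openin X {p \<in> topspace X - {x}. D x y p < \<epsilon>}"
proof -
  have "openin euclideanreal {..<\<epsilon>}" by simp
  then have "openin (subtopology X (topspace X - {x})) {p \<in> topspace (subtopology X (topspace X - {x})). D x y p \<in> {..<\<epsilon>}}"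
    by (rule openin_continuous_map_preimage[OF D_cont[OF assms]])
  moreover have "openin X (topspace X - {x})" using closedin_point[OF assms(1)] by blast
  moreover have "{p \<in> topspace (subtopology X (topspace X - {x})). D x y p \<in> {..<\<epsilon>}} = {p \<in> topspace X - {x}. D x y p < \<epsilon>}"
    by auto
  ultimately show ?thesis by (metis openin_trans_full)
qed

definition basic :: "'a \<Rightarrow> 'b \<Rightarrow> real \<Rightarrow> 'a set \<Rightarrow> ('a \<times> 'b) set" where
  "basic x y \<epsilon> V = {(p, q). p \<in> topspace X \<and> q \<in> M p \<and>
     (p = x \<and> d x y q < \<epsilon> \<or> p \<noteq> x \<and> p \<in> V \<and> D x y p < \<epsilon>)}"

text \<open>At a point (x, q) the triangle inequality for \<open>D\<close> leaves the margin
  \<epsilon> - d(y, q). Over any other base point continuity of \<open>D x y\<close> keeps the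
  condition valid nearby, and entire fibres go along.\<close>

lemma openin_basic:
  assumes x: "x \<in> topspace X" "y \<in> M x" and V: "openin X V" "x \<in> V"
  shows "openin Z (basic x y \<epsilon> V)"
  unfolding openin_Z resolved_open_def
proof (intro conjI allI impI)
  show "basic x y \<epsilon> V \<subseteq> Sigma (topspace X) M" by (auto simp: basic_def)
  fix p q assume pq: "(p, q) \<in> basic x y \<epsilon> V"
  have VX: "V \<subseteq> topspace X" using V(1) by (rule openin_subset)
  interpret Metric_space "M x" "d x" by (rule metric[OF x(1)])
  show "\<exists>\<epsilon>' V'. 0 < \<epsilon>' \<and> openin X V' \<and> p \<in> V' \<and> (\<forall>y'\<in>M p. d p q y' < \<epsilon>' \<longrightarrow> (p, y') \<in> basic x y \<epsilon> V) \<and>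
      (\<forall>r\<in>V' - {p}. D p q r < \<epsilon>' \<longrightarrow> {r} \<times> M r \<subseteq> basic x y \<epsilon> V)"
  proof (cases "p = x")
    case True
    then have q: "q \<in> M x" "d x y q < \<epsilon>" using pq by (auto simp: basic_def)
    have "(x, y') \<in> basic x y \<epsilon> V" if "y' \<in> M x" "d x q y' < \<epsilon> - d x y q" for y'
      using that q x triangle[OF x(2) q(1) that(1)] by (auto simp: basic_def)
    moreover have "{r} \<times> M r \<subseteq> basic x y \<epsilon> V" if "r \<in> V - {x}" "D x q r < \<epsilon> - d x y q" for r
      using that q VX D_triangle[OF x(1) _ x(2) q(1), of r] by (auto simp: basic_def)
    ultimately show ?thesis using True q(2) V
      by (intro exI[of _ "\<epsilon> - d x y q"] exI[of _ V]) auto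
  next
    case False
    let ?V = "V \<inter> {p \<in> topspace X - {x}. D x y p < \<epsilon>}"
    have "openin X ?V" using V openin_D_less[OF x] by blast
    then show ?thesis using False pq by (intro exI[of _ 1] exI[of _ ?V]) (auto simp: basic_def)
  qed
qed

lemma continuous_fst: "continuous_map Z X fst"
  unfolding continuous_map_def
proof (intro conjI allI impI)
  show "fst \<in> topspace Z \<rightarrow> topspace X" by (auto simp: topspace_Z)
  fix U assume U: "openin X U"
  show "openin Z {z \<in> topspace Z. fst z \<in> U}"
    unfolding openin_Z resolved_open_def
  proof (intro conjI allI impI)
    show "{z \<in> topspace Z. fst z \<in> U} \<subseteq> Sigma (topspace X) M" by (auto simp: topspace_Z)
    fix x y assume "(x, y) \<in> {z \<in> topspace Z. fst z \<in> U}"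
    then show "\<exists>\<epsilon> V. 0 < \<epsilon> \<and> openin X V \<and> x \<in> V \<and>
        (\<forall>y'\<in>M x. d x y y' < \<epsilon> \<longrightarrow> (x, y') \<in> {z \<in> topspace Z. fst z \<in> U}) \<and>
        (\<forall>p\<in>V - {x}. D x y p < \<epsilon> \<longrightarrow> {p} \<times> M p \<subseteq> {z \<in> topspace Z. fst z \<in> U})"
      using U openin_subset[OF U] by (intro exI[of _ 1] exI[of _ U]) (auto simp: topspace_Z)
  qed
qed

lemma basic_self:
  assumes "x \<in> topspace X" "y \<in> M x" "0 < \<epsilon>"
  shows "(x, y) \<in> basic x y \<epsilon> V"
proof -
  interpret Metric_space "M x" "d x" by (rule metric[OF assms(1)])
  show ?thesis using assms by (simp add: basic_def)
qed

text \<open>Two points of one fibre get radii of half their distance. A third fibre in both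
  neighbourhoods would contradict the second inequality of \<open>D_triangle\<close>.\<close>

lemma Hausdorff_Z: "Hausdorff_space Z"
  unfolding Hausdorff_space_def
proof (intro allI impI, elim conjE)
  fix z w assume z: "z \<in> topspace Z" and w: "w \<in> topspace Z" and ne: "z \<noteq> w"
  obtain x y where z': "z = (x, y)" "x \<in> topspace X" "y \<in> M x" using z by (auto simp: topspace_Z)
  obtain x' y' where w': "w = (x', y')" "x' \<in> topspace X" "y' \<in> M x'" using w by (auto simp: topspace_Z)
  show "\<exists>U V. openin Z U \<and> openin Z V \<and> z \<in> U \<and> w \<in> V \<and> disjnt U V"
  proof (cases "x = x'")
    case False
    have "Hausdorff_space X" using continuum_X by (simp add: continuum_def)
    then obtain U V where UV: "openin X U" "openin X V" "x \<in> U" "x' \<in> V" "disjnt U V"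
      using False z' w' unfolding Hausdorff_space_def by meson
    show ?thesis
    proof (intro exI conjI)
      show "openin Z {z \<in> topspace Z. fst z \<in> U}" "openin Z {z \<in> topspace Z. fst z \<in> V}"
        using openin_continuous_map_preimage[OF continuous_fst UV(1)]
          openin_continuous_map_preimage[OF continuous_fst UV(2)] by simp_all
    qed (use UV z w z' w' in \<open>auto simp: disjnt_iff\<close>)
  next
    case True
    interpret Metric_space "M x" "d x" by (rule metric[OF z'(2)])
    define \<epsilon> where "\<epsilon> = d x y y' / 2"
    have y': "y' \<in> M x" using w' True by simp
    have "y \<noteq> y'" using ne z' w' True by simp
    then have \<epsilon>: "0 < \<epsilon>" using mdist_pos_less[OF _ z'(3) y'] by (simp add: \<epsilon>_def)
    show ?thesis
    proof (intro exI conjI)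
      show "openin Z (basic x y \<epsilon> (topspace X))" "openin Z (basic x y' \<epsilon> (topspace X))"
        using openin_basic[OF z'(2)] z' y' by simp_all
      show "z \<in> basic x y \<epsilon> (topspace X)" "w \<in> basic x y' \<epsilon> (topspace X)"
        using basic_self[OF z'(2) z'(3) \<epsilon>] basic_self[OF z'(2) y' \<epsilon>] z' w' True by simp_all
      show "disjnt (basic x y \<epsilon> (topspace X)) (basic x y' \<epsilon> (topspace X))"
        unfolding disjnt_iff
      proof (intro allI notI, elim conjE)
        fix r assume r: "r \<in> basic x y \<epsilon> (topspace X)" "r \<in> basic x y' \<epsilon> (topspace X)"
        obtain p q where pq: "r = (p, q)" by (cases r)
        show False
        proof (cases "p = x")
          case True
          then have q: "q \<in> M x" "d x y q < \<epsilon>" "d x y' q < \<epsilon>" using r by (auto simp: pq basic_def)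
          have "d x y y' \<le> d x y q + d x y' q" using triangle[OF z'(3) q(1) y'] commute[of q y'] by simp
          then show False using q by (simp add: \<epsilon>_def)
        next
          case False
          then have p: "p \<in> topspace X" "D x y p < \<epsilon>" "D x y' p < \<epsilon>" using r by (auto simp: pq basic_def)
          have "d x y y' \<le> D x y p + D x y' p" using D_triangle[OF z'(2) p(1) z'(3) y'] by simp
          then show False using p by (simp add: \<epsilon>_def)
        qed
      qed
    qed
  qed
qed

text \<open>The local fact behind compactness and full closedness. Finitely many balls cover
  \<open>M x\<close>; a point \<open>p\<close> close to \<open>x\<close> has some \<open>y'\<close>
  with small \<open>D x y' p\<close>, and the ball containing \<open>y'\<close> singles out a member
  that contains the fibre over \<open>p\<close>.\<close>

lemma fibre_cover:
  assumes x: "x \<in> topspace X" and \<U>: "\<And>U. U \<in> \<U> \<Longrightarrow> openin Z U" "{x} \<times> M x \<subseteq> \<Union>\<U>"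
  shows "\<exists>\<V> V. finite \<V> \<and> \<V> \<subseteq> \<U> \<and> openin X V \<and> x \<in> V \<and> {x} \<times> M x \<subseteq> \<Union>\<V> \<and>
    (\<forall>p\<in>V - {x}. \<exists>U\<in>\<V>. {p} \<times> M p \<subseteq> U)"
proof -
  interpret Metric_space "M x" "d x" by (rule metric[OF x])
  have cpt: "compact_space mtopology" using continuum_M[OF x] by (simp add: continuum_def)
  \<comment> \<open>Twice the radius is reserved: one half for the ball around \<open>y\<close> that
    contains \<open>y'\<close>, the other for the distance between \<open>y'\<close> and
    \<open>p\<close>.\<close>
  have "\<exists>U \<epsilon> V. U \<in> \<U> \<and> 0 < \<epsilon> \<and> openin X V \<and> x \<in> V \<and> (\<forall>y'\<in>M x. d x y y' < 2 * \<epsilon> \<longrightarrow> (x, y') \<in> U) \<and>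
      (\<forall>p\<in>V - {x}. D x y p < 2 * \<epsilon> \<longrightarrow> {p} \<times> M p \<subseteq> U)" if y: "y \<in> M x" for y
  proof -
    obtain U where U: "U \<in> \<U>" "(x, y) \<in> U" using \<U>(2) y by blast
    obtain \<epsilon> V where "0 < \<epsilon>" "openin X V" "x \<in> V" "\<And>y'. y' \<in> M x \<Longrightarrow> d x y y' < \<epsilon> \<Longrightarrow> (x, y') \<in> U"
      "\<And>p. p \<in> V - {x} \<Longrightarrow> D x y p < \<epsilon> \<Longrightarrow> {p} \<times> M p \<subseteq> U"
      by (rule nbhd_in_open[OF \<U>(1)[OF U(1)] U(2)]) (rule that)
    then show ?thesis using U(1) by (intro exI[of _ U] exI[of _ "\<epsilon> / 2"] exI[of _ V]) simp
  qed
  then obtain u e v where uev: "\<And>y. y \<in> M x \<Longrightarrow> u y \<in> \<U> \<and> 0 < e y \<and> openin X (v y) \<and> x \<in> v y \<and>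
      (\<forall>y'\<in>M x. d x y y' < 2 * e y \<longrightarrow> (x, y') \<in> u y) \<and>
      (\<forall>p\<in>v y - {x}. D x y p < 2 * e y \<longrightarrow> {p} \<times> M p \<subseteq> u y)" by metis
  let ?b = "\<lambda>y. mball y (e y)"
  have "\<exists>\<F>. finite \<F> \<and> \<F> \<subseteq> ?b ` M x \<and> topspace mtopology \<subseteq> \<Union>\<F>"
    by (rule compactinD[OF cpt[unfolded compact_space_def]]) (use uev in auto)
  then obtain \<F> where \<F>: "finite \<F>" "\<F> \<subseteq> ?b ` M x" "topspace mtopology \<subseteq> \<Union>\<F>" by blast
  obtain T where "T \<subseteq> M x" "finite T" "\<F> = ?b ` T" using finite_subset_image[OF \<F>(1,2)] by blast
  then have T: "finite T" "T \<subseteq> M x" "M x \<subseteq> (\<Union>y\<in>T. ?b y)" using \<F>(3) by simp_all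
  obtain y0 where y0: "y0 \<in> M x" using continuum_M[OF x] by (auto simp: continuum_def)
  then have neT: "T \<noteq> {}" using T(3) by auto
  define \<delta> where "\<delta> = Min (e ` T)"
  have \<delta>: "0 < \<delta>" "\<And>y. y \<in> T \<Longrightarrow> \<delta> \<le> e y" using T(1,2) neT uev by (auto simp: \<delta>_def)
  obtain V0 where V0: "openin X V0" "x \<in> V0" "\<forall>p\<in>V0 - {x}. \<exists>y\<in>M x. D x y p < \<delta>"
    using D_near[OF x \<delta>(1)] by blast
  define V where "V = V0 \<inter> (\<Inter>y\<in>T. v y)"
  have "openin X (\<Inter>y\<in>T. v y)" using T(1,2) neT uev by (intro openin_Inter) auto
  then have V: "openin X V" "x \<in> V" unfolding V_def using V0 uev T(2) by auto
  have "\<exists>y\<in>T. y' \<in> M x \<and> d x y y' < e y" if "y' \<in> M x" for y'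
  proof -
    have "y' \<in> (\<Union>y\<in>T. ?b y)" using T(3) that by blast
    then show ?thesis by auto
  qed
  then have cov: "\<And>y'. y' \<in> M x \<Longrightarrow> \<exists>y\<in>T. d x y y' < e y" by blast
  show ?thesis
  proof (intro exI[of _ "u ` T"] exI[of _ V] conjI ballI)
    show "finite (u ` T)" "u ` T \<subseteq> \<U>" using T uev by auto
    show "{x} \<times> M x \<subseteq> \<Union>(u ` T)"
    proof clarsimp
      fix y' assume y': "y' \<in> M x"
      then obtain y where y: "y \<in> T" "d x y y' < e y" using cov by blast
      have "0 < e y" "y \<in> M x" using uev T(2) y(1) by auto
      then show "\<exists>y\<in>T. (x, y') \<in> u y" using uev[of y] y y' by (intro bexI[of _ y]) auto
    qed
    fix p assume p: "p \<in> V - {x}"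
    then have pX: "p \<in> topspace X" using V(1) openin_subset by blast
    obtain y' where y': "y' \<in> M x" "D x y' p < \<delta>" using V0(3) p by (auto simp: V_def)
    then obtain y where y: "y \<in> T" "d x y y' < e y" using cov by blast
    have yM: "y \<in> M x" using T(2) y(1) by blast
    have "D x y p \<le> d x y y' + D x y' p" using D_triangle[OF x pX yM y'(1)] by simp
    then have "D x y p < 2 * e y" using y y' \<delta>(2)[OF y(1)] by simp
    moreover have "p \<in> v y - {x}" using p y(1) by (auto simp: V_def)
    ultimately show "\<exists>U\<in>u ` T. {p} \<times> M p \<subseteq> U" using uev[OF yM] y(1) by blast
  qed (use V in auto)
qed

text \<open>Finitely many of the neighbourhoods from \<open>fibre_cover\<close> cover
  \<open>X\<close>, and the finite subfamilies attached to them cover \<open>Z\<close>.\<close>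

lemma compact_Z: "compact_space Z"
  unfolding compact_space_alt
proof (intro allI impI)
  fix \<U> assume "(\<forall>U\<in>\<U>. openin Z U) \<and> topspace Z \<subseteq> \<Union>\<U>"
  then have \<U>: "\<And>U. U \<in> \<U> \<Longrightarrow> openin Z U" "topspace Z \<subseteq> \<Union>\<U>" by auto
  have sub: "{x} \<times> M x \<subseteq> \<Union>\<U>" if "x \<in> topspace X" for x
  proof -
    have "{x} \<times> M x \<subseteq> topspace Z" using that by (auto simp: topspace_Z)
    then show ?thesis using \<U>(2) by blast
  qed
  have cover: "\<forall>x\<in>topspace X. \<exists>\<V> V. finite \<V> \<and> \<V> \<subseteq> \<U> \<and> openin X V \<and> x \<in> V \<and> {x} \<times> M x \<subseteq> \<Union>\<V> \<and>
      (\<forall>p\<in>V - {x}. \<exists>U\<in>\<V>. {p} \<times> M p \<subseteq> U)"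
    using fibre_cover[OF _ \<U>(1) sub] by simp
  obtain c V where cV: "\<And>x. x \<in> topspace X \<Longrightarrow> finite (c x) \<and> c x \<subseteq> \<U> \<and> openin X (V x) \<and> x \<in> V x \<and>
      {x} \<times> M x \<subseteq> \<Union>(c x) \<and> (\<forall>p\<in>V x - {x}. \<exists>U\<in>c x. {p} \<times> M p \<subseteq> U)" using cover by metis
  have cptX: "compact_space X" using continuum_X by (simp add: continuum_def)
  have "\<exists>\<F>. finite \<F> \<and> \<F> \<subseteq> V ` topspace X \<and> topspace X \<subseteq> \<Union>\<F>"
    by (rule compactinD[OF cptX[unfolded compact_space_def]]) (use cV in auto)
  then obtain T where T: "finite T" "T \<subseteq> topspace X" "topspace X \<subseteq> (\<Union>x\<in>T. V x)"
    by (metis finite_subset_image)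
  show "\<exists>\<F>. finite \<F> \<and> \<F> \<subseteq> \<U> \<and> topspace Z \<subseteq> \<Union>\<F>"
  proof (intro exI[of _ "\<Union>(c ` T)"] conjI)
    show "finite (\<Union>(c ` T))" using T cV by (intro finite_UN_I) auto
    show "\<Union>(c ` T) \<subseteq> \<U>" using T cV by blast
    show "topspace Z \<subseteq> \<Union>(\<Union>(c ` T))"
    proof
      fix z assume "z \<in> topspace Z"
      then obtain p q where z: "z = (p, q)" "p \<in> topspace X" "q \<in> M p" by (auto simp: topspace_Z)
      obtain x where x: "x \<in> T" "p \<in> V x" using T(3) z(2) by blast
      have "x \<in> topspace X" using x(1) T(2) by blast
      note cVx = cV[OF this]
      have "\<exists>U\<in>c x. z \<in> U"
      proof (cases "p = x")
        case True
        then have "z \<in> {x} \<times> M x" using z by simp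
        then show ?thesis using cVx by blast
      next
        case False
        then obtain U where "U \<in> c x" "{p} \<times> M p \<subseteq> U" using cVx x(2) by blast
        then show ?thesis using z by blast
      qed
      then show "z \<in> \<Union>(\<Union>(c ` T))" using x(1) by blast
    qed
  qed
qed

lemma closed_fst: "closed_map Z X fst"
  using compact_Z continuum_X continuous_fst by (simp add: continuous_imp_closed_map continuum_def)

lemma fst_topspace: "fst ` topspace Z = topspace X"
proof
  show "topspace X \<subseteq> fst ` topspace Z"
  proof
    fix x assume x: "x \<in> topspace X"
    interpret Metric_space "M x" "d x" by (rule metric[OF x])
    obtain y where "y \<in> M x" using continuum_M[OF x] by (auto simp: continuum_def)
    then show "x \<in> fst ` topspace Z" using x by (force simp: topspace_Z)
  qed
qed (auto simp: topspace_Z)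

lemma fibre_homeomorphic:
  assumes x: "x \<in> topspace X"
  shows "Metric_space.mtopology (M x) (d x) homeomorphic_space fibre Z fst x"
proof -
  interpret Metric_space "M x" "d x" by (rule metric[OF x])
  have cpt: "compact_space mtopology" using continuum_M[OF x] by (simp add: continuum_def)
  have cont: "continuous_map mtopology Z (\<lambda>y. (x, y))"
    unfolding continuous_map_def
  proof (intro conjI allI impI)
    show "(\<lambda>y. (x, y)) \<in> topspace mtopology \<rightarrow> topspace Z" using x by (auto simp: topspace_Z)
    fix W assume W: "openin Z W"
    show "openin mtopology {y \<in> topspace mtopology. (x, y) \<in> W}"
      unfolding openin_mtopology
    proof (intro conjI allI impI)
      fix y assume y: "y \<in> {y \<in> topspace mtopology. (x, y) \<in> W}"
      then have "(x, y) \<in> W" by simp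
      then obtain \<epsilon> V where "0 < \<epsilon>" "openin X V" "x \<in> V" "\<And>y'. y' \<in> M x \<Longrightarrow> d x y y' < \<epsilon> \<Longrightarrow> (x, y') \<in> W"
        "\<And>p. p \<in> V - {x} \<Longrightarrow> D x y p < \<epsilon> \<Longrightarrow> {p} \<times> M p \<subseteq> W"
        by (rule nbhd_in_open[OF W]) (rule that)
      then show "\<exists>r>0. mball y r \<subseteq> {y \<in> topspace mtopology. (x, y) \<in> W}"
        by (intro exI[of _ \<epsilon>]) auto
    qed auto
  qed
  have "closed_map mtopology Z (\<lambda>y. (x, y))"
    using cpt Hausdorff_Z cont by (simp add: continuous_imp_closed_map)
  then have "embedding_map mtopology Z (\<lambda>y. (x, y))"
    using cont by (intro injective_closed_imp_embedding_map) (auto simp: inj_on_def)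
  then have "mtopology homeomorphic_space subtopology Z ((\<lambda>y. (x, y)) ` topspace mtopology)"
    by (rule embedding_map_imp_homeomorphic_space)
  moreover have "(\<lambda>y. (x, y)) ` topspace mtopology = {z \<in> topspace Z. fst z = x}"
    using x by (auto simp: topspace_Z)
  ultimately show ?thesis by (simp add: fibre_def)
qed

text \<open>Apply \<open>fibre_cover\<close> to the complements of \<open>F\<close> and
  \<open>G\<close>: near \<open>x\<close> every other fibre lies in one of them, so its base point
  is not in both images.\<close>

lemma fully_closed_fst: "fully_closed Z X fst"
  unfolding fully_closed_def
proof (intro allI impI, elim conjE)
  fix F G assume FG: "closedin Z F" "closedin Z G" "disjnt F G"
  let ?S = "fst ` F \<inter> fst ` G"
  have SX: "?S \<subseteq> topspace X" using closedin_subset[OF FG(1)] by (auto simp: topspace_Z)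
  have "openin (subtopology X ?S) {x}" if x: "x \<in> ?S" for x
  proof -
    have xX: "x \<in> topspace X" using x SX by blast
    have "{x} \<times> M x \<subseteq> topspace Z" using xX by (auto simp: topspace_Z)
    then have "{x} \<times> M x \<subseteq> \<Union>{topspace Z - F, topspace Z - G}" using FG(3) by (auto simp: disjnt_iff)
    moreover have "openin Z U" if "U \<in> {topspace Z - F, topspace Z - G}" for U using that FG(1,2) by blast
    ultimately have "\<exists>\<V> V. finite \<V> \<and> \<V> \<subseteq> {topspace Z - F, topspace Z - G} \<and> openin X V \<and> x \<in> V \<and>
        {x} \<times> M x \<subseteq> \<Union>\<V> \<and> (\<forall>p\<in>V - {x}. \<exists>U\<in>\<V>. {p} \<times> M p \<subseteq> U)"
      by (intro fibre_cover[OF xX])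
    then obtain \<V> V where "\<V> \<subseteq> {topspace Z - F, topspace Z - G}" and V: "openin X V" "x \<in> V"
      and "\<forall>p\<in>V - {x}. \<exists>U\<in>\<V>. {p} \<times> M p \<subseteq> U" by (elim exE conjE)
    then have V3: "{p} \<times> M p \<subseteq> topspace Z - F \<or> {p} \<times> M p \<subseteq> topspace Z - G" if "p \<in> V - {x}" for p
      using that by blast
    have "V \<inter> ?S \<subseteq> {x}"
    proof
      fix p assume p: "p \<in> V \<inter> ?S"
      then obtain q q' where q: "(p, q) \<in> F" "(p, q') \<in> G" by auto
      then have "q \<in> M p" "q' \<in> M p" using FG(1,2) closedin_subset topspace_Z by fastforce+
      then show "p \<in> {x}" using V3[of p] p q by blast
    qed
    then have "{x} = V \<inter> ?S" using x V(2) by blast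
    then show ?thesis using V(1) by (auto simp: openin_subtopology)
  qed
  moreover have "topspace (subtopology X ?S) = ?S" using SX by auto
  ultimately show "subtopology X ?S = discrete_topology ?S"
    by (metis discrete_topology_unique)
qed

text \<open>A frontier point \<open>p\<close> of the set from \<open>D_ring\<close> has small
  \<open>D x y p\<close>, so its entire fibre belongs to the given neighbourhood.\<close>

lemma ring_like_fst: "ring_like Z X fst"
  unfolding ring_like_def
proof (intro ballI allI impI, elim conjE)
  fix z U V assume z: "z \<in> topspace Z" and U: "openin Z U" "z \<in> U" and V: "openin X V" "fst z \<in> V"
  obtain x y where xy: "z = (x, y)" "x \<in> topspace X" "y \<in> M x" using z by (auto simp: topspace_Z)
  have "(x, y) \<in> U" using U xy by simp
  then obtain \<epsilon> V0 where V0: "0 < \<epsilon>" "openin X V0" "x \<in> V0" "\<And>y'. y' \<in> M x \<Longrightarrow> d x y y' < \<epsilon> \<Longrightarrow> (x, y') \<in> U"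
    "\<And>p. p \<in> V0 - {x} \<Longrightarrow> D x y p < \<epsilon> \<Longrightarrow> {p} \<times> M p \<subseteq> U"
    by (rule nbhd_in_open[OF U(1)]) (rule that)
  have "openin X (V \<inter> V0)" "x \<in> V \<inter> V0" using V V0 xy by auto
  then obtain W where W: "openin X W" "x \<in> W" "W \<subseteq> V \<inter> V0"
    "\<And>p. p \<in> X frontier_of W \<Longrightarrow> p \<in> (V \<inter> V0) - {x} \<and> D x y p < \<epsilon>"
    using D_ring[OF xy(2,3) V0(1), of "V \<inter> V0"] by blast
  have "{z \<in> topspace Z. fst z \<in> X frontier_of W} \<subseteq> U"
  proof clarify
    fix p q assume "(p, q) \<in> topspace Z" "fst (p, q) \<in> X frontier_of W"
    then show "(p, q) \<in> U" using W(4)[of p] V0(5)[of p] by (auto simp: topspace_Z)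
  qed
  then show "\<exists>V'. openin X V' \<and> fst z \<in> V' \<and> V' \<subseteq> V \<and> {z \<in> topspace Z. fst z \<in> X frontier_of V'} \<subseteq> U"
    using W xy by (intro exI[of _ W]) auto
qed

text \<open>Connected fibres over a connected base suffice because \<open>fst\<close> is a quotient
  map.\<close>

lemma connected_Z: "connected_space Z"
proof -
  have "connectedin Z {z \<in> topspace Z. fst z = x}" if x: "x \<in> topspace X" for x
  proof -
    have "connected_space (fibre Z fst x)"
      using continuum_M[OF x] homeomorphic_connected_space[OF fibre_homeomorphic[OF x]] by (simp add: continuum_def)
    then show ?thesis by (auto simp: fibre_def connectedin_def)
  qed
  then have "monotone_map Z X fst" by (simp add: monotone_map_def fst_topspace)
  moreover have "quotient_map Z X fst"
    using continuous_fst closed_fst fst_topspace by (rule continuous_closed_imp_quotient_map)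
  moreover have "connected_space X" using continuum_X by (simp add: continuum_def)
  ultimately show ?thesis by (rule connected_space_monotone_quotient_map_preimage)
qed

lemma first_countable_Z: "first_countable Z"
  unfolding first_countable_def
proof
  fix z assume z: "z \<in> topspace Z"
  obtain x y where xy: "z = (x, y)" "x \<in> topspace X" "y \<in> M x" using z by (auto simp: topspace_Z)
  obtain \<B> where \<B>: "countable \<B>" "\<And>V. V \<in> \<B> \<Longrightarrow> openin X V"
    "\<And>U. openin X U \<Longrightarrow> x \<in> U \<Longrightarrow> \<exists>V\<in>\<B>. x \<in> V \<and> V \<subseteq> U"
    using first_countable_X xy(2) unfolding first_countable_def by metis
  let ?C = "(\<lambda>(V, n). basic x y (inverse (Suc n)) V) ` ({V \<in> \<B>. x \<in> V} \<times> (UNIV :: nat set))"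
  show "\<exists>\<C>. countable \<C> \<and> (\<forall>V\<in>\<C>. openin Z V) \<and> (\<forall>U. openin Z U \<and> z \<in> U \<longrightarrow> (\<exists>V\<in>\<C>. z \<in> V \<and> V \<subseteq> U))"
  proof (intro exI[of _ ?C] conjI allI impI)
    show "countable ?C" using \<B>(1) by (intro countable_image countable_SIGMA) auto
    show "\<forall>V\<in>?C. openin Z V" using openin_basic[OF xy(2,3)] \<B>(2) by auto
    fix U assume U: "openin Z U \<and> z \<in> U"
    then have "openin Z U" "(x, y) \<in> U" using xy by auto
    then obtain \<epsilon> V where V: "0 < \<epsilon>" "openin X V" "x \<in> V" "\<And>y'. y' \<in> M x \<Longrightarrow> d x y y' < \<epsilon> \<Longrightarrow> (x, y') \<in> U"
      "\<And>p. p \<in> V - {x} \<Longrightarrow> D x y p < \<epsilon> \<Longrightarrow> {p} \<times> M p \<subseteq> U"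
      by (rule nbhd_in_open) (rule that)
    obtain B where B: "B \<in> \<B>" "x \<in> B" "B \<subseteq> V" using \<B>(3)[OF V(2,3)] by blast
    obtain n where n: "inverse (Suc n) < \<epsilon>" using reals_Archimedean[OF V(1)] by blast
    have "basic x y (inverse (Suc n)) B \<subseteq> U"
    proof clarify
      fix p q assume pq: "(p, q) \<in> basic x y (inverse (Suc n)) B"
      show "(p, q) \<in> U"
      proof (cases "p = x")
        case True then show ?thesis using pq n V(4)[of q] by (simp add: basic_def)
      next
        case False
        then show ?thesis using pq n V(5)[of p] B(3) by (auto simp: basic_def)
      qed
    qed
    moreover have "z \<in> basic x y (inverse (Suc n)) B" using basic_self[OF xy(2,3)] xy(1) by simp
    ultimately show "\<exists>V\<in>?C. z \<in> V \<and> V \<subseteq> U" using B by (intro bexI[of _ "basic x y (inverse (Suc n)) B"]) auto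
  qed
qed

lemma continuum_Z: "continuum Z"
  unfolding continuum_def using compact_Z Hausdorff_Z connected_Z fst_topspace continuum_X
  by (metis continuum_def image_is_empty)

end

text \<open>\<open>D y p\<close> is the value at \<open>y\<close> of the ray at time
  \<open>g p\<close>. This time tends to infinity as \<open>p\<close> approaches \<open>x\<close>,
  which gives nearness to \<open>M\<close>; the ray returns close to \<open>y\<close> at arbitrarily
  late times, and a level set of \<open>g\<close> at such a time bounds a ring.\<close>

lemma resolution_distance:
  assumes X: "normal_space X" "Hausdorff_space X" "first_countable X" "x \<in> topspace X"
    and M: "Metric_space M d" "continuum (Metric_space.mtopology M d)"
  shows "\<exists>D. (\<forall>y\<in>M. continuous_map (subtopology X (topspace X - {x})) euclideanreal (D y)) \<and>
    (\<forall>p\<in>topspace X. \<forall>y\<in>M. \<forall>y'\<in>M. D y p \<le> d y y' + D y' p \<and> d y y' \<le> D y p + D y' p) \<and>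
    (\<forall>\<epsilon>>0. \<exists>V. openin X V \<and> x \<in> V \<and> (\<forall>p\<in>V - {x}. \<exists>y\<in>M. D y p < \<epsilon>)) \<and>
    (\<forall>y\<in>M. \<forall>\<epsilon>>0. \<forall>V. openin X V \<and> x \<in> V \<longrightarrow>
      (\<exists>W. openin X W \<and> x \<in> W \<and> W \<subseteq> V \<and> (\<forall>p\<in>X frontier_of W. p \<in> V - {x} \<and> D y p < \<epsilon>)))"
proof -
  interpret Metric_space M d by (rule M)
  have M': "compact_space mtopology" "connected_space mtopology" "M \<noteq> {}"
    using M(2) by (auto simp: continuum_def)
  obtain \<phi> :: "real \<Rightarrow> 'b \<Rightarrow> real" where ray: "\<forall>y. continuous_on {0..} (\<lambda>t. \<phi> t y)" "\<forall>t\<ge>0. asymptotic_distance (\<phi> t)"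
    "\<forall>\<epsilon>>0. \<exists>N. \<forall>t\<ge>N. \<exists>y\<in>M. \<phi> t y < \<epsilon>" "\<forall>y\<in>M. \<forall>\<epsilon>>0. \<forall>N. \<exists>t\<ge>N. \<phi> t y < \<epsilon>"
    using approximating_ray[OF M'] by (elim exE conjE)
  note \<phi> = ray[rule_format]
  obtain g :: "'a \<Rightarrow> real" where g: "continuous_map (subtopology X (topspace X - {x})) euclideanreal g"
    "\<And>p. p \<in> topspace X \<Longrightarrow> 0 \<le> g p"
    "\<And>U. openin X U \<Longrightarrow> x \<in> U \<Longrightarrow> \<exists>N. \<forall>p\<in>topspace X - {x}. N < g p \<longrightarrow> p \<in> U"
    "\<And>N. \<exists>U. openin X U \<and> x \<in> U \<and> (\<forall>p\<in>U - {x}. N < g p)"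
    by (rule proper_function_at_point[OF X]) (rule that)
  have off: "openin X (topspace X - {x})" using X(2,4) by (simp add: closedin_Hausdorff_singleton openin_diff)
  have op_g: "openin X {p \<in> topspace X - {x}. g p \<in> U}" if "open U" for U
  proof -
    have "openin (subtopology X (topspace X - {x})) {p \<in> topspace (subtopology X (topspace X - {x})). g p \<in> U}"
      by (rule openin_continuous_map_preimage[OF g(1)]) (use that in simp)
    moreover have "{p \<in> topspace (subtopology X (topspace X - {x})). g p \<in> U} = {p \<in> topspace X - {x}. g p \<in> U}"
      by auto
    ultimately show ?thesis using off by (metis openin_trans_full)
  qed
  define D where "D y p = \<phi> (g p) y" for y p
  have cont: "continuous_map (subtopology X (topspace X - {x})) euclideanreal (D y)" for y
  proof -
    have "continuous_map (subtopology X (topspace X - {x})) (top_of_set {0..}) g"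
      using g(1,2) by (auto simp: continuous_map_in_subtopology)
    moreover have "continuous_map (top_of_set {0..}) euclideanreal (\<lambda>t. \<phi> t y)" using \<phi>(1) by simp
    ultimately show ?thesis using continuous_map_compose unfolding D_def comp_def by blast
  qed
  have tri: "D y p \<le> d y y' + D y' p \<and> d y y' \<le> D y p + D y' p" if "p \<in> topspace X" "y \<in> M" "y' \<in> M" for y y' p
    using \<phi>(2)[OF g(2)[OF that(1)]] that(2,3) unfolding asymptotic_distance_def D_def by blast
  have near: "\<exists>V. openin X V \<and> x \<in> V \<and> (\<forall>p\<in>V - {x}. \<exists>y\<in>M. D y p < \<epsilon>)" if \<epsilon>: "0 < \<epsilon>" for \<epsilon>
  proof -
    obtain N where N: "\<And>t. N \<le> t \<Longrightarrow> \<exists>y\<in>M. \<phi> t y < \<epsilon>" using ray(3) \<epsilon> by blast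
    obtain V where V: "openin X V" "x \<in> V" "\<forall>p\<in>V - {x}. N < g p" using g(4)[of N] by blast
    have "\<exists>y\<in>M. D y p < \<epsilon>" if "p \<in> V - {x}" for p
    proof -
      have "N < g p" using V(3) that by blast
      then show ?thesis unfolding D_def using N[of "g p"] by simp
    qed
    then show ?thesis using V(1,2) by blast
  qed
  have ring: "\<exists>W. openin X W \<and> x \<in> W \<and> W \<subseteq> V \<and> (\<forall>p\<in>X frontier_of W. p \<in> V - {x} \<and> D y p < \<epsilon>)"
    if y: "y \<in> M" and \<epsilon>: "0 < \<epsilon>" and V: "openin X V" "x \<in> V" for y \<epsilon> V
  proof -
    obtain N where N: "\<And>p. p \<in> topspace X - {x} \<Longrightarrow> N < g p \<Longrightarrow> p \<in> V" using g(3)[OF V] by blast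
    \<comment> \<open>The summand 1 makes \<open>t\<close> strictly larger than \<open>N\<close>, so
      the level set of \<open>g\<close> at \<open>t\<close> lies in \<open>V\<close>.\<close>
    obtain t where t: "N + 1 \<le> t" "\<phi> t y < \<epsilon>" using \<phi>(4)[OF y \<epsilon>, of "N + 1"] by blast
    define W where "W = insert x {p \<in> topspace X - {x}. g p \<in> {t<..}}"
    obtain U where U: "openin X U" "x \<in> U" "\<forall>p\<in>U - {x}. t < g p" using g(4)[of t] by blast
    \<comment> \<open>The set \<open>U\<close> shows that \<open>x\<close> is an interior point of
      \<open>W\<close>, which the formula for \<open>W\<close> does not reveal.\<close>
    have W_eq: "W = U \<union> {p \<in> topspace X - {x}. g p \<in> {t<..}}"
      using U openin_subset[OF U(1)] by (auto simp: W_def)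
    have opW: "openin X W"
      unfolding W_eq by (rule openin_Un[OF U(1) op_g[OF open_greaterThan]])
    have "closedin X (topspace X - {p \<in> topspace X - {x}. g p \<in> {..<t}})"
      by (rule closedin_diff[OF closedin_topspace op_g[OF open_lessThan]])
    moreover have "W \<subseteq> topspace X - {p \<in> topspace X - {x}. g p \<in> {..<t}}" using X(4) by (auto simp: W_def)
    ultimately have cl: "X closure_of W \<subseteq> topspace X - {p \<in> topspace X - {x}. g p \<in> {..<t}}"
      by (rule closure_of_minimal[rotated])
    have fr: "p \<in> topspace X - {x} \<and> g p = t" if "p \<in> X frontier_of W" for p
      using that cl unfolding frontier_of_openin[OF opW] by (auto simp: W_def not_less)
    have "p \<in> V - {x} \<and> D y p < \<epsilon>" if "p \<in> X frontier_of W" for p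
      using fr[OF that] N[of p] t by (auto simp: D_def)
    moreover have "W \<subseteq> V" using N t(1) V(2) by (auto simp: W_def)
    ultimately show ?thesis using opW by (intro exI[of _ W]) (simp add: W_def)
  qed
  show ?thesis
  proof (intro exI[of _ D] conjI[rotated] ballI allI impI)
    show "\<exists>W. openin X W \<and> x \<in> W \<and> W \<subseteq> V \<and> (\<forall>p\<in>X frontier_of W. p \<in> V - {x} \<and> D y p < \<epsilon>)"
      if "y \<in> M" "0 < \<epsilon>" "openin X V \<and> x \<in> V" for y \<epsilon> V using ring[of y \<epsilon> V] that by simp
  qed (simp_all add: cont tri near)
qed

section \<open>Existence of the resolution, and the properties of every such map\<close>

lemma resolution_exists:
  fixes X :: "'a topology" and Y :: "'a \<Rightarrow> 'b topology"
  assumes X: "continuum X" "first_countable X"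
    and Y: "\<And>x. x \<in> topspace X \<Longrightarrow> continuum (Y x) \<and> metrizable_space (Y x)"
  shows "\<exists>(Z :: ('a \<times> 'b) topology) \<pi>.
    continuum Z \<and> first_countable Z \<and> continuous_map Z X \<pi> \<and> closed_map Z X \<pi> \<and>
    (\<forall>x\<in>topspace X. fibre Z \<pi> x homeomorphic_space Y x) \<and> ring_like Z X \<pi> \<and> fully_closed Z X \<pi>"
proof -
  have "\<forall>x\<in>topspace X. \<exists>M d. Metric_space M d \<and> Y x = Metric_space.mtopology M d"
    using Y unfolding metrizable_space_def by blast
  then obtain M d where Md: "\<And>x. x \<in> topspace X \<Longrightarrow>
      Metric_space (M x) (d x) \<and> Y x = Metric_space.mtopology (M x) (d x)" by metis
  have nX: "normal_space X" "Hausdorff_space X"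
    using X(1) by (auto simp: continuum_def compact_Hausdorff_or_regular_imp_normal_space)
  have "\<forall>x\<in>topspace X. \<exists>D. (\<forall>y\<in>M x. continuous_map (subtopology X (topspace X - {x})) euclideanreal (D y)) \<and>
    (\<forall>p\<in>topspace X. \<forall>y\<in>M x. \<forall>y'\<in>M x. D y p \<le> d x y y' + D y' p \<and> d x y y' \<le> D y p + D y' p) \<and>
    (\<forall>\<epsilon>>0. \<exists>V. openin X V \<and> x \<in> V \<and> (\<forall>p\<in>V - {x}. \<exists>y\<in>M x. D y p < \<epsilon>)) \<and>
    (\<forall>y\<in>M x. \<forall>\<epsilon>>0. \<forall>V. openin X V \<and> x \<in> V \<longrightarrow>
      (\<exists>W. openin X W \<and> x \<in> W \<and> W \<subseteq> V \<and> (\<forall>p\<in>X frontier_of W. p \<in> V - {x} \<and> D y p < \<epsilon>)))"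
    (is "\<forall>x\<in>topspace X. \<exists>D. ?P x D")
  proof
    fix x assume x: "x \<in> topspace X"
    show "\<exists>D. ?P x D" by (rule resolution_distance[OF nX X(2) x]) (use Md[OF x] Y[OF x] in auto)
  qed
  from bchoice[OF this] obtain D where D: "\<forall>x\<in>topspace X. ?P x (D x)" ..
  have Dx: "?P x (D x)" if "x \<in> topspace X" for x using D that by (rule bspec)
  note D1 = Dx[THEN conjunct1, rule_format]
    and D2 = Dx[THEN conjunct2, THEN conjunct1, rule_format]
    and D3 = Dx[THEN conjunct2, THEN conjunct2, THEN conjunct1, rule_format]
    and D4 = Dx[THEN conjunct2, THEN conjunct2, THEN conjunct2, rule_format, OF _ _ _ conjI]
  interpret resolution X M d D
  proof (rule resolution.intro)
    show "Metric_space (M x) (d x)" if "x \<in> topspace X" for x using Md[OF that] by simp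
    show "continuum (Metric_space.mtopology (M x) (d x))" if "x \<in> topspace X" for x
      using Md[OF that] Y[OF that] by simp
  qed (fact X D1 D2 D3 D4)+
  show ?thesis
  proof (intro exI[of _ Z] exI[of _ fst] conjI ballI)
    show "fibre Z fst x homeomorphic_space Y x" if x: "x \<in> topspace X" for x
      using fibre_homeomorphic[OF x] Md[OF x] homeomorphic_space_sym by metis
  qed (rule continuum_Z first_countable_Z continuous_fst closed_fst ring_like_fst fully_closed_fst)+
qed

text \<open>Connectedness and metrizability of the fibres are topological invariants, and non-empty
  fibres make the map surjective.\<close>

lemma resolution_is_ring_like_surjection:
  assumes X: "continuum X"
    and Y: "\<And>x. x \<in> topspace X \<Longrightarrow> continuum (Y x) \<and> metrizable_space (Y x)"
    and Z: "continuum Z" "continuous_map Z X f" "ring_like Z X f" "fully_closed Z X f"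
    and fib: "\<And>x. x \<in> topspace X \<Longrightarrow> fibre Z f x homeomorphic_space Y x"
  shows "ring_like_surjection Z X f"
proof
  show "compact_space Z" "Hausdorff_space Z" "Hausdorff_space X" "connected_space X"
    using X Z by (auto simp: continuum_def)
  show "continuous_map Z X f" "fully_closed Z X f" "ring_like Z X f" by fact+
  show "f ` topspace Z = topspace X"
  proof
    show "f ` topspace Z \<subseteq> topspace X" using Z(2) by (auto simp: continuous_map_def)
    show "topspace X \<subseteq> f ` topspace Z"
    proof
      fix x assume x: "x \<in> topspace X"
      have "topspace (fibre Z f x) \<noteq> {}"
        using homeomorphic_empty_space[OF fib[OF x]] Y[OF x] by (simp add: continuum_def)
      then show "x \<in> f ` topspace Z" by (auto simp: fibre_def)
    qed
  qed
  show "connectedin Z {z \<in> topspace Z. f z = x}" if x: "x \<in> topspace X" for x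
    using homeomorphic_connected_space[OF fib[OF x]] Y[OF x]
    by (auto simp: continuum_def fibre_def connectedin_def)
  show "metrizable_space (fibre Z f x)" if x: "x \<in> topspace X" for x
    using homeomorphic_metrizable_space[OF fib[OF x]] Y[OF x] by simp
qed

lemma nondegenerate_homeomorphic:
  assumes "X homeomorphic_space Y" "nondegenerate Y"
  shows "nondegenerate X"
proof -
  obtain h where h: "homeomorphic_map Y X h" using assms(1) homeomorphic_space_sym homeomorphic_space by metis
  obtain a b where "a \<in> topspace Y" "b \<in> topspace Y" "a \<noteq> b" using assms(2) by (auto simp: nondegenerate_def)
  then show ?thesis
    using homeomorphic_imp_injective_map[OF h] homeomorphic_imp_surjective_map[OF h]
    unfolding nondegenerate_def inj_on_def by (metis imageI)
qed

text \<open>The type of points of the second \<open>Z\<close> is independent of the one constructed,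
  so that the properties hold for every map of this kind and not only for the resolution.\<close>

theorem theorem3p1:
  fixes X :: "'a topology" and Y :: "'a \<Rightarrow> 'b topology"
  assumes "continuum X" and "first_countable X"
    and "\<And>x. x \<in> topspace X \<Longrightarrow> continuum (Y x) \<and> metrizable_space (Y x)"
  shows
    "(\<exists>(Z :: ('a \<times> 'b) topology) \<pi>.
        continuum Z \<and> first_countable Z \<and> continuous_map Z X \<pi> \<and> closed_map Z X \<pi> \<and>
        (\<forall>x\<in>topspace X. fibre Z \<pi> x homeomorphic_space Y x) \<and>
        ring_like Z X \<pi> \<and> fully_closed Z X \<pi>)
     \<and>
     (\<forall>(Z :: 'c topology) \<pi>.
        continuum Z \<and> first_countable Z \<and> continuous_map Z X \<pi> \<and> closed_map Z X \<pi> \<and>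
        (\<forall>x\<in>topspace X. fibre Z \<pi> x homeomorphic_space Y x) \<and>
        ring_like Z X \<pi> \<and> fully_closed Z X \<pi>
        \<longrightarrow>
        covering_dim Z = max (covering_dim X) (covering_dim_map Z X \<pi>) \<and>
        (perfectly_normal X \<longrightarrow> large_ind Z \<le> large_ind X + large_ind_map Z X \<pi>) \<and>
        (separable_space X \<longrightarrow> separable_space Z) \<and>
        ((\<forall>x\<in>topspace X. nondegenerate (Y x)) \<longrightarrow>
           (\<forall>P. subcontinuum_of P Z \<and> metrizable_space (subtopology Z P) \<longrightarrow>
                (\<exists>x. \<pi> ` P = {x}))) \<and>
        (hereditarily_indecomposable X \<and>
           (\<forall>x\<in>topspace X. hereditarily_indecomposable (Y x)) \<longrightarrow>
           hereditarily_indecomposable Z) \<and>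
        (hereditarily_decomposable X \<and>
           (\<forall>x\<in>topspace X. hereditarily_decomposable (Y x)) \<longrightarrow>
           hereditarily_decomposable Z))"
proof (intro conjI[of "\<exists>Z \<pi>. A Z \<pi>" for A] allI impI, goal_cases)
  case 1
  show ?case by (rule resolution_exists) (use assms in simp_all)
next
  case (2 Z \<pi>)
  then have Z: "continuum Z" "continuous_map Z X \<pi>" "ring_like Z X \<pi>" "fully_closed Z X \<pi>"
    and fib: "\<And>x. x \<in> topspace X \<Longrightarrow> fibre Z \<pi> x homeomorphic_space Y x" by blast+
  interpret ring_like_surjection Z X \<pi>
    by (rule resolution_is_ring_like_surjection) (use assms Z fib in simp_all)
  have ne: "topspace X \<noteq> {}" "topspace Z \<noteq> {}" using assms(1) Z(1) by (simp_all add: continuum_def)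
  show ?case
  proof (intro conjI impI allI)
    show "covering_dim Z = max (covering_dim X) (covering_dim_map Z X \<pi>)"
      using ne(2) by (rule covering_dim_total)
    show "large_ind Z \<le> large_ind X + large_ind_map Z X \<pi>" if "perfectly_normal X"
      using large_ind_total[OF that ne(1) metrizable_fibre] .
    show "separable_space Z" if "separable_space X"
      using that by (rule separable_total_space)
    show "\<exists>x. \<pi> ` P = {x}"
      if nd: "\<forall>x\<in>topspace X. nondegenerate (Y x)"
        and P: "subcontinuum_of P Z \<and> metrizable_space (subtopology Z P)" for P
    proof (rule metrizable_subcontinuum_in_fibre)
      show "nondegenerate (fibre Z \<pi> x)" if "x \<in> topspace X" for x
        using nondegenerate_homeomorphic[OF fib[OF that]] nd that by blast
    qed (use P in simp_all)
    show "hereditarily_indecomposable Z"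
      if "hereditarily_indecomposable X \<and> (\<forall>x\<in>topspace X. hereditarily_indecomposable (Y x))"
      using that hereditarily_indecomposable_homeomorphic[OF _ fib]
      by (intro hereditarily_indecomposable_total_space) blast+
    show "hereditarily_decomposable Z"
      if "hereditarily_decomposable X \<and> (\<forall>x\<in>topspace X. hereditarily_decomposable (Y x))"
      using that hereditarily_decomposable_homeomorphic[OF _ fib]
      by (intro hereditarily_decomposable_total_space) blast+
  qed
qed

end
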